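(* Let $R$ be an equidimensional commutative noetherian local ring and $M$ a finitely generated $R$-module whose Betti numbers are eventually non-decreasing (i.e. there is $N_0$ with $\beta_{i}(M)\leq\beta_{i+1}(M)$ for all $i\geq N_0$). Then the sequence $(\dim(\Omega_i(M)))_{i=0}^{\infty}$ is constant for $i\gg 0$.
   Context: For a commutative noetherian local ring $R$ with maximal ideal $\mathfrak{m}$ and residue field $k=R/\mathfrak{m}$, and a finitely generated $R$-module $M$, the $i$th Betti number is $\beta_i(M)=\dim_k(\operatorname{Tor}^R_i(k,M))$, so $M$ has a minimal free resolution $\cdots\xrightarrow{\delta_3} R^{\beta_2(M)}\xrightarrow{\delta_2}R^{\beta_1(M)}\xrightarrow{\delta_1}R^{\beta_0(M)}\to 0$. The $i$th syzygy module of $M$ is $\Omega_i(M)=\operatorname{Coker}(\delta_{i+1})$ (so $\Omega_0(M)\cong M$). $\dim$ of a module is its Krull dimension. $R$ is equidimensional if $\dim(R/\mathfrak{p})=\dim(R)$ for every minimal prime $\mathfrak{p}$ of $R$. *)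

theory Defs
  imports
    "HOL-Algebra.Ring_Divisibility"
    "HOL-Library.Extended_Real"
    "Jordan_Normal_Form.Missing_VectorSpace"
begin

hide_const (open) Multiset.mult

section \<open>Local rings and Krull dimension\<close>

definition local_ring :: "('a, 'r) ring_scheme \<Rightarrow> bool" where
  "local_ring R \<longleftrightarrow> cring R \<and> (\<exists>!I. maximalideal I R)"

definition max_ideal :: "('a, 'r) ring_scheme \<Rightarrow> 'a set" where
  "max_ideal R = (THE I. maximalideal I R)"

text \<open>The supremum is taken in the extended reals, so the zero ring, which has no prime ideals,
  gets dimension \<open>-\<infinity>\<close>.\<close>

definition krull_dim :: "('a, 'r) ring_scheme \<Rightarrow> ereal" where
  "krull_dim R = Sup {ereal (real l) | l. \<exists>P :: nat \<Rightarrow> 'a set.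
     (\<forall>i\<le>l. primeideal (P i) R) \<and> (\<forall>i<l. P i \<subset> P (Suc i))}"

definition minimal_prime :: "'a set \<Rightarrow> ('a, 'r) ring_scheme \<Rightarrow> bool" where
  "minimal_prime P R \<longleftrightarrow> primeideal P R \<and> (\<forall>Q. primeideal Q R \<and> Q \<subseteq> P \<longrightarrow> Q = P)"

definition equidimensional :: "('a, 'r) ring_scheme \<Rightarrow> bool" where
  "equidimensional R \<longleftrightarrow> (\<forall>P. minimal_prime P R \<longrightarrow> krull_dim (R Quot P) = krull_dim R)"

definition annihilator :: "('a, 'r) ring_scheme \<Rightarrow> ('a, 'b, 'm) module_scheme \<Rightarrow> 'a set" where
  "annihilator R M = {a \<in> carrier R. \<forall>x \<in> carrier M. a \<odot>\<^bsub>M\<^esub> x = \<zero>\<^bsub>M\<^esub>}"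

definition module_krull_dim :: "('a, 'r) ring_scheme \<Rightarrow> ('a, 'b, 'm) module_scheme \<Rightarrow> ereal" where
  "module_krull_dim R M = krull_dim (R Quot annihilator R M)"


section \<open>Modules\<close>

text \<open>The type of modules extends that of rings; the fields \<open>mult\<close> and \<open>one\<close> of the modules
  constructed below carry no meaning.\<close>

definition fin_gen_module :: "('a, 'r) ring_scheme \<Rightarrow> ('a, 'b, 'm) module_scheme \<Rightarrow> bool" where
  "fin_gen_module R M \<longleftrightarrow>
     module R M \<and> (\<exists>S. finite S \<and> S \<subseteq> carrier M \<and> module.span R M S = carrier M)"

definition self_module :: "('a, 'r) ring_scheme \<Rightarrow> ('a, 'a) module" where
  "self_module R = \<lparr>carrier = carrier R, mult = mult R, one = \<one>\<^bsub>R\<^esub>,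
     ring.zero = \<zero>\<^bsub>R\<^esub>, add = add R, smult = mult R\<rparr>"

definition quot_module :: "('a, 'b, 'm) module_scheme \<Rightarrow> 'b set \<Rightarrow> ('a, 'b set) module" where
  "quot_module M N = \<lparr>carrier = a_rcosets\<^bsub>M\<^esub> N, mult = (\<lambda>X Y. N), one = N,
     ring.zero = N, add = set_add M, smult = (\<lambda>a X. \<Union>x\<in>X. N +>\<^bsub>M\<^esub> (a \<odot>\<^bsub>M\<^esub> x))\<rparr>"

text \<open>If an ideal \<open>I\<close> of \<open>R\<close> annihilates \<open>M\<close>, then \<open>M\<close> is a module over \<open>R Quot I\<close>: a coset acts
  through any one of its elements.\<close>

definition quot_ring_module :: "('a, 'b, 'm) module_scheme \<Rightarrow> ('a set, 'b) module" where
  "quot_ring_module M = \<lparr>carrier = carrier M, mult = mult M, one = \<one>\<^bsub>M\<^esub>,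
     ring.zero = \<zero>\<^bsub>M\<^esub>, add = add M, smult = (\<lambda>X x. (SOME a. a \<in> X) \<odot>\<^bsub>M\<^esub> x)\<rparr>"

definition free_module :: "('a, 'r) ring_scheme \<Rightarrow> 'c set \<Rightarrow> ('a, 'c \<Rightarrow> 'a) module" where
  "free_module R S = (ring.func_space R S)
     \<lparr>carrier := {f \<in> carrier (ring.func_space R S). finite {s \<in> S. f s \<noteq> \<zero>\<^bsub>R\<^esub>}}\<rparr>"

definition free_gen :: "('a, 'r) ring_scheme \<Rightarrow> 'c set \<Rightarrow> 'c \<Rightarrow> 'c \<Rightarrow> 'a" where
  "free_gen R S s = (\<lambda>t\<in>S. if t = s then \<one>\<^bsub>R\<^esub> else \<zero>\<^bsub>R\<^esub>)"

text \<open>The free module \<open>R\<^sup>n\<close>.\<close>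

abbreviation free_rank :: "('a, 'r) ring_scheme \<Rightarrow> nat \<Rightarrow> ('a, nat \<Rightarrow> 'a) module" where
  "free_rank R n \<equiv> free_module R {..<n}"


section \<open>Tensor products\<close>

text \<open>\<open>A \<otimes> B\<close> is the free module on the pairs in \<open>A \<times> B\<close> modulo the bilinearity relations.\<close>

abbreviation pair_module ::
  "('a, 'r) ring_scheme \<Rightarrow> ('a, 'b, 'm) module_scheme \<Rightarrow> ('a, 'c, 'n) module_scheme
   \<Rightarrow> ('a, 'b \<times> 'c \<Rightarrow> 'a) module" where
  "pair_module R A B \<equiv> free_module R (carrier A \<times> carrier B)"

abbreviation pair_gen ::
  "('a, 'r) ring_scheme \<Rightarrow> ('a, 'b, 'm) module_scheme \<Rightarrow> ('a, 'c, 'n) module_scheme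
   \<Rightarrow> 'b \<Rightarrow> 'c \<Rightarrow> ('b \<times> 'c \<Rightarrow> 'a)" where
  "pair_gen R A B a b \<equiv> free_gen R (carrier A \<times> carrier B) (a, b)"

inductive_set bilinear_relators ::
  "('a, 'r) ring_scheme \<Rightarrow> ('a, 'b, 'm) module_scheme \<Rightarrow> ('a, 'c, 'n) module_scheme
   \<Rightarrow> ('b \<times> 'c \<Rightarrow> 'a) set"
  for R and A and B where
  add_left: "\<lbrakk>a \<in> carrier A; a' \<in> carrier A; b \<in> carrier B\<rbrakk> \<Longrightarrow>
    pair_gen R A B (a \<oplus>\<^bsub>A\<^esub> a') b \<ominus>\<^bsub>pair_module R A B\<^esub>
      (pair_gen R A B a b \<oplus>\<^bsub>pair_module R A B\<^esub> pair_gen R A B a' b) \<in> bilinear_relators R A B"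
| add_right: "\<lbrakk>a \<in> carrier A; b \<in> carrier B; b' \<in> carrier B\<rbrakk> \<Longrightarrow>
    pair_gen R A B a (b \<oplus>\<^bsub>B\<^esub> b') \<ominus>\<^bsub>pair_module R A B\<^esub>
      (pair_gen R A B a b \<oplus>\<^bsub>pair_module R A B\<^esub> pair_gen R A B a b') \<in> bilinear_relators R A B"
| smult_left: "\<lbrakk>r \<in> carrier R; a \<in> carrier A; b \<in> carrier B\<rbrakk> \<Longrightarrow>
    pair_gen R A B (r \<odot>\<^bsub>A\<^esub> a) b \<ominus>\<^bsub>pair_module R A B\<^esub>
      (r \<odot>\<^bsub>pair_module R A B\<^esub> pair_gen R A B a b) \<in> bilinear_relators R A B"
| smult_right: "\<lbrakk>r \<in> carrier R; a \<in> carrier A; b \<in> carrier B\<rbrakk> \<Longrightarrow>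
    pair_gen R A B a (r \<odot>\<^bsub>B\<^esub> b) \<ominus>\<^bsub>pair_module R A B\<^esub>
      (r \<odot>\<^bsub>pair_module R A B\<^esub> pair_gen R A B a b) \<in> bilinear_relators R A B"

definition tensor_relations ::
  "('a, 'r) ring_scheme \<Rightarrow> ('a, 'b, 'm) module_scheme \<Rightarrow> ('a, 'c, 'n) module_scheme
   \<Rightarrow> ('b \<times> 'c \<Rightarrow> 'a) set" where
  "tensor_relations R A B = module.span R (pair_module R A B) (bilinear_relators R A B)"

definition tensor_product ::
  "('a, 'r) ring_scheme \<Rightarrow> ('a, 'b, 'm) module_scheme \<Rightarrow> ('a, 'c, 'n) module_scheme
   \<Rightarrow> ('a, ('b \<times> 'c \<Rightarrow> 'a) set) module" where
  "tensor_product R A B = quot_module (pair_module R A B) (tensor_relations R A B)"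

text \<open>For \<open>f : B \<rightarrow> C\<close>, the map \<open>id \<otimes> f : A \<otimes> B \<rightarrow> A \<otimes> C\<close> sends the class of
  \<open>\<Sum> g(a, b) (a, b)\<close> to the class of \<open>\<Sum> g(a, b) (a, f b)\<close>; the result does not depend on the
  representative \<open>g\<close>.\<close>

definition tensor_map ::
  "('a, 'r) ring_scheme \<Rightarrow> ('a, 'b, 'm) module_scheme \<Rightarrow> ('a, 'c, 'n) module_scheme
   \<Rightarrow> ('a, 'd, 'p) module_scheme \<Rightarrow> ('c \<Rightarrow> 'd)
   \<Rightarrow> ('b \<times> 'c \<Rightarrow> 'a) set \<Rightarrow> ('b \<times> 'd \<Rightarrow> 'a) set" where
  "tensor_map R A B C f X =
     (\<Union>g\<in>X. tensor_relations R A C +>\<^bsub>pair_module R A C\<^esub>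
        (\<Oplus>\<^bsub>pair_module R A C\<^esub>p\<in>{p \<in> carrier A \<times> carrier B. g p \<noteq> \<zero>\<^bsub>R\<^esub>}.
           g p \<odot>\<^bsub>pair_module R A C\<^esub> pair_gen R A C (fst p) (f (snd p))))"


section \<open>Free resolutions, Tor and Betti numbers\<close>

text \<open>A record \<open>F\<close> describes
  \<open>\<dots> \<rightarrow> R\<^bsup>rk F 2\<^esup> \<rightarrow> R\<^bsup>rk F 1\<^esup> \<rightarrow> R\<^bsup>rk F 0\<^esup> \<rightarrow> M \<rightarrow> 0\<close>, where \<open>diff F i\<close> is the map from degree \<open>i\<close> to
  degree \<open>i - 1\<close> for \<open>i \<ge> 1\<close> (the value of \<open>diff F 0\<close> is never used) and \<open>aug F\<close> is the map
  onto \<open>M\<close>.\<close>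

record ('a, 'b) free_complex =
  rk :: "nat \<Rightarrow> nat"
  diff :: "nat \<Rightarrow> (nat \<Rightarrow> 'a) \<Rightarrow> (nat \<Rightarrow> 'a)"
  aug :: "(nat \<Rightarrow> 'a) \<Rightarrow> 'b"

abbreviation res_term :: "('a, 'r) ring_scheme \<Rightarrow> ('a, 'b) free_complex \<Rightarrow> nat \<Rightarrow> ('a, nat \<Rightarrow> 'a) module"
  where "res_term R F i \<equiv> free_rank R (rk F i)"

definition free_resolution ::
  "('a, 'r) ring_scheme \<Rightarrow> ('a, 'b, 'm) module_scheme \<Rightarrow> ('a, 'b) free_complex \<Rightarrow> bool" where
  "free_resolution R M F \<longleftrightarrow>
     aug F \<in> module_hom R (res_term R F 0) M \<and>
     (\<forall>i. diff F (Suc i) \<in> module_hom R (res_term R F (Suc i)) (res_term R F i)) \<and>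
     aug F ` carrier (res_term R F 0) = carrier M \<and>
     diff F 1 ` carrier (res_term R F 1) = a_kernel (res_term R F 0) M (aug F) \<and>
     (\<forall>i. diff F (Suc (Suc i)) ` carrier (res_term R F (Suc (Suc i))) =
            a_kernel (res_term R F (Suc i)) (res_term R F i) (diff F (Suc i)))"

definition minimal_free_resolution ::
  "('a, 'r) ring_scheme \<Rightarrow> ('a, 'b, 'm) module_scheme \<Rightarrow> ('a, 'b) free_complex \<Rightarrow> bool" where
  "minimal_free_resolution R M F \<longleftrightarrow>
     free_resolution R M F \<and>
     (\<forall>i. diff F (Suc i) ` carrier (res_term R F (Suc i)) \<subseteq>
        module.span R (res_term R F i)
          {a \<odot>\<^bsub>res_term R F i\<^esub> x | a x. a \<in> max_ideal R \<and> x \<in> carrier (res_term R F i)})"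

definition syzygy :: "('a, 'r) ring_scheme \<Rightarrow> ('a, 'b) free_complex \<Rightarrow> nat \<Rightarrow> ('a, (nat \<Rightarrow> 'a) set) module"
  where "syzygy R F i =
    quot_module (res_term R F i) (diff F (Suc i) ` carrier (res_term R F (Suc i)))"

text \<open>The homology of \<open>N \<otimes> F\<close>, without the augmentation.\<close>

definition tensor_cycles ::
  "('a, 'r) ring_scheme \<Rightarrow> ('a, 'c, 'n) module_scheme \<Rightarrow> ('a, 'b) free_complex \<Rightarrow> nat
   \<Rightarrow> ('c \<times> (nat \<Rightarrow> 'a) \<Rightarrow> 'a) set set" where
  "tensor_cycles R N F i =
     (case i of 0 \<Rightarrow> carrier (tensor_product R N (res_term R F 0))
      | Suc j \<Rightarrow> a_kernel (tensor_product R N (res_term R F (Suc j))) (tensor_product R N (res_term R F j))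
                  (tensor_map R N (res_term R F (Suc j)) (res_term R F j) (diff F (Suc j))))"

definition tensor_boundaries ::
  "('a, 'r) ring_scheme \<Rightarrow> ('a, 'c, 'n) module_scheme \<Rightarrow> ('a, 'b) free_complex \<Rightarrow> nat
   \<Rightarrow> ('c \<times> (nat \<Rightarrow> 'a) \<Rightarrow> 'a) set set" where
  "tensor_boundaries R N F i =
     tensor_map R N (res_term R F (Suc i)) (res_term R F i) (diff F (Suc i)) `
       carrier (tensor_product R N (res_term R F (Suc i)))"

definition tensor_homology ::
  "('a, 'r) ring_scheme \<Rightarrow> ('a, 'c, 'n) module_scheme \<Rightarrow> ('a, 'b) free_complex \<Rightarrow> nat
   \<Rightarrow> ('a, ('c \<times> (nat \<Rightarrow> 'a) \<Rightarrow> 'a) set set) module" where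
  "tensor_homology R N F i =
     quot_module ((tensor_product R N (res_term R F i))\<lparr>carrier := tensor_cycles R N F i\<rparr>)
       (tensor_boundaries R N F i)"

text \<open>\<open>Tor\<close> is computed from an arbitrarily chosen resolution of \<open>M\<close> by free modules of finite
  rank. Such a resolution exists when \<open>R\<close> is noetherian and \<open>M\<close> is finitely generated, and up to
  isomorphism the result does not depend on the choice.\<close>

definition Tor ::
  "('a, 'r) ring_scheme \<Rightarrow> nat \<Rightarrow> ('a, 'c, 'n) module_scheme \<Rightarrow> ('a, 'b, 'm) module_scheme
   \<Rightarrow> ('a, ('c \<times> (nat \<Rightarrow> 'a) \<Rightarrow> 'a) set set) module" where
  "Tor R i N M = tensor_homology R N (SOME F. free_resolution R M F) i"

text \<open>The residue field as an \<open>R\<close>-module.\<close>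

definition residue_module :: "('a, 'r) ring_scheme \<Rightarrow> ('a, 'a set) module" where
  "residue_module R = quot_module (self_module R) (max_ideal R)"

definition betti :: "('a, 'r) ring_scheme \<Rightarrow> ('a, 'b, 'm) module_scheme \<Rightarrow> nat \<Rightarrow> nat" where
  "betti R M i = vectorspace.dim (R Quot max_ideal R)
     (quot_ring_module (Tor R i (residue_module R) M))"

end

theory Submission
  imports Defs "HOL-Library.Extended_Nat"
begin

text \<open>For a prime ideal \<open>P\<close> let \<open>\<omega>\<^sub>i\<close> be the length of \<open>\<Omega>\<^sub>i(M)\<^sub>P\<close> and \<open>L\<close> the length of \<open>R\<^sub>P\<close>; then
  \<open>\<omega>\<^sub>i + \<omega>\<^sub>i\<^sub>+\<^sub>1 = \<beta>\<^sub>i L\<close>. At a minimal prime \<open>P\<close> these lengths are finite, so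
  \<open>\<omega>\<^sub>i\<^sub>+\<^sub>2 = \<omega>\<^sub>i + (\<beta>\<^sub>i\<^sub>+\<^sub>1 - \<beta>\<^sub>i) L \<ge> \<omega>\<^sub>i\<close> for large \<open>i\<close>: once \<open>\<Omega>\<^sub>i(M)\<close> has a minimal prime in its support,
  so does \<open>\<Omega>\<^sub>i\<^sub>+\<^sub>2(M)\<close>, and by equidimensionality both have dimension \<open>dim R\<close>.

  It remains to exclude that the nonzero modules \<open>\<Omega>\<^sub>i(M)\<close> of one parity have no minimal prime in their
  support. In that case \<open>\<beta>\<^sub>i\<^sub>+\<^sub>1 = \<beta>\<^sub>i\<close> for these \<open>i\<close>, so that \<open>\<Omega>\<^sub>i\<^sub>+\<^sub>2(M)\<close> and \<open>\<Omega>\<^sub>i(M)\<close> are the kernel and the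
  cokernel of an endomorphism \<open>f\<close> of \<open>X = R\<^sup>n\<close>. If \<open>K\<close> is the generalised kernel of \<open>f\<close> and \<open>\<omega>\<^sub>i\<close> is
  finite, then \<open>\<omega>\<^sub>i\<close> exceeds \<open>\<omega>\<^sub>i\<^sub>+\<^sub>2\<close> by the length of \<open>X / (K + f X)\<close> at \<open>P\<close>. When \<open>P\<close> is not minimal,
  \<open>K \<subseteq> P X\<close> because \<open>R\<^sub>P\<close> has infinite length, and this difference is positive by Nakayama's lemma.
  Hence the supports decrease, and at a minimal prime of the eventual support the finite nonzero
  lengths \<open>\<omega>\<^sub>i\<close> decrease strictly for ever.

  Localisations are avoided: lengths at \<open>P\<close> are measured by chains of submodules of the unlocalised
  modules. That \<open>\<beta>\<^sub>i\<close> is the rank of the \<open>i\<close>th term of a minimal resolution follows by comparing it, up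
  to homotopy, with the resolution chosen in the definition of \<open>Tor\<close>.\<close>

section \<open>Lengths at a prime ideal\<close>

text \<open>Additivity along a resolution relates only syzygies two steps apart, hence the
  separation of parities. At a non-minimal prime \<open>L\<close> is infinite and the identity says
  nothing, yet the descent must happen exactly there, since the bad parity has no minimal prime in
  its support. A square matrix replaces the counting: at a minimal prime both \<omega>_i and
  \<omega>_(i+2) vanish, so that \<beta>_i \<open>L\<close> = \<omega>_(i+1) = \<beta>_(i+1)
  \<open>L\<close>, and the equal ranks turn the differential into an endomorphism.

  Two facts make lengths at \<open>P\<close> subtractable. \<open>P\<close> is taken minimal over
  the annihilator of one syzygy, so \<omega>_i is finite there; and \<open>K\<close> meets a high
  image f^k X only in 0, so \<open>K\<close> embeds into X / f^k X, whose length is a sum of k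
  lengths bounded by that of X / f X. A coordinate of an element of \<open>K\<close> outside
  \<open>P\<close> would then bound the length of R_P, which is how infinite length forces
  \<open>K\<close> into P X.

  Minimality of the resolution enters twice: ranks become Betti numbers, and a syzygy that vanishes
  stays zero, so that the zero modules are a separate, easy case.\<close>

definition local_le ::
  "('a, 'r) ring_scheme \<Rightarrow> 'a set \<Rightarrow> ('a, 'b, 'm) module_scheme \<Rightarrow> 'b set \<Rightarrow> 'b set \<Rightarrow> bool" where
  "local_le R P X A B \<longleftrightarrow> (\<forall>x\<in>A. \<exists>s\<in>carrier R - P. s \<odot>\<^bsub>X\<^esub> x \<in> B)"

text \<open>For submodules, \<open>local_le\<close> is inclusion after localising at
  \<open>P\<close>. Steps must be strict after localising but nested before; nothing is lost, since
  a chain of submodules of the localised \<open>B / A\<close> has nested preimages in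
  \<open>B\<close>.\<close>

definition local_chain ::
  "('a, 'r) ring_scheme \<Rightarrow> 'a set \<Rightarrow> ('a, 'b, 'm) module_scheme \<Rightarrow> 'b set \<Rightarrow> 'b set
    \<Rightarrow> nat \<Rightarrow> (nat \<Rightarrow> 'b set) \<Rightarrow> bool" where
  "local_chain R P X A B k C \<longleftrightarrow>
     (\<forall>j\<le>k. submodule R (C j) X \<and> A \<subseteq> C j \<and> C j \<subseteq> B) \<and>
     (\<forall>j<k. C j \<subseteq> C (Suc j) \<and> \<not> local_le R P X (C (Suc j)) (C j))"

text \<open>For submodules \<open>A \<subseteq> B\<close> this is the length of the localisation of \<open>B / A\<close> at \<open>P\<close>: submodules of a
  localised module correspond to submodules up to mutual \<^const>\<open>local_le\<close>.\<close>

definition local_length ::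
  "('a, 'r) ring_scheme \<Rightarrow> 'a set \<Rightarrow> ('a, 'b, 'm) module_scheme \<Rightarrow> 'b set \<Rightarrow> 'b set \<Rightarrow> enat" where
  "local_length R P X A B = Sup {enat k | k. \<exists>C. local_chain R P X A B k C}"

lemma local_chainD:
  assumes "local_chain R P X A B k C"
  shows "j \<le> k \<Longrightarrow> submodule R (C j) X \<and> A \<subseteq> C j \<and> C j \<subseteq> B"
    and "j < k \<Longrightarrow> C j \<subseteq> C (Suc j) \<and> \<not> local_le R P X (C (Suc j)) (C j)"
  using assms by (simp_all add: local_chain_def)

lemma enat_le_add_iff:
  "enat n \<le> a + b \<longleftrightarrow> (\<exists>k l. k + l = n \<and> enat k \<le> a \<and> enat l \<le> b)" (is "?L \<longleftrightarrow> ?R")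
proof
  assume L: ?L
  show ?R
  proof (cases "enat n \<le> a")
    case True
    then show ?thesis by (intro exI[of _ n] exI[of _ 0]) (auto simp: zero_enat_def[symmetric])
  next
    case False
    then obtain k where k: "a = enat k" "k < n" by (cases a) auto
    then have "enat (n - k) \<le> b" using L by (cases b) auto
    then show ?thesis using k by (intro exI[of _ k] exI[of _ "n - k"]) auto
  qed
next
  assume ?R
  then show ?L by (metis add_mono plus_enat_simps(1))
qed

text \<open>Reduces the basic inequalities between lengths to the construction of one finite chain
  from another, and so treats infinite lengths without a case distinction.\<close>

lemma enat_leI:
  assumes "\<And>n. enat n \<le> a \<Longrightarrow> enat n \<le> b" shows "a \<le> b"
proof (cases a)
  case (enat n) then show ?thesis using assms[of n] by simp
next
  case infinity
  then have le: "enat n \<le> b" for n using assms by simp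
  show ?thesis
  proof (cases b)
    case (enat m) then show ?thesis using le[of "Suc m"] by simp
  qed simp
qed

context abelian_group
begin

lemma add_diff_cancel: "a \<in> carrier G \<Longrightarrow> b \<in> carrier G \<Longrightarrow> a \<oplus> (b \<ominus> a) = b"
  by (simp add: a_minus_def a_lcomm[of a b] r_neg)

lemma diff_diff_cancel: "a \<in> carrier G \<Longrightarrow> b \<in> carrier G \<Longrightarrow> a \<ominus> (a \<ominus> b) = b"
  by (simp add: a_minus_def minus_add r_neg2)

end

lemma submodule_subsetD: "submodule R A X \<Longrightarrow> x \<in> A \<Longrightarrow> x \<in> carrier X"
  by (auto simp: submodule_def)

lemma submodule_minus_closed:
  assumes "submodule R A X" "x \<in> A" "y \<in> A" shows "x \<ominus>\<^bsub>X\<^esub> y \<in> A"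
proof -
  interpret X: module R X using assms(1) by (simp add: submodule_def)
  have "y \<in> carrier X" using assms by (simp add: submodule_subsetD)
  then have "\<ominus>\<^bsub>X\<^esub> y = (\<ominus>\<^bsub>R\<^esub> \<one>\<^bsub>R\<^esub>) \<odot>\<^bsub>X\<^esub> y" by (simp add: X.smult_minus_1)
  then have "\<ominus>\<^bsub>X\<^esub> y \<in> A" using assms by (simp add: submodule_def)
  then show ?thesis using assms by (simp add: a_minus_def submodule_def)
qed

lemma submodule_Int:
  assumes "submodule R A X" "submodule R B X" shows "submodule R (A \<inter> B) X"
  using assms by (auto simp: submodule_def)

lemma hom_image_submodule:
  assumes f: "f \<in> module_hom R X Y" and "module R Y" "submodule R A X"
  shows "submodule R (f ` A) Y"
proof -
  have X: "module R X" using assms by (simp add: submodule_def)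
  interpret f: mod_hom R X Y f using f X assms(2) by (simp add: mod_hom_def mod_hom_axioms_def)
  have A: "A \<subseteq> carrier X" using assms by (simp add: submodule_def)
  show ?thesis
  proof (unfold submodule_def, intro conjI allI impI)
    show "f ` A \<subseteq> carrier Y" using A by auto
    show "\<zero>\<^bsub>Y\<^esub> \<in> f ` A" using assms(3) f.f0_is_0 by (metis image_eqI submodule.zero_closed)
    fix v w assume "v \<in> f ` A" "w \<in> f ` A"
    then obtain a b where ab: "a \<in> A" "b \<in> A" "v = f a" "w = f b" by auto
    then have "v \<oplus>\<^bsub>Y\<^esub> w = f (a \<oplus>\<^bsub>X\<^esub> b)" using A by (simp add: subset_iff)
    then show "v \<oplus>\<^bsub>Y\<^esub> w \<in> f ` A" using ab assms(3) by (simp add: submodule.m_closed)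
  next
    fix c v assume "c \<in> carrier R" "v \<in> f ` A"
    then obtain a where ab: "a \<in> A" "v = f a" by auto
    then have "c \<odot>\<^bsub>Y\<^esub> v = f (c \<odot>\<^bsub>X\<^esub> a)" using A \<open>c \<in> carrier R\<close> by (simp add: subset_iff)
    then show "c \<odot>\<^bsub>Y\<^esub> v \<in> f ` A" using ab \<open>c \<in> carrier R\<close> assms(3) by (simp add: submodule.smult_closed)
  qed (use assms in auto)
qed

lemma hom_vimage_submodule:
  assumes f: "f \<in> module_hom R X Y" and "module R X" "submodule R B Y"
  shows "submodule R {x \<in> carrier X. f x \<in> B} X"
proof -
  have Y: "module R Y" using assms by (simp add: submodule_def)
  interpret f: mod_hom R X Y f using f Y assms(2) by (simp add: mod_hom_def mod_hom_axioms_def)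
  show ?thesis using assms(2,3)
    by (auto simp: submodule_def)
qed

lemma zero_submodule: "module R X \<Longrightarrow> submodule R {\<zero>\<^bsub>X\<^esub>} X"
proof -
  assume "module R X" then interpret module R X .
  show ?thesis by unfold_locales auto
qed

lemma carrier_submodule: "module R X \<Longrightarrow> submodule R (carrier X) X"
proof -
  assume "module R X" then interpret module R X .
  show ?thesis by unfold_locales auto
qed

locale module_at_prime = module R X for R and X (structure) +
  fixes P
  assumes prime: "primeideal P R"
begin

abbreviation "ple \<equiv> local_le R P X"
abbreviation "pchain \<equiv> local_chain R P X"
abbreviation "plen \<equiv> local_length R P X"
abbreviation "smod A \<equiv> submodule R A X"

lemma one_not_prime: "\<one>\<^bsub>R\<^esub> \<in> carrier R - P"
  using primeideal.I_notcarr[OF prime] ideal.one_imp_carrier[OF primeideal.axioms(1)[OF prime]] by auto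

lemma not_prime_mult: "s \<in> carrier R - P \<Longrightarrow> t \<in> carrier R - P \<Longrightarrow> s \<otimes>\<^bsub>R\<^esub> t \<in> carrier R - P"
  using primeideal.I_prime[OF prime] by auto

lemma local_le_subset: "A \<subseteq> B \<Longrightarrow> B \<subseteq> carrier X \<Longrightarrow> ple A B"
  unfolding local_le_def using one_not_prime by (metis smult_one subset_iff)

lemma local_le_trans:
  assumes "A \<subseteq> carrier X" "ple A B" "ple B C" shows "ple A C"
  unfolding local_le_def
proof
  fix x assume x: "x \<in> A"
  then obtain s where s: "s \<in> carrier R - P" "s \<odot> x \<in> B" using assms by (auto simp: local_le_def)
  then obtain t where t: "t \<in> carrier R - P" "t \<odot> (s \<odot> x) \<in> C" using assms by (auto simp: local_le_def)
  then have "(t \<otimes>\<^bsub>R\<^esub> s) \<odot> x \<in> C" using s x assms(1) by (auto simp: smult_assoc1)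
  then show "\<exists>s\<in>carrier R - P. s \<odot> x \<in> C" using not_prime_mult s t by blast
qed

lemma submodule_sum_upper:
  assumes "smod A" "smod B" shows "A \<subseteq> submodule_sum A B" "B \<subseteq> submodule_sum A B"
  using in_sum[OF assms] in_sum[OF assms(2,1)] msum_comm[OF assms] by auto

lemma submodule_sum_least:
  assumes "smod C" "A \<subseteq> C" "B \<subseteq> C" shows "submodule_sum A B \<subseteq> C"
  using assms by (fastforce simp: submodule_sum_def intro: submodule.m_closed)

lemma submodule_sum_mono: "A \<subseteq> A' \<Longrightarrow> B \<subseteq> B' \<Longrightarrow> submodule_sum A B \<subseteq> submodule_sum A' B'"
  by (auto simp: submodule_sum_def)

lemma submodule_sumE:
  assumes "x \<in> submodule_sum A B" obtains a b where "a \<in> A" "b \<in> B" "x = a \<oplus> b"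
  using assms by (auto simp: submodule_sum_def)

text \<open>The modular law after localising: write \<open>s x = e + b\<close>; then
  \<open>b = s x - e\<close> lies in \<open>E' \<inter> B\<close>, some \<open>t\<close> outside
  \<open>P\<close> moves it into \<open>E\<close>, and \<open>t s\<close> moves \<open>x\<close>
  into \<open>E\<close>. In \<open>len_add\<close> it detects where a strict step survives.\<close>

lemma local_le_modular:
  assumes sub: "smod E" "smod E'" "smod B" and "E \<subseteq> E'"
    and inter: "ple (E' \<inter> B) (E \<inter> B)" and sum: "ple (submodule_sum E' B) (submodule_sum E B)"
  shows "ple E' E"
  unfolding local_le_def
proof
  interpret E: submodule R E X by fact
  interpret E': submodule R E' X by fact
  interpret B: submodule R B X by fact
  fix x assume x: "x \<in> E'"
  then have "x \<in> submodule_sum E' B" using submodule_sum_upper sub by blast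
  then obtain s where s: "s \<in> carrier R - P" "s \<odot> x \<in> submodule_sum E B"
    using sum by (auto simp: local_le_def)
  then obtain e b where eb: "e \<in> E" "b \<in> B" "s \<odot> x = e \<oplus> b" by (auto elim: submodule_sumE)
  have c: "e \<in> carrier X" "b \<in> carrier X" "x \<in> carrier X" using eb x E'.subset E.subset B.subset by auto
  have "b = s \<odot> x \<ominus> e" using eb c by (simp add: a_minus_def M.add.m_ac M.r_neg)
  moreover have "s \<odot> x \<in> E'" "e \<in> E'"
    using s x eb(1) \<open>E \<subseteq> E'\<close> E'.smult_closed by blast+
  ultimately have "b \<in> E' \<inter> B" using submodule_minus_closed[OF sub(2), of "s \<odot> x" e] eb(2) by simp
  then obtain t where t: "t \<in> carrier R - P" "t \<odot> b \<in> E" using inter by (auto simp: local_le_def)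
  have "(t \<otimes>\<^bsub>R\<^esub> s) \<odot> x = t \<odot> e \<oplus> t \<odot> b"
    using t s c eb by (simp add: smult_assoc1 smult_r_distr)
  then have "(t \<otimes>\<^bsub>R\<^esub> s) \<odot> x \<in> E" using t eb by auto
  then show "\<exists>s\<in>carrier R - P. s \<odot> x \<in> E" using not_prime_mult t s by blast
qed

section \<open>Additivity of the length at a prime\<close>

lemma chain_mono:
  assumes "pchain A B k C" "l \<le> k" shows "pchain A B l C"
  using assms by (auto simp: local_chain_def)

lemma le_lenI: "pchain A B n C \<Longrightarrow> enat n \<le> plen A B"
  unfolding local_length_def by (auto intro: Sup_upper)

text \<open>Initial segments of chains are chains, so the chain lengths are closed downwards and a
  lower bound on the supremum yields a chain of exactly that length.\<close>

lemma le_len_iff: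
  assumes "smod A" "A \<subseteq> B"
  shows "enat n \<le> plen A B \<longleftrightarrow> (\<exists>C. pchain A B n C)"
proof
  assume "\<exists>C. pchain A B n C"
  then show "enat n \<le> plen A B" using le_lenI by blast
next
  assume L: "enat n \<le> plen A B"
  show "\<exists>C. pchain A B n C"
  proof (cases n)
    case 0
    then show ?thesis using assms by (intro exI[of _ "\<lambda>_. A"]) (auto simp: local_chain_def)
  next
    case (Suc m)
    then have "enat m < plen A B" using L by (metis Suc_ile_eq)
    then obtain k C where "m < k" "pchain A B k C"
      unfolding local_length_def less_Sup_iff by auto
    then show ?thesis using chain_mono Suc by (metis Suc_leI)
  qed
qed

lemma len_zero_iff:
  assumes "smod A" "smod B" "A \<subseteq> B"
  shows "plen A B = 0 \<longleftrightarrow> ple B A"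
proof -
  have "plen A B \<noteq> 0 \<longleftrightarrow> enat 1 \<le> plen A B" by (metis enat_0_iff(1) iless_eSuc0 linorder_not_le one_eSuc one_enat_def one_neq_zero ile0_eq)
  also have "\<dots> \<longleftrightarrow> (\<exists>C. pchain A B 1 C)" using assms by (simp add: le_len_iff)
  also have "\<dots> \<longleftrightarrow> \<not> ple B A"
  proof
    assume "\<exists>C. pchain A B 1 C"
    then obtain C where "pchain A B 1 C" by blast
    then have C: "smod (C 0)" "smod (C 1)" "A \<subseteq> C 0" "C 1 \<subseteq> B" "\<not> ple (C 1) (C 0)"
      by (auto simp: local_chain_def)
    show "\<not> ple B A"
    proof
      assume "ple B A"
      then have "ple (C 1) (C 0)" using C unfolding local_le_def by blast
      then show False using C by simp
    qed
  next
    assume "\<not> ple B A"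
    then show "\<exists>C. pchain A B 1 C" using assms
      by (intro exI[of _ "\<lambda>j. if j = 0 then A else B"]) (auto simp: local_chain_def)
  qed
  finally show ?thesis by blast
qed

lemma len_super_add:
  assumes sub: "smod A" "smod B" and "A \<subseteq> B" "B \<subseteq> D"
  shows "plen A B + plen B D \<le> plen A D"
proof (rule enat_leI)
  fix n assume "enat n \<le> plen A B + plen B D"
  then obtain k l where kl: "k + l = n" "enat k \<le> plen A B" "enat l \<le> plen B D"
    by (auto simp: enat_le_add_iff)
  then obtain C C' where C: "pchain A B k C" "pchain B D l C'" using assms by (auto simp: le_len_iff)
  have joint: "C' 0 \<supseteq> C k" using C by (force simp: local_chain_def)
  \<comment> \<open>The top \<open>C k\<close> of the lower chain is dropped in favour of
    \<open>C' 0\<close>. Since \<open>C k \<subseteq> B \<subseteq> C' 0\<close>, the step into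
    \<open>C' 0\<close> is at least as large as the step into \<open>C k\<close> and stays
    strict.\<close>
  have "pchain A D (k + l) (\<lambda>j. if j < k then C j else C' (j - k))"
    unfolding local_chain_def
  proof (intro conjI allI impI)
    fix j assume j: "j \<le> k + l"
    have "submodule R (C j) X \<and> A \<subseteq> C j \<and> C j \<subseteq> B" if "j < k" using C(1) that by (simp add: local_chain_def)
    moreover have "submodule R (C' (j - k)) X \<and> B \<subseteq> C' (j - k) \<and> C' (j - k) \<subseteq> D"
      using C(2) j by (simp add: local_chain_def)
    ultimately show "smod (if j < k then C j else C' (j - k))"
      "A \<subseteq> (if j < k then C j else C' (j - k))" "(if j < k then C j else C' (j - k)) \<subseteq> D"
      using assms by auto
  next
    fix j assume j: "j < k + l"
    have c1: "C j \<subseteq> C (Suc j) \<and> \<not> ple (C (Suc j)) (C j)" if "j < k" using C(1) that by (simp add: local_chain_def)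
    have c2: "C' (j - k) \<subseteq> C' (Suc (j - k)) \<and> \<not> ple (C' (Suc (j - k))) (C' (j - k))" if "j \<ge> k"
      using C(2) that j by (simp add: local_chain_def)
    consider "Suc j < k" | "Suc j = k" | "j \<ge> k" by linarith
    then have "(if j < k then C j else C' (j - k)) \<subseteq> (if Suc j < k then C (Suc j) else C' (Suc j - k)) \<and>
      \<not> ple (if Suc j < k then C (Suc j) else C' (Suc j - k)) (if j < k then C j else C' (j - k))"
    proof cases
      case 1 then show ?thesis using c1 by simp
    next
      case 2
      then have "C j \<subseteq> C k" "\<not> ple (C k) (C j)" using c1 by auto
      then have "C j \<subseteq> C' 0" "\<not> ple (C' 0) (C j)" using joint unfolding local_le_def by blast+
      then show ?thesis using 2 by auto
    next
      case 3
      then have "Suc j - k = Suc (j - k)" by simp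
      then show ?thesis using c2 3 by simp
    qed
    then show "(if j < k then C j else C' (j - k)) \<subseteq> (if Suc j < k then C (Suc j) else C' (Suc j - k))"
      "\<not> ple (if Suc j < k then C (Suc j) else C' (Suc j - k)) (if j < k then C j else C' (j - k))"
      by blast+
  qed
  from le_lenI[OF this] show "enat n \<le> plen A D" unfolding kl(1) .
qed

text \<open>Intersecting a strict chain with a submodule, or adding one to it, produces repetitions.
  Counting the strict steps avoids renumbering what is left; the inclusion
  \<open>E 0 \<subseteq> E k\<close> is carried along for the induction.\<close>

lemma len_weak_chain:
  assumes "\<And>j. j \<le> k \<Longrightarrow> smod (E j)" "\<And>j. j < k \<Longrightarrow> E j \<subseteq> E (Suc j)"
  shows "enat (card {j. j < k \<and> \<not> ple (E (Suc j)) (E j)}) \<le> plen (E 0) (E k) \<and> E 0 \<subseteq> E k"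
  using assms
proof (induction k)
  case 0 then show ?case by (simp add: zero_enat_def[symmetric])
next
  case (Suc k)
  then have IH: "enat (card {j. j < k \<and> \<not> ple (E (Suc j)) (E j)}) \<le> plen (E 0) (E k)" "E 0 \<subseteq> E k" by auto
  have sub: "smod (E 0)" "smod (E k)" "smod (E (Suc k))" "E k \<subseteq> E (Suc k)" using Suc.prems by auto
  have step: "enat (if ple (E (Suc k)) (E k) then 0 else 1) \<le> plen (E k) (E (Suc k))"
    using len_zero_iff[OF sub(2-4)] by (cases "plen (E k) (E (Suc k))") (auto simp: enat_0_iff)
  have "{j. j < Suc k \<and> \<not> ple (E (Suc j)) (E j)} =
    {j. j < k \<and> \<not> ple (E (Suc j)) (E j)} \<union> (if ple (E (Suc k)) (E k) then {} else {k})"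
    by (auto simp: less_Suc_eq)
  then have "card {j. j < Suc k \<and> \<not> ple (E (Suc j)) (E j)} =
    card {j. j < k \<and> \<not> ple (E (Suc j)) (E j)} + (if ple (E (Suc k)) (E k) then 0 else 1)"
    by (simp add: card_insert_if)
  then have "enat (card {j. j < Suc k \<and> \<not> ple (E (Suc j)) (E j)}) =
    enat (card {j. j < k \<and> \<not> ple (E (Suc j)) (E j)}) + enat (if ple (E (Suc k)) (E k) then 0 else 1)"
    by simp
  also have "\<dots> \<le> plen (E 0) (E k) + plen (E k) (E (Suc k))"
    using IH(1) step by (rule add_mono)
  also have "\<dots> \<le> plen (E 0) (E (Suc k))" using len_super_add[OF sub(1,2) IH(2) sub(4)] .
  finally show ?case using IH(2) sub(4) by auto
qed

lemma len_mono:
  assumes "smod A" "smod A'" "A' \<subseteq> A" "A \<subseteq> B" "B \<subseteq> B'"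
  shows "plen A B \<le> plen A' B'"
proof (rule enat_leI)
  fix n assume "enat n \<le> plen A B"
  then obtain C where "pchain A B n C" using assms by (auto simp: le_len_iff)
  note C = local_chainD(1)[OF this] and C' = local_chainD(2)[OF this]
  have "pchain A' B' n C" unfolding local_chain_def
    using C C' order_trans[OF assms(3)] order_trans[OF _ assms(5)] by simp
  then show "enat n \<le> plen A' B'" by (rule le_lenI)
qed

lemma len_add:
  assumes sub: "smod A" "smod B" "smod D" and "A \<subseteq> B" "B \<subseteq> D"
  shows "plen A D = plen A B + plen B D"
proof (rule antisym)
  show "plen A B + plen B D \<le> plen A D" using assms by (intro len_super_add)
  show "plen A D \<le> plen A B + plen B D"
  proof (rule enat_leI)
    fix n assume "enat n \<le> plen A D"
    then obtain C where C: "pchain A D n C" using assms by (auto simp: le_len_iff)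
    let ?E = "\<lambda>j. C j \<inter> B" and ?F = "\<lambda>j. submodule_sum (C j) B"
    have sC: "smod (C j)" "A \<subseteq> C j" "C j \<subseteq> D" if "j \<le> n" for j using C that by (auto simp: local_chain_def)
    have incC: "C j \<subseteq> C (Suc j)" "\<not> ple (C (Suc j)) (C j)" if "j < n" for j using C that by (auto simp: local_chain_def)
    have E: "enat (card {j. j < n \<and> \<not> ple (?E (Suc j)) (?E j)}) \<le> plen (?E 0) (?E n) \<and> ?E 0 \<subseteq> ?E n"
    proof (rule len_weak_chain[of n ?E])
      show "smod (?E j)" if "j \<le> n" for j using sC(1)[OF that] sub(2) by (rule submodule_Int)
      show "?E j \<subseteq> ?E (Suc j)" if "j < n" for j using incC(1)[OF that] by blast
    qed
    have F: "enat (card {j. j < n \<and> \<not> ple (?F (Suc j)) (?F j)}) \<le> plen (?F 0) (?F n) \<and> ?F 0 \<subseteq> ?F n"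
    proof (rule len_weak_chain[of n ?F])
      show "smod (?F j)" if "j \<le> n" for j using sC(1)[OF that] sub(2) by (rule sum_is_submodule)
      show "?F j \<subseteq> ?F (Suc j)" if "j < n" for j using incC(1)[OF that] by (intro submodule_sum_mono) auto
    qed
    \<comment> \<open>By the modular law a step that disappears both in the intersections with
      \<open>B\<close> and in the sums with \<open>B\<close> was not strict. A step may survive on
      both sides, so the cardinalities give only the inequality that is wanted.\<close>
    have "{..<n} \<subseteq> {j. j < n \<and> \<not> ple (?E (Suc j)) (?E j)} \<union> {j. j < n \<and> \<not> ple (?F (Suc j)) (?F j)}"
    proof
      fix j assume "j \<in> {..<n}"
      then have "smod (C j)" "smod (C (Suc j))" "C j \<subseteq> C (Suc j)" "\<not> ple (C (Suc j)) (C j)" "j < n"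
        using sC incC by auto
      then show "j \<in> {j. j < n \<and> \<not> ple (?E (Suc j)) (?E j)} \<union> {j. j < n \<and> \<not> ple (?F (Suc j)) (?F j)}"
        using local_le_modular sub(2) by blast
    qed
    then have "card {..<n} \<le> card ({j. j < n \<and> \<not> ple (?E (Suc j)) (?E j)} \<union> {j. j < n \<and> \<not> ple (?F (Suc j)) (?F j)})"
      by (intro card_mono) auto
    also have "\<dots> \<le> card {j. j < n \<and> \<not> ple (?E (Suc j)) (?E j)} + card {j. j < n \<and> \<not> ple (?F (Suc j)) (?F j)}"
      by (rule card_Un_le)
    finally have "enat n \<le> enat (card {j. j < n \<and> \<not> ple (?E (Suc j)) (?E j)}) + enat (card {j. j < n \<and> \<not> ple (?F (Suc j)) (?F j)})"
      by simp
    also have "\<dots> \<le> plen (?E 0) (?E n) + plen (?F 0) (?F n)" using E F by (intro add_mono) auto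
    also have "\<dots> \<le> plen A B + plen B D"
    proof (rule add_mono)
      show "plen (?E 0) (?E n) \<le> plen A B"
        using sC[of 0] assms E by (intro len_mono submodule_Int) auto
      show "plen (?F 0) (?F n) \<le> plen B D"
      proof (rule len_mono)
        show "submodule_sum (C n) B \<subseteq> D" using sC[of n] assms by (intro submodule_sum_least) auto
        show "submodule_sum (C 0) B \<subseteq> submodule_sum (C n) B" using F by blast
      qed (use sC[of 0] sub in \<open>auto intro: sum_is_submodule submodule_sum_upper[THEN subsetD]\<close>)
    qed
    finally show "enat n \<le> plen A B + plen B D" .
  qed
qed

end

lemma (in cring) comm_idealI:
  assumes "I \<subseteq> carrier R" "\<zero> \<in> I" "\<And>a b. a \<in> I \<Longrightarrow> b \<in> I \<Longrightarrow> a \<oplus> b \<in> I"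
    and smult: "\<And>a r. a \<in> I \<Longrightarrow> r \<in> carrier R \<Longrightarrow> r \<otimes> a \<in> I"
  shows "ideal I R"
proof (rule idealI)
  show "ring R" by (rule ring_axioms)
  show "subgroup I (add_monoid R)"
  proof (rule add.subgroupI)
    fix a assume a: "a \<in> I"
    then have "(\<ominus> \<one>) \<otimes> a \<in> I" by (intro smult) auto
    moreover have "a \<in> carrier R" using a assms(1) by blast
    ultimately show "\<ominus> a \<in> I" by (simp add: l_minus)
  qed (use assms in auto)
  fix a r assume a: "a \<in> I" and r: "r \<in> carrier R"
  show "r \<otimes> a \<in> I" using smult[OF a r] .
  moreover have "a \<in> carrier R" using a assms(1) by blast
  ultimately show "a \<otimes> r \<in> I" using r by (simp add: m_comm)
qed

section \<open>Lengths under homomorphisms\<close>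

context module_at_prime
begin

text \<open>Preimages, cut down to \<open>B\<close>, turn a chain between the images into one
  between \<open>A\<close> and \<open>B\<close>: localising commutes with \<open>f\<close>, so a
  step that collapses upstairs collapses downstairs.\<close>

lemma hom_len_le:
  assumes f: "f \<in> module_hom R X Y" and Y: "module R Y" and sub: "smod A" "smod B" "A \<subseteq> B"
  shows "local_length R P Y (f ` A) (f ` B) \<le> plen A B"
proof (rule enat_leI)
  interpret Y: module_at_prime R Y P
    using Y prime by (simp add: module_at_prime_def module_at_prime_axioms_def)
  interpret f: mod_hom R X Y f using f module_axioms Y by (simp add: mod_hom_def mod_hom_axioms_def)
  fix n assume "enat n \<le> local_length R P Y (f ` A) (f ` B)"
  then obtain C where "Y.pchain (f ` A) (f ` B) n C"
    using Y.le_len_iff[OF hom_image_submodule[OF f Y sub(1)] image_mono[OF sub(3)]] by blast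
  note C = local_chainD(1)[OF this] and C' = local_chainD(2)[OF this]
  define D where "D j = {x \<in> carrier X. f x \<in> C j} \<inter> B" for j
  have B: "B \<subseteq> carrier X" using sub(2) by (simp add: submodule_def)
  have "pchain A B n D" unfolding local_chain_def
  proof (intro conjI allI impI)
    fix j assume j: "j \<le> n"
    show "smod (D j)" unfolding D_def using C[OF j] sub f module_axioms
      by (intro submodule_Int hom_vimage_submodule) auto
    show "A \<subseteq> D j" "D j \<subseteq> B" unfolding D_def using C[OF j] sub(3) B by auto
  next
    fix j assume j: "j < n"
    show "D j \<subseteq> D (Suc j)" unfolding D_def using C'[OF j] by auto
    show "\<not> ple (D (Suc j)) (D j)"
    proof
      assume le: "ple (D (Suc j)) (D j)"
      have "Y.ple (C (Suc j)) (C j)" unfolding local_le_def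
      proof
        fix y assume y: "y \<in> C (Suc j)"
        then obtain x where x: "x \<in> B" "y = f x" using C[of "Suc j"] j by auto
        then have "x \<in> D (Suc j)" using y B by (auto simp: D_def)
        then obtain s where s: "s \<in> carrier R - P" "s \<odot> x \<in> D j" using le by (auto simp: local_le_def)
        then have "f (s \<odot> x) \<in> C j" by (simp add: D_def)
        moreover have "f (s \<odot> x) = s \<odot>\<^bsub>Y\<^esub> y" using s x B by (simp add: subset_iff)
        ultimately show "\<exists>s\<in>carrier R - P. s \<odot>\<^bsub>Y\<^esub> y \<in> C j" using s by auto
      qed
      then show False using C'[OF j] by blast
    qed
  qed
  then show "enat n \<le> plen A B" by (rule le_lenI)
qed

text \<open>The isomorphism of \<open>B\<close> modulo the kernel with \<open>f B\<close>, at the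
  level of chains. For the converse inequality, \<open>s f x = f c\<close> puts
  \<open>s x - c\<close> into the kernel, which every member of the chain contains.\<close>

lemma hom_len_image:
  assumes f: "f \<in> module_hom R X Y" and Y: "module R Y" and B: "smod B"
  shows "local_length R P Y {\<zero>\<^bsub>Y\<^esub>} (f ` B) = plen {x \<in> B. f x = \<zero>\<^bsub>Y\<^esub>} B"
proof (rule antisym)
  interpret Y: module_at_prime R Y P
    using Y prime by (simp add: module_at_prime_def module_at_prime_axioms_def)
  interpret f: mod_hom R X Y f using f module_axioms Y by (simp add: mod_hom_def mod_hom_axioms_def)
  let ?K = "{x \<in> B. f x = \<zero>\<^bsub>Y\<^esub>}"
  have BX: "B \<subseteq> carrier X" using B by (simp add: submodule_def)
  have K: "smod ?K"
  proof -
    have "?K = {x \<in> carrier X. f x \<in> {\<zero>\<^bsub>Y\<^esub>}} \<inter> B" using BX by auto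
    then show ?thesis using f Y B module_axioms
      by (simp only:) (intro submodule_Int hom_vimage_submodule[OF f] zero_submodule)
  qed
  have 0: "\<zero> \<in> B" using B by (simp add: submodule_def)
  then have "f ` ?K = {\<zero>\<^bsub>Y\<^esub>}" using f.f0_is_0 by force
  then show "local_length R P Y {\<zero>\<^bsub>Y\<^esub>} (f ` B) \<le> plen ?K B"
    using hom_len_le[OF f Y K B] by auto
  show "plen ?K B \<le> local_length R P Y {\<zero>\<^bsub>Y\<^esub>} (f ` B)"
  proof (rule enat_leI)
    fix n assume "enat n \<le> plen ?K B"
    then obtain C where "pchain ?K B n C" using le_len_iff[OF K] by blast
    note C = local_chainD(1)[OF this] and C' = local_chainD(2)[OF this]
    have "Y.pchain {\<zero>\<^bsub>Y\<^esub>} (f ` B) n (\<lambda>j. f ` C j)" unfolding local_chain_def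
    proof (intro conjI allI impI)
      fix j assume j: "j \<le> n"
      show "Y.smod (f ` C j)" using C[OF j] f Y by (intro hom_image_submodule) auto
      have "\<zero> \<in> C j" using C[OF j] by (simp add: submodule_def)
      then have "\<zero>\<^bsub>Y\<^esub> \<in> f ` C j" using f.f0_is_0 by (metis image_eqI)
      then show "{\<zero>\<^bsub>Y\<^esub>} \<subseteq> f ` C j" by simp
      show "f ` C j \<subseteq> f ` B" using C[OF j] by auto
    next
      fix j assume j: "j < n"
      show "f ` C j \<subseteq> f ` C (Suc j)" using C'[OF j] by auto
      show "\<not> Y.ple (f ` C (Suc j)) (f ` C j)"
      proof
        assume le: "Y.ple (f ` C (Suc j)) (f ` C j)"
        have Cj: "smod (C j)" "?K \<subseteq> C j" "C j \<subseteq> B" "smod (C (Suc j))" "C (Suc j) \<subseteq> B"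
          using C[of j] C[of "Suc j"] j by auto
        have "ple (C (Suc j)) (C j)" unfolding local_le_def
        proof
          fix x assume x: "x \<in> C (Suc j)"
          then obtain s c where s: "s \<in> carrier R - P" and c: "c \<in> C j" "s \<odot>\<^bsub>Y\<^esub> f x = f c"
            using le by (auto simp: local_le_def)
          have xc: "x \<in> carrier X" "c \<in> carrier X" "x \<in> B" "c \<in> B" using x c Cj BX by auto
          have "f (s \<odot> x \<ominus> c) = \<zero>\<^bsub>Y\<^esub>" using s xc c by simp
          moreover have "s \<odot> x \<ominus> c \<in> B"
            using submodule_minus_closed[OF B] s xc submodule.smult_closed[OF B] by simp
          ultimately have d: "s \<odot> x \<ominus> c \<in> C j" using Cj(2) by blast
          have "(s \<odot> x \<ominus> c) \<oplus> c = s \<odot> x"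
            using s xc by (simp add: a_minus_def M.add.m_assoc M.l_neg)
          then have "s \<odot> x \<in> C j" using submodule.m_closed[OF Cj(1) d c(1)] by simp
          then show "\<exists>s\<in>carrier R - P. s \<odot> x \<in> C j" using s by blast
        qed
        then show False using C'[OF j] by blast
      qed
    qed
    then show "enat n \<le> local_length R P Y {\<zero>\<^bsub>Y\<^esub>} (f ` B)" by (rule Y.le_lenI)
  qed
qed

text \<open>\<open>B / A\<close> is a quotient of \<open>B / (B \<inter> D)\<close>, which is
  isomorphic to \<open>(B + D) / D\<close>.\<close>

lemma len_le_sum:
  assumes sub: "smod A" "smod B" "smod D" and "A \<subseteq> B" "B \<inter> D \<subseteq> A"
  shows "plen A B \<le> plen D (submodule_sum B D)"
proof (rule enat_leI)
  fix n assume "enat n \<le> plen A B"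
  then obtain C where "pchain A B n C" using le_len_iff[OF sub(1) assms(4)] by blast
  note C = local_chainD(1)[OF this] and C' = local_chainD(2)[OF this]
  have "pchain D (submodule_sum B D) n (\<lambda>j. submodule_sum (C j) D)" unfolding local_chain_def
  proof (intro conjI allI impI)
    fix j assume j: "j \<le> n"
    show "smod (submodule_sum (C j) D)" using C[OF j] sub by (intro sum_is_submodule) auto
    show "D \<subseteq> submodule_sum (C j) D" using C[OF j] sub submodule_sum_upper(2) by blast
    show "submodule_sum (C j) D \<subseteq> submodule_sum B D" using C[OF j] by (intro submodule_sum_mono) auto
  next
    fix j assume j: "j < n"
    have Cj: "smod (C j)" "A \<subseteq> C j" "smod (C (Suc j))" "C (Suc j) \<subseteq> B"
      using C[of j] C[of "Suc j"] j by auto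
    show "submodule_sum (C j) D \<subseteq> submodule_sum (C (Suc j)) D"
      using C'[OF j] by (intro submodule_sum_mono) auto
    have "C (Suc j) \<inter> D \<subseteq> C j \<inter> D" using Cj assms(5) by blast
    moreover have "C j \<inter> D \<subseteq> carrier X" using Cj(1) by (auto simp: submodule_def)
    ultimately have "ple (C (Suc j) \<inter> D) (C j \<inter> D)" by (rule local_le_subset)
    then show "\<not> ple (submodule_sum (C (Suc j)) D) (submodule_sum (C j) D)"
      using local_le_modular[OF Cj(1,3) sub(3)] C'[OF j] by blast
  qed
  then show "enat n \<le> plen D (submodule_sum B D)" by (rule le_lenI)
qed

section \<open>Adjoining one element to a submodule\<close>

definition cyclic where "cyclic x = {r \<odot> x | r. r \<in> carrier R}"

lemma cyclic_submodule: "x \<in> carrier X \<Longrightarrow> smod (cyclic x)"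
  unfolding submodule_def
proof (intro conjI allI impI)
  assume x: "x \<in> carrier X"
  show "module R X" by (rule module_axioms)
  show "cyclic x \<subseteq> carrier X" using x by (auto simp: cyclic_def)
  show "\<zero> \<in> cyclic x" unfolding cyclic_def using x R.zero_closed lmult_0 by (metis (mono_tags, lifting) mem_Collect_eq)
  fix v w assume "v \<in> cyclic x" "w \<in> cyclic x"
  then obtain r r' where "r \<in> carrier R" "r' \<in> carrier R" "v = r \<odot> x" "w = r' \<odot> x"
    by (auto simp: cyclic_def)
  then show "v \<oplus> w \<in> cyclic x" unfolding cyclic_def using x
    by (intro CollectI exI[of _ "r \<oplus>\<^bsub>R\<^esub> r'"]) (simp add: smult_l_distr)
next
  fix c v assume x: "x \<in> carrier X" and c: "c \<in> carrier R" and "v \<in> cyclic x"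
  then obtain r where "r \<in> carrier R" "v = r \<odot> x" by (auto simp: cyclic_def)
  then show "c \<odot> v \<in> cyclic x" unfolding cyclic_def using x c
    by (intro CollectI exI[of _ "c \<otimes>\<^bsub>R\<^esub> r"]) (simp add: smult_assoc1)
qed

lemma mem_cyclic: "x \<in> carrier X \<Longrightarrow> x \<in> cyclic x"
  unfolding cyclic_def by (intro CollectI exI[of _ "\<one>\<^bsub>R\<^esub>"]) simp

lemma submodule_sum_cyclicE:
  assumes "y \<in> submodule_sum C (cyclic x)"
  obtains c r where "c \<in> C" "r \<in> carrier R" "y = c \<oplus> r \<odot> x"
  using assms by (auto simp: cyclic_def elim!: submodule_sumE)

text \<open>\<open>(C + R x) / C\<close> is a quotient of \<open>R / P\<close>, and
  \<open>R / P\<close> becomes a field at \<open>P\<close>. Concretely, a first strict step contains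
  some \<open>c + r x\<close> with \<open>r\<close> outside \<open>P\<close>, and then
  \<open>r\<close> carries all of \<open>C + R x\<close> into that step, so no second one
  exists.\<close>

lemma len_add_cyclic:
  assumes C: "smod C" and x: "x \<in> carrier X" and Px: "\<And>p. p \<in> P \<Longrightarrow> p \<odot> x \<in> C"
  shows "plen C (submodule_sum C (cyclic x)) \<le> 1"
proof (rule enat_leI)
  interpret C: submodule R C X by fact
  let ?N = "submodule_sum C (cyclic x)"
  have N: "C \<subseteq> ?N" using submodule_sum_upper(1)[OF C cyclic_submodule[OF x]] .
  fix n assume n: "enat n \<le> plen C ?N"
  show "enat n \<le> 1"
  proof (rule ccontr)
    assume "\<not> enat n \<le> 1"
    then have "2 \<le> n" by (simp add: one_enat_def)
    moreover obtain D where "pchain C ?N n D" using n le_len_iff[OF C N] by blast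
    ultimately have "pchain C ?N 2 D" using chain_mono by blast
    note D = local_chainD(1)[OF this] and D' = local_chainD(2)[OF this]
    have D1: "smod (D 1)" "C \<subseteq> D 1" "D 1 \<subseteq> ?N" and D2: "D 2 \<subseteq> ?N" using D[of 1] D[of 2] by auto
    have "\<not> ple (D 1) (D 0)" and n2: "\<not> ple (D 2) (D 1)" using D'[of 0] D'[of 1] by (simp_all add: numeral_2_eq_2)
    then obtain y where y: "y \<in> D 1" "\<And>s. s \<in> carrier R - P \<Longrightarrow> s \<odot> y \<notin> D 0" by (auto simp: local_le_def)
    from y(1) D1(3) have "y \<in> ?N" by (rule subsetD[rotated])
    then obtain c r where cr: "c \<in> C" "r \<in> carrier R" "y = c \<oplus> r \<odot> x"
      by (rule submodule_sum_cyclicE)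
    have c: "c \<in> carrier X" using cr C.subset by auto
    have "r \<notin> P"
    proof
      assume "r \<in> P"
      then have "y \<in> C" using cr Px by simp
      then have "\<one>\<^bsub>R\<^esub> \<odot> y \<in> D 0" using D[of 0] cr c x by auto
      then show False using y(2) one_not_prime by blast
    qed
    have "r \<odot> x = y \<ominus> c"
      using cr c x by (simp add: a_minus_def M.add.m_ac M.r_neg1 M.r_neg2)
    then have rx: "r \<odot> x \<in> D 1" using submodule_minus_closed[OF D1(1) y(1)] cr(1) D1(2) by auto
    have "ple (D 2) (D 1)" unfolding local_le_def
    proof
      fix z assume "z \<in> D 2"
      with D2 have "z \<in> ?N" by (rule subsetD)
      then obtain c' r' where z: "c' \<in> C" "r' \<in> carrier R" "z = c' \<oplus> r' \<odot> x"
        by (rule submodule_sum_cyclicE)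
      then have c': "c' \<in> carrier X" using C.subset by auto
      have "r \<odot> z = r \<odot> c' \<oplus> (r \<otimes>\<^bsub>R\<^esub> r') \<odot> x"
        using z cr c' x by (simp add: smult_r_distr smult_assoc1)
      also have "(r \<otimes>\<^bsub>R\<^esub> r') \<odot> x = r' \<odot> (r \<odot> x)"
        using z cr x by (simp add: smult_assoc1 R.m_comm[of r r'])
      finally have "r \<odot> z = r \<odot> c' \<oplus> r' \<odot> (r \<odot> x)" .
      moreover have "r \<odot> c' \<in> D 1" using cr z D1(2) C.smult_closed by blast
      moreover have "r' \<odot> (r \<odot> x) \<in> D 1" using z(2) rx D1(1) by (simp add: submodule.smult_closed)
      ultimately have "r \<odot> z \<in> D 1" using submodule.m_closed[OF D1(1)] by simp
      then show "\<exists>s\<in>carrier R - P. s \<odot> z \<in> D 1" using cr \<open>r \<notin> P\<close> by blast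
    qed
    then show False using n2 by blast
  qed
qed

lemma len_add_cyclic_0:
  assumes C: "smod C" and x: "x \<in> carrier X" and s: "s \<in> carrier R - P" "s \<odot> x \<in> C"
  shows "plen C (submodule_sum C (cyclic x)) = 0"
proof -
  interpret C: submodule R C X by fact
  have "ple (submodule_sum C (cyclic x)) C" unfolding local_le_def
  proof
    fix z assume "z \<in> submodule_sum C (cyclic x)"
    then obtain c r where z: "c \<in> C" "r \<in> carrier R" "z = c \<oplus> r \<odot> x" by (rule submodule_sum_cyclicE)
    have c: "c \<in> carrier X" using z C.subset by auto
    have "s \<odot> z = s \<odot> c \<oplus> (s \<otimes>\<^bsub>R\<^esub> r) \<odot> x"
      using z s c x by (simp add: smult_r_distr smult_assoc1)
    also have "(s \<otimes>\<^bsub>R\<^esub> r) \<odot> x = r \<odot> (s \<odot> x)"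
      using z s x by (simp add: smult_assoc1 R.m_comm[of s r])
    finally have "s \<odot> z \<in> C" using z s by simp
    then show "\<exists>s\<in>carrier R - P. s \<odot> z \<in> C" using s by blast
  qed
  then show ?thesis
    using len_zero_iff[OF C sum_is_submodule[OF C cyclic_submodule[OF x]] submodule_sum_upper(1)[OF C cyclic_submodule[OF x]]]
    by blast
qed

end

section \<open>Noetherian modules\<close>

text \<open>Stated as the maximum condition, because every use of it picks a maximal
  submodule.\<close>

definition noetherian_module :: "('a, 'r) ring_scheme \<Rightarrow> ('a, 'b, 'm) module_scheme \<Rightarrow> bool" where
  "noetherian_module R X \<longleftrightarrow> (\<forall>S. S \<noteq> {} \<and> (\<forall>N\<in>S. submodule R N X) \<longrightarrow>
     (\<exists>N\<in>S. \<forall>N'\<in>S. N \<subseteq> N' \<longrightarrow> N' = N))"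

lemma noetherian_moduleD:
  assumes "noetherian_module R X" "N0 \<in> S" "\<And>N. N \<in> S \<Longrightarrow> submodule R N X"
  obtains N where "N \<in> S" "\<forall>N'\<in>S. N \<subseteq> N' \<longrightarrow> N' = N"
  using assms unfolding noetherian_module_def by (metis empty_iff)

text \<open>Zorn's lemma applies because the union of a nonempty chain of ideals already belongs to
  the chain.\<close>

lemma (in noetherian_ring) ideal_maximal_elem:
  assumes "S \<noteq> {}" "\<And>I. I \<in> S \<Longrightarrow> ideal I R"
  obtains I where "I \<in> S" "\<forall>J\<in>S. I \<subseteq> J \<longrightarrow> J = I"
proof -
  have "\<exists>M\<in>S. \<forall>X\<in>S. M \<subseteq> X \<longrightarrow> X = M"
  proof (rule subset_Zorn)
    fix C assume C: "subset.chain S C"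
    show "\<exists>U\<in>S. \<forall>X\<in>C. X \<subseteq> U"
    proof (cases "C = {}")
      case True then show ?thesis using assms(1) by auto
    next
      case False
      have "subset.chain {I. ideal I R} C" using C assms(2) unfolding subset_chain_def by auto
      then have "\<Union>C \<in> C" using ideal_chain_is_trivial[OF False] by blast
      moreover have "C \<subseteq> S" using C by (simp add: subset_chain_def)
      ultimately show ?thesis by blast
    qed
  qed
  then show ?thesis using that by blast
qed

text \<open>Filtration by associated primes. Take \<open>C\<close> maximal among the submodules of
  finite length over \<open>A\<close>. If \<open>C\<close> is proper, an element \<open>x\<close>
  outside \<open>C\<close> with maximal annihilator modulo \<open>C\<close> has a prime annihilator
  \<open>q x\<close>, and adjoining \<open>x\<close> costs length at most 1. The hypothesis
  \<open>minimal\<close> says that no prime strictly inside \<open>P\<close> contains the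
  annihilator of \<open>X / A\<close>.\<close>

lemma (in module_at_prime) finite_length:
  assumes R: "noetherian_ring R" and X: "noetherian_module R X" and A: "smod A"
    and minimal: "\<And>Q. primeideal Q R \<Longrightarrow> Q \<subseteq> P \<Longrightarrow> {a \<in> carrier R. \<forall>x\<in>carrier X. a \<odot> x \<in> A} \<subseteq> Q \<Longrightarrow> Q = P"
  shows "plen A (carrier X) < \<infinity>"
proof -
  interpret R': noetherian_ring R by fact
  define S where "S = {C. smod C \<and> A \<subseteq> C \<and> plen A C < \<infinity>}"
  have "ple A A" using A by (intro local_le_subset) (auto simp: submodule_def)
  then have "plen A A = 0" using len_zero_iff[OF A A] by simp
  then have "plen A A < \<infinity>" by simp
  then have "A \<in> S" using A by (simp add: S_def)
  moreover have "smod N" if "N \<in> S" for N using that by (simp add: S_def)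
  ultimately obtain C where C: "C \<in> S" and max: "\<forall>N\<in>S. C \<subseteq> N \<longrightarrow> N = C"
    by (rule noetherian_moduleD[OF X])
  have sC: "smod C" "A \<subseteq> C" "plen A C < \<infinity>" using C by (auto simp: S_def)
  interpret C: submodule R C X by fact
  have "C = carrier X"
  proof (rule ccontr)
    assume "C \<noteq> carrier X"
    then have ne: "carrier X - C \<noteq> {}" using C.subset by blast
    define q where "q x = {a \<in> carrier R. a \<odot> x \<in> C}" for x
    have q_ideal: "ideal (q x) R" if "x \<in> carrier X" for x
    proof (rule R.comm_idealI)
      show "q x \<subseteq> carrier R" by (auto simp: q_def)
      show "\<zero>\<^bsub>R\<^esub> \<in> q x" using that C.zero_closed by (simp add: q_def)
      fix a b assume "a \<in> q x" "b \<in> q x"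
      then show "a \<oplus>\<^bsub>R\<^esub> b \<in> q x" using that submodule.m_closed[OF sC(1)] by (simp add: q_def smult_l_distr)
    next
      fix a r assume "a \<in> q x" "r \<in> carrier R"
      then show "r \<otimes>\<^bsub>R\<^esub> a \<in> q x" using that C.smult_closed by (simp add: q_def smult_assoc1)
    qed
    have "q ` (carrier X - C) \<noteq> {}" using ne by simp
    moreover have "ideal I R" if "I \<in> q ` (carrier X - C)" for I using that q_ideal by auto
    ultimately obtain I where I: "I \<in> q ` (carrier X - C)" and Imax: "\<forall>J\<in>q ` (carrier X - C). I \<subseteq> J \<longrightarrow> J = I"
      by (rule R'.ideal_maximal_elem)
    then obtain x where x: "x \<in> carrier X" "x \<notin> C" "I = q x" by auto
    have prime_q: "primeideal (q x) R"
    proof (rule primeidealI[OF q_ideal[OF x(1)] R.is_cring])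
      show "carrier R \<noteq> q x" using x by (auto simp: q_def dest!: equalityD1 subsetD[OF _ R.one_closed])
      fix a b assume ab: "a \<in> carrier R" "b \<in> carrier R" "a \<otimes>\<^bsub>R\<^esub> b \<in> q x"
      show "a \<in> q x \<or> b \<in> q x"
      proof (rule disjCI)
        assume "b \<notin> q x"
        then have b: "b \<odot> x \<notin> C" using ab by (simp add: q_def)
        \<comment> \<open>Since \<open>b x\<close> is still outside \<open>C\<close> and its
          annihilator can only be larger, maximality makes the two annihilators equal; as
          \<open>a\<close> kills \<open>b x\<close> modulo \<open>C\<close>, it already kills
          \<open>x\<close>.\<close>
        have "q x \<subseteq> q (b \<odot> x)"
        proof
          fix c assume "c \<in> q x"
          then have c: "c \<in> carrier R" "c \<odot> x \<in> C" by (auto simp: q_def)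
          have "c \<odot> (b \<odot> x) = b \<odot> (c \<odot> x)"
            using c ab x by (simp add: smult_assoc1[symmetric] R.m_comm)
          then show "c \<in> q (b \<odot> x)" using c ab C.smult_closed by (simp add: q_def)
        qed
        moreover have "q (b \<odot> x) \<in> q ` (carrier X - C)" using b ab x by auto
        ultimately have "q (b \<odot> x) = q x" using Imax x by blast
        moreover have "a \<in> q (b \<odot> x)" using ab x by (auto simp: q_def smult_assoc1)
        ultimately show "a \<in> q x" by blast
      qed
    qed
    have ann: "{a \<in> carrier R. \<forall>x\<in>carrier X. a \<odot> x \<in> A} \<subseteq> q x" using x sC by (auto simp: q_def)
    let ?N = "submodule_sum C (cyclic x)"
    have N: "smod ?N" "C \<subseteq> ?N" "x \<in> ?N"
      using sum_is_submodule[OF sC(1) cyclic_submodule[OF x(1)]] submodule_sum_upper[OF sC(1) cyclic_submodule[OF x(1)]]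
        mem_cyclic[OF x(1)] by auto
    \<comment> \<open>Either \<open>q x\<close> is contained in \<open>P\<close>, hence equal to it,
      and the new layer is a quotient of \<open>R / P\<close>; or some element outside
      \<open>P\<close> kills \<open>x\<close> modulo \<open>C\<close>, and the layer vanishes at
      \<open>P\<close>.\<close>
    have "plen C ?N \<le> 1"
    proof (cases "q x \<subseteq> P")
      case True
      then have "q x = P" using minimal prime_q ann by blast
      then show ?thesis using len_add_cyclic[OF sC(1) x(1)] by (auto simp: q_def)
    next
      case False
      then obtain s where "s \<in> q x" "s \<notin> P" by blast
      then show ?thesis using len_add_cyclic_0[OF sC(1) x(1)] by (auto simp: q_def)
    qed
    then have "plen C ?N < \<infinity>" by (metis enat_ord_simps(4) infinity_ne_i1 order_le_less_trans)
    then have "plen A C + plen C ?N \<noteq> \<infinity>"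
      using sC(3) by (cases "plen A C"; cases "plen C ?N") simp_all
    then have "plen A ?N < \<infinity>" using len_add[OF A sC(1) N(1) sC(2) N(2)] by (simp only: enat_ord_simps simp_thms)
    then have "?N \<in> S" using N sC by (auto simp: S_def)
    then show False using max N x by blast
  qed
  then show ?thesis using sC by simp
qed

section \<open>Free modules\<close>

lemma (in cring) free_module_simps:
  "carrier (free_module R S) = {f \<in> S \<rightarrow>\<^sub>E carrier R. finite {s \<in> S. f s \<noteq> \<zero>}}"
  "x \<oplus>\<^bsub>free_module R S\<^esub> y = (\<lambda>s\<in>S. x s \<oplus> y s)"
  "\<zero>\<^bsub>free_module R S\<^esub> = (\<lambda>s\<in>S. \<zero>)"
  "a \<odot>\<^bsub>free_module R S\<^esub> x = (\<lambda>s\<in>S. a \<otimes> x s)"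
  by (simp_all add: free_module_def func_space_def)

lemma (in cring) free_module_module: "module R (free_module R S)"
proof -
  interpret F: module R "func_space S" by (rule func_space_is_module)
  let ?N = "{f \<in> carrier (func_space S). finite {s \<in> S. f s \<noteq> \<zero>}}"
  have "submodule R ?N (func_space S)" unfolding submodule_def
  proof (intro conjI allI impI)
    show "module R (func_space S)" by (rule func_space_is_module)
    show "\<zero>\<^bsub>func_space S\<^esub> \<in> ?N" by (auto simp: func_space_def)
    fix v w assume v: "v \<in> ?N" and w: "w \<in> ?N"
    have "{s \<in> S. (v \<oplus>\<^bsub>func_space S\<^esub> w) s \<noteq> \<zero>} \<subseteq> {s \<in> S. v s \<noteq> \<zero>} \<union> {s \<in> S. w s \<noteq> \<zero>}"
      by (auto simp: func_space_def)
    then have "finite {s \<in> S. (v \<oplus>\<^bsub>func_space S\<^esub> w) s \<noteq> \<zero>}"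
      by (rule finite_subset) (use v w in simp)
    then show "v \<oplus>\<^bsub>func_space S\<^esub> w \<in> ?N" using v w by simp
  next
    fix c v assume c: "c \<in> carrier R" and v: "v \<in> ?N"
    have "{s \<in> S. (c \<odot>\<^bsub>func_space S\<^esub> v) s \<noteq> \<zero>} \<subseteq> {s \<in> S. v s \<noteq> \<zero>}"
      using c by (auto simp: func_space_def)
    then have "finite {s \<in> S. (c \<odot>\<^bsub>func_space S\<^esub> v) s \<noteq> \<zero>}" by (rule finite_subset) (use v in simp)
    then show "c \<odot>\<^bsub>func_space S\<^esub> v \<in> ?N" using c v by simp
  qed auto
  from F.submodule_is_module[OF this] show ?thesis unfolding free_module_def .
qed

lemma (in cring) free_rank_carrier: "carrier (free_rank R n) = {..<n} \<rightarrow>\<^sub>E carrier R"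
  by (auto simp: free_module_simps)

lemma (in cring) free_gen_closed: "s \<in> S \<Longrightarrow> free_gen R S s \<in> carrier (free_module R S)"
proof -
  assume s: "s \<in> S"
  have "{t \<in> S. free_gen R S s t \<noteq> \<zero>} \<subseteq> {s}" by (auto simp: free_gen_def)
  then have "finite {t \<in> S. free_gen R S s t \<noteq> \<zero>}" by (rule finite_subset) simp
  then show ?thesis by (auto simp: free_module_simps free_gen_def)
qed

text \<open>\<open>x\<close> is the finite sum of its components along the generators, built up over
  finite subsets of the support. Taking for \<open>C\<close> the set of elements with a given linear
  property makes this the extension principle from generators to the whole module.\<close>

lemma (in cring) free_module_memI:
  assumes C: "submodule R C (free_module R S)" and x: "x \<in> carrier (free_module R S)"
    and gens: "\<And>s. s \<in> S \<Longrightarrow> x s \<odot>\<^bsub>free_module R S\<^esub> free_gen R S s \<in> C"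
  shows "x \<in> C"
proof -
  define y where "y U = (\<lambda>s\<in>S. if s \<in> U then x s else \<zero>)" for U
  have xc: "x s \<in> carrier R" if "s \<in> S" for s using x that by (auto simp: free_module_simps)
  have "y U \<in> C" if "finite U" "U \<subseteq> S" for U using that
  proof (induction U)
    case empty
    have "y {} = \<zero>\<^bsub>free_module R S\<^esub>" by (simp add: y_def free_module_simps)
    then show ?case using C by (simp add: submodule_def)
  next
    case (insert s U)
    have "y (insert s U) = y U \<oplus>\<^bsub>free_module R S\<^esub> x s \<odot>\<^bsub>free_module R S\<^esub> free_gen R S s"
      using insert.hyps insert.prems xc
      by (auto simp: y_def free_module_simps free_gen_def fun_eq_iff restrict_def)
    moreover have "y U \<in> C" "x s \<odot>\<^bsub>free_module R S\<^esub> free_gen R S s \<in> C"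
      using insert.IH insert.prems gens by auto
    ultimately show ?case using submodule.m_closed[OF C] by simp
  qed
  then have "y {s \<in> S. x s \<noteq> \<zero>} \<in> C" using x by (auto simp: free_module_simps)
  moreover have "y {s \<in> S. x s \<noteq> \<zero>} = x"
    using x by (intro extensionalityI[of _ S]) (auto simp: y_def free_module_simps PiE_def)
  ultimately show ?thesis by simp
qed

lemma (in cring) free_rank_memI:
  assumes "submodule R C (free_rank R n)" "x \<in> carrier (free_rank R n)"
    and "\<And>j. j < n \<Longrightarrow> x j \<odot>\<^bsub>free_rank R n\<^esub> free_gen R {..<n} j \<in> C"
  shows "x \<in> C"
  by (rule free_module_memI[OF assms(1,2)]) (simp add: assms(3))

section \<open>The ring as a module; free modules of finite rank are noetherian\<close>

lemma self_module_simps [simp]: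
  "carrier (self_module R) = carrier R" "x \<oplus>\<^bsub>self_module R\<^esub> y = x \<oplus>\<^bsub>R\<^esub> y"
  "\<zero>\<^bsub>self_module R\<^esub> = \<zero>\<^bsub>R\<^esub>" "a \<odot>\<^bsub>self_module R\<^esub> x = a \<otimes>\<^bsub>R\<^esub> x"
  by (simp_all add: self_module_def)

lemma (in cring) self_module_module: "module R (self_module R)"
proof (rule module_criteria)
  show "\<forall>v\<in>carrier (self_module R). \<exists>neg_v\<in>carrier (self_module R). v \<oplus>\<^bsub>self_module R\<^esub> neg_v = \<zero>\<^bsub>self_module R\<^esub>"
    by (auto intro!: bexI[of _ "\<ominus> v" for v] simp: r_neg)
qed (auto simp: a_ac m_assoc l_distr r_distr is_cring)

lemma (in cring) self_submodule_iff: "submodule R I (self_module R) \<longleftrightarrow> ideal I R"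
proof
  assume "submodule R I (self_module R)"
  then show "ideal I R" by (intro comm_idealI) (auto simp: submodule_def)
next
  assume "ideal I R"
  then interpret I: ideal I R .
  show "submodule R I (self_module R)" unfolding submodule_def
    using self_module_module I.a_subset I.a_closed I.I_l_closed by auto
qed

lemma noetherian_self:
  assumes "noetherian_ring R" "cring R" shows "noetherian_module R (self_module R)"
proof -
  interpret noetherian_ring R by fact
  interpret cring R by fact
  show ?thesis unfolding noetherian_module_def self_submodule_iff
  proof (intro allI impI)
    fix S assume S: "S \<noteq> {} \<and> (\<forall>N\<in>S. ideal N R)"
    then have "S \<noteq> {}" "\<And>I. I \<in> S \<Longrightarrow> ideal I R" by auto
    then obtain I where "I \<in> S" "\<forall>J\<in>S. I \<subseteq> J \<longrightarrow> J = I"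
      by (rule ideal_maximal_elem)
    then show "\<exists>N\<in>S. \<forall>N'\<in>S. N \<subseteq> N' \<longrightarrow> N' = N" by blast
  qed
qed

lemma (in cring) coord_hom: "j < n \<Longrightarrow> (\<lambda>x. x j) \<in> module_hom R (free_rank R n) (self_module R)"
  by (auto simp: module_hom_def free_module_simps)

text \<open>Filter \<open>N\<close> by the number of vanishing initial coordinates: these ideals are
  the successive quotients, read off in the ring.\<close>

definition lead_ideal :: "('a, 'r) ring_scheme \<Rightarrow> nat \<Rightarrow> (nat \<Rightarrow> 'a) set \<Rightarrow> 'a set" where
  "lead_ideal R j N = {x j | x. x \<in> N \<and> (\<forall>l<j. x l = \<zero>\<^bsub>R\<^esub>)}"

lemma (in cring) lead_ideal_ideal:
  assumes N: "submodule R N (free_rank R n)" and j: "j < n" shows "ideal (lead_ideal R j N) R"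
proof (rule comm_idealI)
  interpret N: submodule R N "free_rank R n" by fact
  have c: "x l \<in> carrier R" if "x \<in> N" "l < n" for x l using N.subset that by (auto simp: free_rank_carrier)
  show "lead_ideal R j N \<subseteq> carrier R" using c j by (auto simp: lead_ideal_def)
  show "\<zero> \<in> lead_ideal R j N" unfolding lead_ideal_def using N.zero_closed j
    by (intro CollectI exI[of _ "\<zero>\<^bsub>free_rank R n\<^esub>"]) (simp add: free_module_simps)
  fix a b assume "a \<in> lead_ideal R j N" "b \<in> lead_ideal R j N"
  then obtain x y where *: "a = x j" "x \<in> N" "\<And>l. l < j \<Longrightarrow> x l = \<zero>" "b = y j" "y \<in> N" "\<And>l. l < j \<Longrightarrow> y l = \<zero>"
    by (auto simp: lead_ideal_def)
  then have "x \<oplus>\<^bsub>free_rank R n\<^esub> y \<in> N" by (intro N.m_closed)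
  then show "a \<oplus> b \<in> lead_ideal R j N" unfolding lead_ideal_def using * j
    by (intro CollectI exI[of _ "x \<oplus>\<^bsub>free_rank R n\<^esub> y"]) (simp add: free_module_simps)
next
  interpret N: submodule R N "free_rank R n" by fact
  fix a r assume "a \<in> lead_ideal R j N" and r: "r \<in> carrier R"
  then obtain x where *: "a = x j" "x \<in> N" "\<And>l. l < j \<Longrightarrow> x l = \<zero>" by (auto simp: lead_ideal_def)
  then have "r \<odot>\<^bsub>free_rank R n\<^esub> x \<in> N" using r by (intro N.smult_closed)
  then show "r \<otimes> a \<in> lead_ideal R j N" unfolding lead_ideal_def using * j r
    by (intro CollectI exI[of _ "r \<odot>\<^bsub>free_rank R n\<^esub> x"]) (simp add: free_module_simps)
qed

text \<open>An element of \<open>N'\<close> is matched by elements of \<open>N\<close> one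
  coordinate at a time. The error in coordinate \<open>m\<close> is a leading coefficient of
  \<open>N'\<close>, hence of \<open>N\<close>, and the element of \<open>N\<close> that realises it
  leaves the earlier coordinates alone.\<close>

lemma (in cring) lead_ideal_eq:
  assumes N: "submodule R N (free_rank R n)" and N': "submodule R N' (free_rank R n)" and "N \<subseteq> N'"
    and eq: "\<And>j. j < n \<Longrightarrow> lead_ideal R j N' = lead_ideal R j N"
  shows "N' = N"
proof
  interpret F: module R "free_rank R n" by (rule free_module_module)
  interpret N: submodule R N "free_rank R n" by fact
  interpret N': submodule R N' "free_rank R n" by fact
  show "N' \<subseteq> N"
  proof
    fix x assume x: "x \<in> N'"
    have c: "z l \<in> carrier R" if "z \<in> N'" "l < n" for z l using N'.subset that by (auto simp: free_rank_carrier)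
    have "\<exists>y\<in>N. \<forall>l<m. x l = y l" if "m \<le> n" for m using that
    proof (induction m)
      case 0 then show ?case using N.zero_closed by blast
    next
      case (Suc m)
      then obtain y where y: "y \<in> N" "\<And>l. l < m \<Longrightarrow> x l = y l" by auto
      have yN': "y \<in> N'" using y \<open>N \<subseteq> N'\<close> by blast
      define d where "d = x \<oplus>\<^bsub>free_rank R n\<^esub> (\<ominus> \<one>) \<odot>\<^bsub>free_rank R n\<^esub> y"
      have dv: "d l = x l \<ominus> y l" if "l < n" for l
        using that c x yN' by (simp add: d_def free_module_simps l_minus a_minus_def)
      have "d \<in> N'" unfolding d_def using x yN' by (intro N'.m_closed N'.smult_closed) auto
      moreover have "\<forall>l<m. d l = \<zero>"
      proof (intro allI impI)
        fix l assume "l < m"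
        then have "l < n" "y l \<in> carrier R" using Suc.prems c yN' by auto
        then show "d l = \<zero>" using dv y(2)[OF \<open>l < m\<close>] by (simp add: a_minus_def r_neg)
      qed
      ultimately have "d m \<in> lead_ideal R m N" using eq[of m] Suc.prems by (auto simp: lead_ideal_def)
      then obtain z where z: "z \<in> N" "z m = d m" "\<And>l. l < m \<Longrightarrow> z l = \<zero>" by (auto simp: lead_ideal_def)
      have "x l = (y \<oplus>\<^bsub>free_rank R n\<^esub> z) l" if "l < Suc m" for l
      proof (cases "l = m")
        case True
        then have "x l \<in> carrier R" "y l \<in> carrier R" using Suc.prems c x yN' by auto
        then show ?thesis using True Suc.prems dv[of m] z(2)
          by (simp add: free_module_simps a_minus_def a_ac r_neg)
      next
        case False
        then have "l < m" "l < n" "y l \<in> carrier R" using that Suc.prems c yN' by auto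
        then show ?thesis using y(2) z(3) by (simp add: free_module_simps)
      qed
      then show ?case using N.m_closed[OF y(1) z(1)] by blast
    qed
    then obtain y where y: "y \<in> N" "\<forall>l<n. x l = y l" by blast
    have "x = y"
    proof (rule PiE_ext)
      show "x \<in> {..<n} \<rightarrow>\<^sub>E carrier R" "y \<in> {..<n} \<rightarrow>\<^sub>E carrier R"
        using x y N'.subset N.subset by (auto simp: free_rank_carrier)
    qed (use y in auto)
    then show "x \<in> N" using y by simp
  qed
qed fact

text \<open>The leading ideals are made stable one index after the other: above an \<open>N\<close>
  at which the first \<open>m\<close> are stable, pick an \<open>N1\<close> whose ideal at index
  \<open>m\<close> is maximal. Once all \<open>n\<close> are stable, \<open>lead_ideal_eq\<close>
  makes \<open>N\<close> maximal.\<close>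

lemma noetherian_free_rank:
  assumes "noetherian_ring R" "cring R" shows "noetherian_module R (free_rank R n)"
  unfolding noetherian_module_def
proof (intro allI impI)
  interpret noetherian_ring R by fact
  interpret cring R by fact
  fix S assume S: "S \<noteq> {} \<and> (\<forall>N\<in>S. submodule R N (free_rank R n))"
  have "\<exists>N\<in>S. \<forall>N'\<in>S. N \<subseteq> N' \<longrightarrow> (\<forall>j<m. lead_ideal R j N' = lead_ideal R j N)" if "m \<le> n" for m
    using that
  proof (induction m)
    case 0 then show ?case using S by auto
  next
    case (Suc m)
    then have "m \<le> n" by simp
    from Suc.IH[OF this] obtain N where N: "N \<in> S"
      and stable: "\<forall>N'\<in>S. N \<subseteq> N' \<longrightarrow> (\<forall>j<m. lead_ideal R j N' = lead_ideal R j N)"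
      by (rule bexE)
    let ?T = "lead_ideal R m ` {N' \<in> S. N \<subseteq> N'}"
    have "?T \<noteq> {}" using N by auto
    moreover have "ideal I R" if "I \<in> ?T" for I using that S Suc.prems lead_ideal_ideal by auto
    ultimately obtain I where I: "I \<in> ?T" "\<forall>J\<in>?T. I \<subseteq> J \<longrightarrow> J = I"
      by (rule ideal_maximal_elem[of ?T])
    then obtain N1 where N1: "N1 \<in> S" "N \<subseteq> N1" "I = lead_ideal R m N1" by auto
    show ?case
    proof (intro bexI[OF _ N1(1)] ballI impI allI)
      fix N' j assume N': "N' \<in> S" "N1 \<subseteq> N'" and j: "j < Suc m"
      show "lead_ideal R j N' = lead_ideal R j N1"
      proof (cases "j = m")
        case True
        have "lead_ideal R m N1 \<subseteq> lead_ideal R m N'" using N'(2) by (auto simp: lead_ideal_def)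
        moreover have "lead_ideal R m N' \<in> ?T" using N' N1 by auto
        ultimately show ?thesis using I(2) N1(3) True by blast
      next
        case False
        then have "j < m" using j by simp
        moreover have "N \<subseteq> N'" using N' N1 by blast
        ultimately have "lead_ideal R j N' = lead_ideal R j N" "lead_ideal R j N1 = lead_ideal R j N"
          using stable N'(1) N1(1,2) by simp_all
        then show ?thesis by simp
      qed
    qed
  qed
  from this[OF order_refl] obtain N where N: "N \<in> S"
    and stable: "\<forall>N'\<in>S. N \<subseteq> N' \<longrightarrow> (\<forall>j<n. lead_ideal R j N' = lead_ideal R j N)"
    by (rule bexE)
  have "N' = N" if "N' \<in> S" "N \<subseteq> N'" for N'
  proof (rule lead_ideal_eq)
    show "submodule R N (free_rank R n)" "submodule R N' (free_rank R n)" using S N that by auto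
    show "lead_ideal R j N' = lead_ideal R j N" if "j < n" for j
      using stable that \<open>N' \<in> S\<close> \<open>N \<subseteq> N'\<close> by simp
  qed fact
  then show "\<exists>N\<in>S. \<forall>N'\<in>S. N \<subseteq> N' \<longrightarrow> N' = N" using N by blast
qed

section \<open>Lengths of free modules\<close>

abbreviation ring_length :: "('a, 'r) ring_scheme \<Rightarrow> 'a set \<Rightarrow> enat" where
  "ring_length R P \<equiv> local_length R P (self_module R) {\<zero>\<^bsub>R\<^esub>} (carrier R)"

lemma (in cring) module_at_primeI: "primeideal P R \<Longrightarrow> module R X \<Longrightarrow> module_at_prime R X P"
  by (simp add: module_at_prime_def module_at_prime_axioms_def)

lemma (in cring) free_rank_length:
  assumes P: "primeideal P R"
  shows "local_length R P (free_rank R n) {\<zero>\<^bsub>free_rank R n\<^esub>} (carrier (free_rank R n)) = enat n * ring_length R P"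
proof -
  let ?F = "free_rank R n"
  interpret F: module_at_prime R ?F P by (rule module_at_primeI[OF P free_module_module])
  \<comment> \<open>Vectors with \<open>m\<close> leading zeros: coordinate \<open>m\<close> maps
    \<open>U m\<close> onto \<open>R\<close> with kernel \<open>U (Suc m)\<close>, so each layer
    contributes one copy of the length of the ring.\<close>
  define U where "U m = {x \<in> carrier ?F. \<forall>l<m. x l = \<zero>}" for m :: nat
  have sU: "F.smod (U m)" if "m \<le> n" for m unfolding submodule_def
    using that by (auto simp: U_def free_module_module) (auto simp: free_module_simps)
  have step: "F.plen (U (Suc m)) (U m) = ring_length R P" if m: "m < n" for m
  proof -
    have "{x \<in> U m. x m = \<zero>\<^bsub>self_module R\<^esub>} = U (Suc m)" by (auto simp: U_def less_Suc_eq)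
    moreover have "(\<lambda>x. x m) ` U m = carrier R"
    proof
      show "(\<lambda>x. x m) ` U m \<subseteq> carrier R" using m by (auto simp: U_def free_rank_carrier)
      show "carrier R \<subseteq> (\<lambda>x. x m) ` U m"
      proof
        fix r assume "r \<in> carrier R"
        then show "r \<in> (\<lambda>x. x m) ` U m" using m
          by (intro image_eqI[of _ _ "\<lambda>l\<in>{..<n}. if l = m then r else \<zero>"]) (auto simp: U_def free_rank_carrier)
      qed
    qed
    ultimately show ?thesis
      using F.hom_len_image[OF coord_hom[OF m] self_module_module sU[OF less_imp_le[OF m]]] by simp
  qed
  have "F.plen (U m) (U 0) = enat m * ring_length R P" if "m \<le> n" for m using that
  proof (induction m)
    case 0
    have "F.ple (U 0) (U 0)" by (intro F.local_le_subset) (auto simp: U_def)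
    then show ?case using F.len_zero_iff[OF sU sU] by (simp add: zero_enat_def[symmetric])
  next
    case (Suc m)
    have "F.plen (U (Suc m)) (U 0) = F.plen (U (Suc m)) (U m) + F.plen (U m) (U 0)"
      using Suc.prems by (intro F.len_add sU) (auto simp: U_def)
    also have "\<dots> = ring_length R P + enat m * ring_length R P" using Suc step by simp
    also have "\<dots> = (1 + enat m) * ring_length R P" by (simp only: distrib_right mult_1)
    also have "1 + enat m = enat (Suc m)" by (simp add: one_enat_def)
    finally show ?case .
  qed
  moreover have "U n = {\<zero>\<^bsub>?F\<^esub>}"
  proof -
    have "x = \<zero>\<^bsub>?F\<^esub>" if "x \<in> U n" for x
      using that by (intro extensionalityI[of _ "{..<n}"]) (auto simp: U_def free_module_simps PiE_def)
    moreover have "\<zero>\<^bsub>?F\<^esub> \<in> U n" using sU[OF order_refl] by (simp add: submodule_def)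
    ultimately show ?thesis by blast
  qed
  moreover have "U 0 = carrier ?F" by (simp add: U_def)
  ultimately show ?thesis by (metis order_refl)
qed

section \<open>The length of the ring at minimal and at non-minimal primes\<close>

lemma (in cring) ring_length_pos:
  assumes P: "primeideal P R" shows "ring_length R P \<noteq> 0"
proof -
  interpret F: module_at_prime R "self_module R" P by (rule module_at_primeI[OF P self_module_module])
  have "\<zero> \<in> P" using additive_subgroup.zero_closed[OF ideal.axioms(1)[OF primeideal.axioms(1)[OF P]]] .
  have "\<not> F.ple (carrier R) {\<zero>}"
  proof
    assume "F.ple (carrier R) {\<zero>}"
    then have "\<forall>x\<in>carrier R. \<exists>s\<in>carrier R - P. s \<otimes> x = \<zero>" by (auto simp: local_le_def)
    then obtain s where "s \<in> carrier R - P" "s \<otimes> \<one> = \<zero>" by blast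
    then show False using \<open>\<zero> \<in> P\<close> by auto
  qed
  then show ?thesis using F.len_zero_iff[OF zero_submodule[OF self_module_module] carrier_submodule[OF self_module_module]] by simp
qed

lemma ring_length_finite:
  assumes "noetherian_ring R" "cring R" and P: "minimal_prime P R"
  shows "ring_length R P < \<infinity>"
proof -
  interpret cring R by fact
  have P': "primeideal P R" using P by (simp add: minimal_prime_def)
  interpret F: module_at_prime R "self_module R" P by (rule module_at_primeI[OF P' self_module_module])
  show ?thesis
    using F.finite_length[OF assms(1) noetherian_self[OF assms(1,2)] zero_submodule[OF self_module_module]] P
    by (simp add: minimal_prime_def)
qed

lemma (in cring) prime_pow:
  assumes "primeideal Q R" "x \<in> carrier R" "x \<notin> Q" shows "x [^] (m::nat) \<notin> Q"
proof (induction m)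
  case 0
  then show ?case using primeideal.I_notcarr[OF assms(1)] ideal.one_imp_carrier[OF primeideal.axioms(1)[OF assms(1)]] by auto
next
  case (Suc m)
  then show ?case using primeideal.I_prime[OF assms(1), of "x [^] m" x] assms by auto
qed

text \<open>For \<open>x\<close> in \<open>P\<close> but not in \<open>Q\<close>, the powers of
  \<open>x\<close> generate an infinite strictly decreasing sequence of ideals
  \<open>Q + R x^m\<close>, even after localising at \<open>P\<close>.\<close>

lemma (in cring) ring_length_infinite:
  assumes P: "primeideal P R" and Q: "primeideal Q R" "Q \<subset> P"
  shows "ring_length R P = \<infinity>"
proof -
  interpret F: module_at_prime R "self_module R" P by (rule module_at_primeI[OF P self_module_module])
  interpret Q: primeideal Q R by fact
  interpret P: primeideal P R by fact
  obtain x where x: "x \<in> P" "x \<notin> Q" using Q by blast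
  have xR: "x \<in> carrier R" using x P.a_subset by auto
  have sQ: "F.smod Q" by (simp add: self_submodule_iff Q.ideal_axioms)
  have cyc: "F.smod (F.cyclic (x [^] m))" for m :: nat using xR by (intro F.cyclic_submodule) simp
  have "enat k \<le> ring_length R P" for k
  proof -
    \<comment> \<open>Chains are indexed upwards while the ideals shrink with the exponent, hence
      \<open>k - j\<close>.\<close>
    define D where "D j = F.submodule_sum Q (F.cyclic (x [^] (k - j)))" for j
    have sD: "F.smod (D j)" for j unfolding D_def using sQ cyc by (rule F.sum_is_submodule)
    have "F.pchain {\<zero>} (carrier R) k D" unfolding local_chain_def
    proof (intro conjI allI impI)
      fix j
      show "F.smod (D j)" by (rule sD)
      show "{\<zero>} \<subseteq> D j" "D j \<subseteq> carrier R" using sD[of j] by (auto simp: submodule_def)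
    next
      fix j assume "j < k"
      then obtain m where m: "k - j = Suc m" "k - Suc j = m" by (metis Suc_diff_Suc)
      have "F.cyclic (x [^] Suc m) \<subseteq> F.cyclic (x [^] m)"
      proof
        fix y assume "y \<in> F.cyclic (x [^] Suc m)"
        then obtain r where "r \<in> carrier R" "y = r \<otimes> x [^] Suc m" by (auto simp: F.cyclic_def)
        then show "y \<in> F.cyclic (x [^] m)" unfolding F.cyclic_def using xR
          by (intro CollectI exI[of _ "r \<otimes> x"]) (simp add: m_ac)
      qed
      then show "D j \<subseteq> D (Suc j)" unfolding D_def m by (intro F.submodule_sum_mono) auto
      show "\<not> F.ple (D (Suc j)) (D j)"
      proof
        assume le: "F.ple (D (Suc j)) (D j)"
        have "x [^] m \<in> D (Suc j)"
          unfolding D_def m using F.submodule_sum_upper(2)[OF sQ cyc] F.mem_cyclic[of "x [^] m"] xR by auto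
        then obtain s where s: "s \<in> carrier R" "s \<notin> P" "s \<otimes> x [^] m \<in> D j" using le by (auto simp: local_le_def)
        from s(3) obtain q r where q: "q \<in> Q" and r: "r \<in> carrier R"
          and eq: "s \<otimes> x [^] m = q \<oplus>\<^bsub>self_module R\<^esub> r \<odot>\<^bsub>self_module R\<^esub> x [^] Suc m"
          unfolding D_def m by (rule F.submodule_sum_cyclicE)
        have qR: "q \<in> carrier R" using q Q.a_subset by auto
        \<comment> \<open>From \<open>s x^m = q + r x^(m+1)\<close> it follows that
          \<open>(s - r x) x^m\<close> is in \<open>Q\<close>. No power of \<open>x\<close> is, so
          \<open>s - r x\<close> lies in \<open>Q\<close>, hence in \<open>P\<close>; with
          \<open>x\<close> in \<open>P\<close> this puts \<open>s\<close> into
          \<open>P\<close>.\<close>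
        have "(s \<ominus> r \<otimes> x) \<otimes> x [^] m = s \<otimes> x [^] m \<ominus> r \<otimes> x [^] Suc m"
          using s r xR by (simp add: a_minus_def l_distr r_distr l_minus r_minus m_ac)
        also have "\<dots> = q"
          using eq qR r xR by (simp add: a_minus_def a_ac r_neg r_neg1 r_neg2)
        finally have "(s \<ominus> r \<otimes> x) \<otimes> x [^] m \<in> Q" using q by simp
        then have "s \<ominus> r \<otimes> x \<in> Q" using Q.I_prime[of "s \<ominus> r \<otimes> x" "x [^] m"] prime_pow[OF Q(1) xR x(2)] s r xR by auto
        then have "(s \<ominus> r \<otimes> x) \<oplus> r \<otimes> x \<in> P" using Q(2) x r P.I_l_closed by (intro P.a_closed) auto
        moreover have "(s \<ominus> r \<otimes> x) \<oplus> r \<otimes> x = s" using s r xR by (simp add: a_minus_def a_assoc l_neg)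
        ultimately show False using s by simp
      qed
    qed
    then show ?thesis by (rule F.le_lenI)
  qed
  then have "\<infinity> \<le> ring_length R P" by (rule enat_leI)
  then show ?thesis by simp
qed

section \<open>Endomorphisms\<close>

context module_at_prime
begin

text \<open>The hypothesis \<open>le\<close> expresses that \<open>Y + P X\<close> is all of
  \<open>X\<close> at \<open>P\<close>, quantified over the submodules containing \<open>Y\<close>
  and \<open>P X\<close> so that \<open>P X\<close> need not be formed. In place of a determinant
  the proof takes a maximal counterexample \<open>C\<close> above \<open>Y\<close> and shows that it
  contains \<open>P X\<close>.\<close>

lemma local_nakayama:
  assumes noeth: "noetherian_module R X" and Y: "smod Y"
    and le: "\<And>C. smod C \<Longrightarrow> Y \<subseteq> C \<Longrightarrow> (\<And>p x. p \<in> P \<Longrightarrow> x \<in> carrier X \<Longrightarrow> p \<odot> x \<in> C) \<Longrightarrow> ple (carrier X) C"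
  shows "ple (carrier X) Y"
proof (rule ccontr)
  assume "\<not> ple (carrier X) Y"
  define S where "S = {C. smod C \<and> Y \<subseteq> C \<and> \<not> ple (carrier X) C}"
  have "Y \<in> S" using Y \<open>\<not> ple (carrier X) Y\<close> by (simp add: S_def)
  moreover have "smod N" if "N \<in> S" for N using that by (simp add: S_def)
  ultimately obtain C where C: "C \<in> S" and max: "\<forall>N\<in>S. C \<subseteq> N \<longrightarrow> N = C"
    by (rule noetherian_moduleD[OF noeth])
  then have sC: "smod C" "Y \<subseteq> C" "\<not> ple (carrier X) C" by (auto simp: S_def)
  interpret C: submodule R C X by fact
  have "p \<odot> x \<in> C" if p: "p \<in> P" and x: "x \<in> carrier X" for p x
  proof (rule ccontr)
    assume nC: "p \<odot> x \<notin> C"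
    have pR: "p \<in> carrier R" using p ideal.Icarr[OF primeideal.axioms(1)[OF prime]] by blast
    have px: "p \<odot> x \<in> carrier X" using pR x by simp
    let ?N = "submodule_sum C (cyclic (p \<odot> x))"
    have N: "smod ?N" "C \<subseteq> ?N" using sum_is_submodule[OF sC(1) cyclic_submodule[OF px]]
      submodule_sum_upper(1)[OF sC(1) cyclic_submodule[OF px]] by auto
    have "p \<odot> x \<in> ?N"
      using submodule_sum_upper(2)[OF sC(1) cyclic_submodule[OF px]] mem_cyclic[OF px] by blast
    then have "?N \<notin> S" using max N nC by blast
    then have leN: "ple (carrier X) ?N" using N sC(2) by (simp add: S_def)
    then obtain s where s: "s \<in> carrier R" "s \<notin> P" "s \<odot> x \<in> ?N" using x by (auto simp: local_le_def)
    from s(3) obtain c r where c: "c \<in> C" and r: "r \<in> carrier R" and eq: "s \<odot> x = c \<oplus> r \<odot> (p \<odot> x)"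
      by (rule submodule_sum_cyclicE)
    have cX: "c \<in> carrier X" using c C.subset by auto
    \<comment> \<open>By maximality \<open>C + R p x\<close> is everything at \<open>P\<close>,
      whence \<open>s x = c + r p x\<close>. Then \<open>s - r p\<close> is outside \<open>P\<close>
      and moves \<open>x\<close>, hence also \<open>p x\<close>, into \<open>C\<close>; so adjoining
      \<open>p x\<close> changed nothing at \<open>P\<close>.\<close>
    let ?t = "s \<ominus>\<^bsub>R\<^esub> r \<otimes>\<^bsub>R\<^esub> p"
    have rp: "r \<otimes>\<^bsub>R\<^esub> p \<in> P" using ideal.I_l_closed[OF primeideal.axioms(1)[OF prime] p r] .
    have t: "?t \<in> carrier R - P"
    proof
      show "?t \<in> carrier R" using s r pR by simp
      show "?t \<notin> P"
      proof
        assume "?t \<in> P"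
        then have "?t \<oplus>\<^bsub>R\<^esub> r \<otimes>\<^bsub>R\<^esub> p \<in> P"
          using rp additive_subgroup.a_closed[OF ideal.axioms(1)[OF primeideal.axioms(1)[OF prime]]] by blast
        moreover have "?t \<oplus>\<^bsub>R\<^esub> r \<otimes>\<^bsub>R\<^esub> p = s" using s r pR by (simp add: a_minus_def R.a_assoc R.l_neg)
        ultimately show False using s by simp
      qed
    qed
    have "?t \<odot> x = s \<odot> x \<oplus> (\<ominus> (r \<odot> (p \<odot> x)))"
      using s r pR x by (simp add: a_minus_def smult_l_distr smult_l_minus smult_assoc1)
    also have "\<dots> = c" using eq cX r px by (simp add: M.a_assoc M.r_neg)
    finally have tx: "?t \<odot> x \<in> C" using c by simp
    have "?t \<odot> (p \<odot> x) = p \<odot> (?t \<odot> x)"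
      using t pR x by (simp add: smult_assoc1[symmetric] R.m_comm)
    then have "?t \<odot> (p \<odot> x) \<in> C" using tx pR by simp
    then have "plen C ?N = 0" by (rule len_add_cyclic_0[OF sC(1) px t])
    then have "ple ?N C" using len_zero_iff[OF sC(1) N] by blast
    then have "ple (carrier X) C" by (rule local_le_trans[OF subset_refl leN])
    then show False using sC(3) by blast
  qed
  then have "ple (carrier X) C" by (rule le[OF sC(1,2)])
  then show False using sC(3) by blast
qed

lemma funpow_hom:
  assumes f: "f \<in> module_hom R X X" shows "f ^^ k \<in> module_hom R X X"
proof (induction k)
  case 0 then show ?case by (auto simp: module_hom_def)
next
  case (Suc k)
  then show ?case using f by (auto simp: module_hom_def Pi_def)
qed

lemma kernel_submodule:
  assumes f: "f \<in> module_hom R X Y" and "module R Y" and B: "smod B"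
  shows "smod {x \<in> B. f x = \<zero>\<^bsub>Y\<^esub>}"
proof -
  have "{x \<in> B. f x = \<zero>\<^bsub>Y\<^esub>} = {x \<in> carrier X. f x \<in> {\<zero>\<^bsub>Y\<^esub>}} \<inter> B"
    using B by (auto simp: submodule_def)
  then show ?thesis
    by (simp only:) (intro submodule_Int B hom_vimage_submodule[OF f module_axioms zero_submodule[OF assms(2)]])
qed

text \<open>With \<open>K\<close> the generalised kernel of \<open>f\<close>: lengths of kernel and cokernel of \<open>f\<close> agree on \<open>K\<close>, and
  \<open>f\<close> is injective modulo \<open>K\<close>.\<close>
lemma endomorphism_length:
  assumes noeth: "noetherian_module R X" and f: "f \<in> module_hom R X X"
    and fin: "plen (f ` carrier X) (carrier X) < \<infinity>"
  obtains K where "smod K" "plen {\<zero>} K < \<infinity>"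
    "plen {\<zero>} {x \<in> carrier X. f x = \<zero>} + plen (submodule_sum K (f ` carrier X)) (carrier X)
       \<le> plen (f ` carrier X) (carrier X)"
proof -
  interpret f: mod_hom R X X f using f module_axioms by (simp add: mod_hom_def mod_hom_axioms_def)
  have X: "smod (carrier X)" by (rule carrier_submodule[OF module_axioms])
  have zX: "smod {\<zero>}" by (rule zero_submodule[OF module_axioms])
  define K where "K k = {x \<in> carrier X. (f ^^ k) x = \<zero>}" for k
  have fk: "f ^^ k \<in> module_hom R X X" for k by (rule funpow_hom[OF f])
  interpret fk: mod_hom R X X "f ^^ k" for k using fk module_axioms by (simp add: mod_hom_def mod_hom_axioms_def)
  have sK: "smod (K k)" for k unfolding K_def by (rule kernel_submodule[OF fk module_axioms X])
  have K_mono: "K k \<subseteq> K (j + k)" for j k by (auto simp: K_def funpow_add)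
  have "K 0 \<in> range K" by simp
  moreover have "smod N" if "N \<in> range K" for N using that sK by blast
  ultimately obtain N where "N \<in> range K" and max: "\<forall>N'\<in>range K. N \<subseteq> N' \<longrightarrow> N' = N"
    by (rule noetherian_moduleD[OF noeth])
  then obtain k where N: "N = K k" by blast
  \<comment> \<open>The kernels of the powers of \<open>f\<close> increase, so they stop at some
    \<open>k\<close>; \<open>K k\<close> is the generalised kernel.\<close>
  have stable: "K (j + k) = K k"
    for j using max K_mono[of k j] N by blast
  let ?fX = "f ` carrier X"
  have sI: "smod ((f ^^ j) ` carrier X)" for j by (rule hom_image_submodule[OF fk module_axioms X])
  have sfX: "smod ?fX" by (rule hom_image_submodule[OF f module_axioms X])
  have zI: "{\<zero>} \<subseteq> A" if "smod A" for A using that by (simp add: submodule_def)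
  have AX: "A \<subseteq> carrier X" if "smod A" for A using that by (simp add: submodule_def)
  \<comment> \<open>The layer between two successive images is the image under \<open>f ^^ j\<close>
    of \<open>X / f X\<close>, so its length is bounded by the finite length of the
    cokernel.\<close>
  have finI: "plen ((f ^^ j) ` carrier X) (carrier X) < \<infinity>" for j
  proof (induction j)
    case 0
    have "ple (carrier X) (carrier X)" by (intro local_le_subset) auto
    then show ?case using len_zero_iff[OF X X] by simp
  next
    case (Suc j)
    have eq: "(f ^^ Suc j) ` carrier X = (f ^^ j) ` ?fX" by (simp only: funpow_Suc_right image_comp)
    have "plen ((f ^^ j) ` ?fX) ((f ^^ j) ` carrier X) \<le> plen ?fX (carrier X)"
      by (rule hom_len_le[OF fk module_axioms sfX X AX[OF sfX]])
    then have "plen ((f ^^ Suc j) ` carrier X) ((f ^^ j) ` carrier X) < \<infinity>"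
      unfolding eq using fin by (rule order_le_less_trans)
    moreover have "(f ^^ Suc j) ` carrier X \<subseteq> (f ^^ j) ` carrier X"
      unfolding eq by (rule image_mono[OF AX[OF sfX]])
    then have "plen ((f ^^ Suc j) ` carrier X) (carrier X) =
      plen ((f ^^ Suc j) ` carrier X) ((f ^^ j) ` carrier X) + plen ((f ^^ j) ` carrier X) (carrier X)"
      by (intro len_add sI X AX)
    ultimately show ?case using Suc.IH
      by (cases "plen ((f ^^ Suc j) ` carrier X) ((f ^^ j) ` carrier X)";
          cases "plen ((f ^^ j) ` carrier X) (carrier X)") simp_all
  qed
  \<comment> \<open>An element of \<open>K k\<close> of the form f^k x has x in the kernel of
    f^(2k), which by stability is \<open>K k\<close>, so it is 0. Thus \<open>K k\<close> embeds
    into X / f^k X and has finite length.\<close>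
  have "K k \<inter> (f ^^ k) ` carrier X \<subseteq> {\<zero>}"
  proof
    fix y assume y: "y \<in> K k \<inter> (f ^^ k) ` carrier X"
    then obtain x where x: "x \<in> carrier X" "y = (f ^^ k) x" by blast
    have "(f ^^ (k + k)) x = \<zero>" using y x by (simp add: funpow_add K_def)
    then have "x \<in> K k" using stable[of k] x by (auto simp: K_def)
    then show "y \<in> {\<zero>}" using x by (simp add: K_def)
  qed
  then have "plen {\<zero>} (K k) \<le> plen ((f ^^ k) ` carrier X) (submodule_sum (K k) ((f ^^ k) ` carrier X))"
    by (intro len_le_sum zX sK sI zI)
  also have "\<dots> \<le> plen ((f ^^ k) ` carrier X) (carrier X)"
    by (intro len_mono sI subset_refl submodule_sum_upper sK submodule_sum_least[OF X] AX)
  also note finI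
  finally have finK: "plen {\<zero>} (K k) < \<infinity>" .
  let ?ker = "{x \<in> carrier X. f x = \<zero>}"
  have fK_K: "x \<in> K k" if "x \<in> carrier X" "f x \<in> K k" for x
  proof -
    have "(f ^^ Suc k) x = \<zero>" using that by (simp add: K_def funpow_Suc_right del: funpow.simps)
    then show ?thesis using stable[of 1] that by (auto simp: K_def)
  qed
  have "f ` K k \<subseteq> K k"
  proof
    fix y assume "y \<in> f ` K k"
    then obtain x where x: "x \<in> K k" "y = f x" by blast
    have "(f ^^ k) y = (f ^^ Suc k) x" using x by (simp add: funpow_Suc_right del: funpow.simps)
    also have "\<dots> = f ((f ^^ k) x)" by simp
    also have "\<dots> = \<zero>" using x by (simp add: K_def)
    finally show "y \<in> K k" using x by (auto simp: K_def)
  qed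
  have kerK: "?ker \<subseteq> K k" using fK_K zI[OF sK] by auto
  then have ker: "{x \<in> K k. f x = \<zero>} = ?ker" using AX[OF sK] by auto
  have sker: "smod ?ker" by (rule kernel_submodule[OF f module_axioms X])
  have sfK: "smod (f ` K k)" by (rule hom_image_submodule[OF f module_axioms sK])
  have 1: "plen {\<zero>} (f ` K k) = plen ?ker (K k)" using hom_len_image[OF f module_axioms sK[of k]] unfolding ker .
  have 2: "plen {\<zero>} (K k) = plen {\<zero>} ?ker + plen ?ker (K k)"
    by (intro len_add zX sker sK zI kerK)
  have 3: "plen {\<zero>} (K k) = plen {\<zero>} (f ` K k) + plen (f ` K k) (K k)"
    by (intro len_add zX sfK sK zI \<open>f ` K k \<subseteq> K k\<close>)
  \<comment> \<open>Both sides complement the length of \<open>f K\<close>, which is also that of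
    \<open>K\<close> modulo the kernel, in the length of \<open>K\<close>. Cancelling it is
    legitimate because the length of \<open>K\<close> is finite.\<close>
  have 4: "plen {\<zero>} ?ker = plen (f ` K k) (K k)"
    using 1 2 3 finK by (cases "plen {\<zero>} ?ker"; cases "plen ?ker (K k)"; cases "plen (f ` K k) (K k)") auto
  \<comment> \<open>Injectivity of \<open>f\<close> modulo \<open>K\<close>: if \<open>f x\<close>
    lies in \<open>K\<close>, so does \<open>x\<close>. Hence \<open>K / f K\<close> embeds into
    \<open>X / f X\<close>, and what remains of the cokernel is
    \<open>X / (K + f X)\<close>.\<close>
  have "K k \<inter> ?fX \<subseteq> f ` K k" using fK_K by auto
  then have 5: "plen (f ` K k) (K k) \<le> plen ?fX (submodule_sum (K k) ?fX)"
    by (intro len_le_sum sfK sK sfX \<open>f ` K k \<subseteq> K k\<close>)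
  have 6: "plen ?fX (carrier X) = plen ?fX (submodule_sum (K k) ?fX) + plen (submodule_sum (K k) ?fX) (carrier X)"
    by (intro len_add sfX sum_is_submodule sK X submodule_sum_upper AX)
  show ?thesis
  proof (rule that[OF sK finK])
    show "plen {\<zero>} ?ker + plen (submodule_sum (K k) ?fX) (carrier X) \<le> plen ?fX (carrier X)"
      unfolding 6 4 using 5 by (rule add_right_mono)
  qed
qed

end

lemma kernel_length_le:
  assumes "noetherian_ring R" "cring R" and P: "primeideal P R"
    and f: "f \<in> module_hom R (free_rank R n) (free_rank R n)"
  defines "F \<equiv> free_rank R n"
  shows "local_length R P F {\<zero>\<^bsub>F\<^esub>} {x \<in> carrier F. f x = \<zero>\<^bsub>F\<^esub>} \<le> local_length R P F (f ` carrier F) (carrier F)"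
proof -
  interpret cring R by fact
  interpret F: module_at_prime R F P unfolding F_def by (rule module_at_primeI[OF P free_module_module])
  have noeth: "noetherian_module R F" unfolding F_def by (rule noetherian_free_rank[OF assms(1,2)])
  show ?thesis
  proof (cases "F.plen (f ` carrier F) (carrier F) < \<infinity>")
    case True
    then obtain K where "F.plen {\<zero>\<^bsub>F\<^esub>} {x \<in> carrier F. f x = \<zero>\<^bsub>F\<^esub>} + F.plen (F.submodule_sum K (f ` carrier F)) (carrier F)
       \<le> F.plen (f ` carrier F) (carrier F)"
      using F.endomorphism_length[OF noeth f[folded F_def]] by metis
    then show ?thesis by (rule order_trans[rotated]) simp
  qed simp
qed

text \<open>The gain over \<open>kernel_length_le\<close> is the length of
  \<open>X / (K + f X)\<close>. Were it 0, then \<open>K \<subseteq> P X\<close> and Nakayama's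
  lemma would make \<open>f X\<close> everything at \<open>P\<close>, against
  \<open>nz\<close>.\<close>

lemma kernel_length_less:
  assumes "noetherian_ring R" "cring R" and P: "primeideal P R"
    and f: "f \<in> module_hom R (free_rank R n) (free_rank R n)"
  defines "F \<equiv> free_rank R n"
  assumes fin: "local_length R P F (f ` carrier F) (carrier F) < \<infinity>"
    and nz: "local_length R P F (f ` carrier F) (carrier F) \<noteq> 0"
    and inf: "ring_length R P = \<infinity>"
  shows "local_length R P F {\<zero>\<^bsub>F\<^esub>} {x \<in> carrier F. f x = \<zero>\<^bsub>F\<^esub>} < local_length R P F (f ` carrier F) (carrier F)"
proof -
  interpret cring R by fact
  interpret F: module_at_prime R F P unfolding F_def by (rule module_at_primeI[OF P free_module_module])
  interpret S: module_at_prime R "self_module R" P by (rule module_at_primeI[OF P self_module_module])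
  have noeth: "noetherian_module R F" unfolding F_def by (rule noetherian_free_rank[OF assms(1,2)])
  let ?fX = "f ` carrier F"
  have X: "F.smod (carrier F)" by (rule carrier_submodule[OF F.module_axioms])
  have sfX: "F.smod ?fX" by (rule hom_image_submodule[OF f[folded F_def] F.module_axioms X])
  have fXX: "?fX \<subseteq> carrier F" using sfX by (simp add: submodule_def)
  obtain K where K: "F.smod K" "F.plen {\<zero>\<^bsub>F\<^esub>} K < \<infinity>"
    and le: "F.plen {\<zero>\<^bsub>F\<^esub>} {x \<in> carrier F. f x = \<zero>\<^bsub>F\<^esub>} + F.plen (F.submodule_sum K ?fX) (carrier F)
       \<le> F.plen ?fX (carrier F)"
    by (rule F.endomorphism_length[OF noeth f[folded F_def] fin])
  have KF: "K \<subseteq> carrier F" using K by (simp add: submodule_def)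
  \<comment> \<open>The j-th coordinates of \<open>K\<close> form an ideal whose length at
    \<open>P\<close> is at most that of \<open>K\<close>, thus finite. If it contained an element
    outside \<open>P\<close>, it would be the whole ring at \<open>P\<close>, and the length of the
    ring at \<open>P\<close> would be finite.\<close>
  have coords: "x j \<in> P" if x: "x \<in> K" and j: "j < n" for x j
  proof (rule ccontr)
    assume nP: "x j \<notin> P"
    have xj: "x j \<in> carrier R" using x KF j by (auto simp: F_def free_rank_carrier)
    let ?\<pi> = "\<lambda>x. x j"
    have hom: "?\<pi> \<in> module_hom R F (self_module R)" unfolding F_def by (rule coord_hom[OF j])
    have "{\<zero>\<^bsub>F\<^esub>} \<subseteq> K" using K(1) by (simp add: submodule_def)
    then have le1: "S.plen (?\<pi> ` {\<zero>\<^bsub>F\<^esub>}) (?\<pi> ` K) \<le> F.plen {\<zero>\<^bsub>F\<^esub>} K"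
      by (rule F.hom_len_le[OF hom self_module_module zero_submodule[OF F.module_axioms] K(1)])
    have eq: "?\<pi> ` {\<zero>\<^bsub>F\<^esub>} = {\<zero>\<^bsub>R\<^esub>}" using j by (simp add: F_def free_module_simps)
    have finI: "S.plen {\<zero>\<^bsub>R\<^esub>} (?\<pi> ` K) < \<infinity>"
      using le1 K(2) unfolding eq by (rule order_le_less_trans)
    have sI: "S.smod (?\<pi> ` K)" by (rule hom_image_submodule[OF hom self_module_module K(1)])
    have "S.ple (carrier R) (?\<pi> ` K)" unfolding local_le_def
    proof
      fix a assume a: "a \<in> carrier R"
      have "a \<otimes>\<^bsub>R\<^esub> x j \<in> ?\<pi> ` K" using submodule.smult_closed[OF sI a, of "x j"] x by simp
      then show "\<exists>s\<in>carrier R - P. s \<odot>\<^bsub>self_module R\<^esub> a \<in> ?\<pi> ` K"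
        using nP xj a by (intro bexI[of _ "x j"]) (auto simp: m_comm)
    qed
    moreover have sR: "S.smod (carrier R)" using carrier_submodule[OF self_module_module] by simp
    moreover have IR: "?\<pi> ` K \<subseteq> carrier R" using sI by (simp add: submodule_def)
    ultimately have 0: "S.plen (?\<pi> ` K) (carrier R) = 0" using S.len_zero_iff[OF sI] by blast
    have z: "S.smod {\<zero>\<^bsub>R\<^esub>}" using zero_submodule[OF self_module_module] by simp
    have zI: "{\<zero>\<^bsub>R\<^esub>} \<subseteq> ?\<pi> ` K" using sI by (simp add: submodule_def)
    have "ring_length R P = S.plen {\<zero>\<^bsub>R\<^esub>} (?\<pi> ` K) + S.plen (?\<pi> ` K) (carrier R)"
      by (rule S.len_add[OF z sI sR zI IR])
    then show False using 0 finI inf by simp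
  qed
  have "F.plen (F.submodule_sum K ?fX) (carrier F) \<noteq> 0"
  proof
    assume 0: "F.plen (F.submodule_sum K ?fX) (carrier F) = 0"
    have sum: "F.submodule_sum K ?fX \<subseteq> carrier F" by (rule F.submodule_sum_least[OF X KF fXX])
    have le': "F.ple (carrier F) (F.submodule_sum K ?fX)"
      using F.len_zero_iff[OF F.sum_is_submodule[OF K(1) sfX] X sum] 0 by blast
    have "F.ple (carrier F) ?fX"
    proof (rule F.local_nakayama[OF noeth sfX])
      fix C assume C: "F.smod C" "?fX \<subseteq> C" and PC: "\<And>p x. p \<in> P \<Longrightarrow> x \<in> carrier F \<Longrightarrow> p \<odot>\<^bsub>F\<^esub> x \<in> C"
      have "K \<subseteq> C"
      proof
        fix x assume x: "x \<in> K"
        show "x \<in> C"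
        proof (rule free_rank_memI[OF C(1)[unfolded F_def]])
          show "x \<in> carrier (free_rank R n)" using x KF by (auto simp: F_def)
          fix j assume j: "j < n"
          show "x j \<odot>\<^bsub>free_rank R n\<^esub> free_gen R {..<n} j \<in> C"
            using PC[OF coords[OF x j], of "free_gen R {..<n} j"] free_gen_closed[of j "{..<n}"] j by (simp add: F_def)
        qed
      qed
      then have "F.submodule_sum K ?fX \<subseteq> C" by (intro F.submodule_sum_least C)
      then have "F.ple (F.submodule_sum K ?fX) C" using C by (intro F.local_le_subset) (auto simp: submodule_def)
      then show "F.ple (carrier F) C" by (rule F.local_le_trans[OF subset_refl le'])
    qed
    then show False using nz F.len_zero_iff[OF sfX X fXX] by blast
  qed
  then show ?thesis using le fin
    by (cases "F.plen {\<zero>\<^bsub>F\<^esub>} {x \<in> carrier F. f x = \<zero>\<^bsub>F\<^esub>}"; cases "F.plen (F.submodule_sum K ?fX) (carrier F)";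
        cases "F.plen ?fX (carrier F)") (auto simp: zero_enat_def)
qed

section \<open>Quotient modules\<close>

lemma quot_module_simps:
  "carrier (quot_module X N) = a_rcosets\<^bsub>X\<^esub> N" "Z \<oplus>\<^bsub>quot_module X N\<^esub> W = Z <+>\<^bsub>X\<^esub> W"
  "\<zero>\<^bsub>quot_module X N\<^esub> = N" "a \<odot>\<^bsub>quot_module X N\<^esub> Z = (\<Union>x\<in>Z. N +>\<^bsub>X\<^esub> (a \<odot>\<^bsub>X\<^esub> x))"
  by (simp_all add: quot_module_def)

locale quotient = module R X for R and X (structure) + fixes N
  assumes sub: "submodule R N X"
begin

lemma abelian_subgroup_N: "abelian_subgroup N X"
proof (rule abelian_subgroupI3)
  show "additive_subgroup N X"
  proof (rule additive_subgroupI, rule M.add.subgroupI)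
    show "N \<subseteq> carrier X" using sub by (simp add: submodule_def)
    show "N \<noteq> {}" using sub by (auto simp: submodule_def)
    show "\<ominus> a \<in> N" if "a \<in> N" for a
    proof -
      have "\<zero> \<ominus> a \<in> N" using submodule_minus_closed[OF sub _ that] sub by (simp add: submodule_def)
      then show ?thesis using submodule_subsetD[OF sub that] by (simp add: a_minus_def)
    qed
    show "a \<oplus> b \<in> N" if "a \<in> N" "b \<in> N" for a b using sub that by (simp add: submodule_def)
  qed
qed (rule M.abelian_group_axioms)

sublocale N: abelian_subgroup N X by (rule abelian_subgroup_N)

lemma coset_eq_iff:
  assumes "x \<in> carrier X" "y \<in> carrier X"
  shows "N +> x = N +> y \<longleftrightarrow> x \<ominus> y \<in> N"
proof
  assume "N +> x = N +> y"
  then have "x \<in> N +> y" using N.a_rcos_self[OF assms(1)] by simp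
  then show "x \<ominus> y \<in> N" using N.a_rcos_module[OF assms(2,1)] by (simp add: a_minus_def)
next
  assume "x \<ominus> y \<in> N"
  then have "x \<in> N +> y" using N.a_rcos_module[OF assms(2,1)] by (simp add: a_minus_def)
  then show "N +> x = N +> y" using N.a_repr_independence'[OF _ assms(2)] by blast
qed

lemma coset_zero: "N +> \<zero> = N" using N.a_rcos_const[OF N.zero_closed] .

lemma coset_eq_zero_iff: "x \<in> carrier X \<Longrightarrow> N +> x = N \<longleftrightarrow> x \<in> N"
  using N.a_rcos_const N.a_rcos_self by auto

lemma quot_carrierE:
  assumes "Z \<in> carrier (quot_module X N)" obtains x where "x \<in> carrier X" "Z = N +> x"
  using assms by (auto simp: quot_module_simps A_RCOSETS_def')

lemma coset_closed: "x \<in> carrier X \<Longrightarrow> N +> x \<in> carrier (quot_module X N)"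
  by (auto simp: quot_module_simps A_RCOSETS_def')

lemma quot_smult:
  assumes a: "a \<in> carrier R" and x: "x \<in> carrier X"
  shows "a \<odot>\<^bsub>quot_module X N\<^esub> (N +> x) = N +> (a \<odot> x)"
proof -
  have eq: "N +> (a \<odot> y) = N +> (a \<odot> x)" if y: "y \<in> N +> x" for y
  proof -
    have yX: "y \<in> carrier X" by (rule N.a_elemrcos_carrier[OF x y])
    have "a \<odot> y \<ominus> a \<odot> x = a \<odot> (y \<oplus> \<ominus> x)"
      using a x yX by (simp add: a_minus_def smult_r_distr smult_r_minus)
    also have "\<dots> \<in> N" using N.a_rcos_module_imp[OF x y] a sub by (simp add: submodule_def)
    finally show ?thesis using coset_eq_iff a x yX by simp
  qed
  have "x \<in> N +> x" by (rule N.a_rcos_self[OF x])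
  then have ne: "N +> x \<noteq> {}" by blast
  have "(\<Union>y\<in>N +> x. N +> (a \<odot> y)) = (\<Union>y\<in>N +> x. N +> (a \<odot> x))"
    by (rule SUP_cong[OF refl eq])
  then show ?thesis using ne by (simp add: quot_module_simps)
qed

lemma quot_add:
  "x \<in> carrier X \<Longrightarrow> y \<in> carrier X \<Longrightarrow>
    (N +> x) \<oplus>\<^bsub>quot_module X N\<^esub> (N +> y) = N +> (x \<oplus> y)"
  by (simp add: quot_module_simps N.a_rcos_sum)

lemma quot_zero: "\<zero>\<^bsub>quot_module X N\<^esub> = N +> \<zero>"
  by (simp add: quot_module_simps(3) coset_zero)

lemma quot_module_module: "module R (quot_module X N)"
proof (rule module_criteria, rule R.is_cring, unfold quot_zero)
  let ?Q = "quot_module X N"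
  show "N +> \<zero> \<in> carrier ?Q" by (rule coset_closed) simp
  show "\<forall>v w. v \<in> carrier ?Q \<and> w \<in> carrier ?Q \<longrightarrow> v \<oplus>\<^bsub>?Q\<^esub> w \<in> carrier ?Q"
    by (auto elim!: quot_carrierE simp: quot_add intro!: coset_closed)
  show "\<forall>v\<in>carrier ?Q. \<exists>neg_v\<in>carrier ?Q. v \<oplus>\<^bsub>?Q\<^esub> neg_v = N +> \<zero>"
  proof
    fix v assume "v \<in> carrier ?Q"
    then obtain x where x: "x \<in> carrier X" "v = N +> x" by (rule quot_carrierE)
    then show "\<exists>neg_v\<in>carrier ?Q. v \<oplus>\<^bsub>?Q\<^esub> neg_v = N +> \<zero>"
      by (intro bexI[of _ "N +> (\<ominus> x)"] coset_closed) (simp_all add: quot_add M.r_neg)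
  qed
  show "\<forall>c v. c \<in> carrier R \<and> v \<in> carrier ?Q \<longrightarrow> c \<odot>\<^bsub>?Q\<^esub> v \<in> carrier ?Q"
    by (auto elim!: quot_carrierE simp: quot_smult intro!: coset_closed)
  show "\<forall>v w. v \<in> carrier ?Q \<and> w \<in> carrier ?Q \<longrightarrow> v \<oplus>\<^bsub>?Q\<^esub> w = w \<oplus>\<^bsub>?Q\<^esub> v"
    by (auto elim!: quot_carrierE simp: quot_add M.a_comm)
  show "\<forall>v w x. v \<in> carrier ?Q \<and> w \<in> carrier ?Q \<and> x \<in> carrier ?Q \<longrightarrow>
      (v \<oplus>\<^bsub>?Q\<^esub> w) \<oplus>\<^bsub>?Q\<^esub> x = v \<oplus>\<^bsub>?Q\<^esub> (w \<oplus>\<^bsub>?Q\<^esub> x)"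
    by (auto elim!: quot_carrierE simp: quot_add M.a_assoc)
  show "\<forall>v\<in>carrier ?Q. v \<oplus>\<^bsub>?Q\<^esub> (N +> \<zero>) = v"
    by (auto elim!: quot_carrierE simp: quot_add)
  show "\<forall>a b v. a \<in> carrier R \<and> b \<in> carrier R \<and> v \<in> carrier ?Q \<longrightarrow>
      (a \<otimes>\<^bsub>R\<^esub> b) \<odot>\<^bsub>?Q\<^esub> v = a \<odot>\<^bsub>?Q\<^esub> (b \<odot>\<^bsub>?Q\<^esub> v)"
    by (auto elim!: quot_carrierE simp: quot_smult smult_assoc1)
  show "\<forall>v\<in>carrier ?Q. \<one>\<^bsub>R\<^esub> \<odot>\<^bsub>?Q\<^esub> v = v"
    by (auto elim!: quot_carrierE simp: quot_smult)
  show "\<forall>a b v. a \<in> carrier R \<and> b \<in> carrier R \<and> v \<in> carrier ?Q \<longrightarrow>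
      (a \<oplus>\<^bsub>R\<^esub> b) \<odot>\<^bsub>?Q\<^esub> v = a \<odot>\<^bsub>?Q\<^esub> v \<oplus>\<^bsub>?Q\<^esub> b \<odot>\<^bsub>?Q\<^esub> v"
    by (auto elim!: quot_carrierE simp: quot_smult quot_add smult_l_distr)
  show "\<forall>a v w. a \<in> carrier R \<and> v \<in> carrier ?Q \<and> w \<in> carrier ?Q \<longrightarrow>
      a \<odot>\<^bsub>?Q\<^esub> (v \<oplus>\<^bsub>?Q\<^esub> w) = a \<odot>\<^bsub>?Q\<^esub> v \<oplus>\<^bsub>?Q\<^esub> a \<odot>\<^bsub>?Q\<^esub> w"
    by (auto elim!: quot_carrierE simp: quot_smult quot_add smult_r_distr)
qed

lemma quot_proj_hom: "(\<lambda>x. N +> x) \<in> module_hom R X (quot_module X N)"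
  by (auto simp: module_hom_def quot_add quot_smult intro: coset_closed)

lemma annihilator_quot:
  "annihilator R (quot_module X N) = {a \<in> carrier R. \<forall>x\<in>carrier X. a \<odot> x \<in> N}"
proof -
  have "(\<forall>Z\<in>carrier (quot_module X N). a \<odot>\<^bsub>quot_module X N\<^esub> Z = \<zero>\<^bsub>quot_module X N\<^esub>) \<longleftrightarrow>
    (\<forall>x\<in>carrier X. a \<odot> x \<in> N)" if a: "a \<in> carrier R" for a
  proof
    assume L: "\<forall>Z\<in>carrier (quot_module X N). a \<odot>\<^bsub>quot_module X N\<^esub> Z = \<zero>\<^bsub>quot_module X N\<^esub>"
    show "\<forall>x\<in>carrier X. a \<odot> x \<in> N"
    proof
      fix x assume x: "x \<in> carrier X"
      then have "N +> (a \<odot> x) = N"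
        using L coset_closed[OF x] quot_smult[OF a x] by (simp add: quot_module_simps(3))
      then show "a \<odot> x \<in> N" using coset_eq_zero_iff a x by simp
    qed
  next
    assume "\<forall>x\<in>carrier X. a \<odot> x \<in> N"
    then have "N +> (a \<odot> x) = N" if "x \<in> carrier X" for x
      using that a coset_eq_zero_iff by simp
    then show "\<forall>Z\<in>carrier (quot_module X N). a \<odot>\<^bsub>quot_module X N\<^esub> Z = \<zero>\<^bsub>quot_module X N\<^esub>"
      unfolding quot_module_simps(3) using quot_smult[OF a] by (metis quot_carrierE)
  qed
  then show ?thesis by (auto simp: annihilator_def)
qed

end

lemma quotientI: "submodule R N X \<Longrightarrow> quotient R X N"
  by (simp add: quotient_def quotient_axioms_def submodule_def)

section \<open>Krull dimension of quotients\<close>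

text \<open>Primes pull back along \<open>h\<close>, and surjectivity keeps strict inclusions
  strict.\<close>

lemma krull_dim_surj_le:
  assumes h: "ring_hom_ring A B h" and A: "cring A" and surj: "h ` carrier A = carrier B"
  shows "krull_dim B \<le> krull_dim A"
  unfolding krull_dim_def
proof (rule Sup_least)
  fix d assume "d \<in> {ereal (real l) | l. \<exists>P. (\<forall>i\<le>l. primeideal (P i) B) \<and> (\<forall>i<l. P i \<subset> P (Suc i))}"
  then obtain l P where d: "d = ereal (real l)" and P: "\<forall>i\<le>l. primeideal (P i) B" and inc: "\<forall>i<l. P i \<subset> P (Suc i)"
    by blast
  define Q where "Q i = {a \<in> carrier A. h a \<in> P i}" for i
  have "primeideal (Q i) A" if "i \<le> l" for i
    unfolding Q_def using P that by (intro ring_hom_ring.primeideal_vimage[OF h A]) blast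
  moreover have "Q i \<subset> Q (Suc i)" if i: "i < l" for i
  proof -
    have sub: "P i \<subset> P (Suc i)" using inc i by blast
    then obtain y where y: "y \<in> P (Suc i)" "y \<notin> P i" by blast
    have "primeideal (P (Suc i)) B" using P i by simp
    then have "y \<in> carrier B" using y(1) by (intro ideal.Icarr[OF primeideal.axioms(1)])
    then obtain x where "x \<in> carrier A" "y = h x" using surj by blast
    then have "x \<in> Q (Suc i)" "x \<notin> Q i" using y by (auto simp: Q_def)
    moreover have "Q i \<subseteq> Q (Suc i)" using sub by (auto simp: Q_def)
    ultimately show ?thesis by blast
  qed
  ultimately have "d \<in> {ereal (real l) | l. \<exists>P. (\<forall>i\<le>l. primeideal (P i) A) \<and> (\<forall>i<l. P i \<subset> P (Suc i))}"
    using d by blast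
  then show "d \<le> Sup {ereal (real l) | l. \<exists>P. (\<forall>i\<le>l. primeideal (P i) A) \<and> (\<forall>i<l. P i \<subset> P (Suc i))}"
    by (rule Sup_upper)
qed

lemma (in cring) krull_dim_quot_le:
  assumes "ideal I R" shows "krull_dim (R Quot I) \<le> krull_dim R"
proof (rule krull_dim_surj_le[OF ideal.rcos_ring_hom_ring[OF assms] is_cring])
  show "(+>) I ` carrier R = carrier (R Quot I)" by (auto simp: FactRing_def A_RCOSETS_def')
qed

lemma (in cring) krull_dim_quot_mono:
  assumes I: "ideal I R" and J: "ideal J R" and IJ: "I \<subseteq> J"
  shows "krull_dim (R Quot J) \<le> krull_dim (R Quot I)"
proof -
  interpret I: ideal I R by fact
  interpret J: ideal J R by fact
  \<comment> \<open>Adding \<open>J\<close> to a coset of \<open>I\<close> gives the coset of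
    \<open>J\<close> with the same representative, so set addition realises the projection from
    \<open>R / I\<close> onto \<open>R / J\<close> without a choice of representatives.\<close>
  have JI: "J <+>\<^bsub>R\<^esub> I = J"
  proof
    show "J <+>\<^bsub>R\<^esub> I \<subseteq> J" using IJ by (auto simp: set_add_def set_mult_def)
    show "J \<subseteq> J <+>\<^bsub>R\<^esub> I"
    proof
      fix j assume "j \<in> J"
      then have "j = j \<oplus> \<zero>" "\<zero> \<in> I" using J.a_subset by auto
      then show "j \<in> J <+>\<^bsub>R\<^esub> I" using \<open>j \<in> J\<close> unfolding set_add_def set_mult_def by fastforce
    qed
  qed
  have h: "J <+>\<^bsub>R\<^esub> (I +> a) = J +> a" if "a \<in> carrier R" for a
    using a_setmult_rcos_assoc[OF J.a_subset I.a_subset that] JI by simp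
  have carr: "Z \<in> carrier (R Quot K) \<longleftrightarrow> (\<exists>a\<in>carrier R. Z = K +> a)" for Z K
    by (auto simp: FactRing_def A_RCOSETS_def')
  have mult: "(K +> a) \<otimes>\<^bsub>R Quot K\<^esub> (K +> b) = K +> (a \<otimes> b)" if "ideal K R" "a \<in> carrier R" "b \<in> carrier R" for K a b
    using ring_hom_mult[OF ideal.rcos_ring_hom[OF that(1)] that(2,3)] by simp
  have add: "(K +> a) \<oplus>\<^bsub>R Quot K\<^esub> (K +> b) = K +> (a \<oplus> b)" if "ideal K R" "a \<in> carrier R" "b \<in> carrier R" for K a b
    using ring_hom_add[OF ideal.rcos_ring_hom[OF that(1)] that(2,3)] by simp
  have one: "\<one>\<^bsub>R Quot K\<^esub> = K +> \<one>" for K by (simp add: FactRing_def)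
  have "ring_hom_ring (R Quot I) (R Quot J) (\<lambda>Z. J <+>\<^bsub>R\<^esub> Z)"
  proof (rule ring_hom_ringI[OF I.quotient_is_ring J.quotient_is_ring])
    fix Z assume "Z \<in> carrier (R Quot I)"
    then obtain a where "a \<in> carrier R" "Z = I +> a" using carr by blast
    then show "J <+>\<^bsub>R\<^esub> Z \<in> carrier (R Quot J)" using h carr by auto
  next
    fix Z W assume "Z \<in> carrier (R Quot I)" "W \<in> carrier (R Quot I)"
    then obtain a b where ab: "a \<in> carrier R" "b \<in> carrier R" "Z = I +> a" "W = I +> b" using carr by metis
    show "J <+>\<^bsub>R\<^esub> (Z \<otimes>\<^bsub>R Quot I\<^esub> W) = (J <+>\<^bsub>R\<^esub> Z) \<otimes>\<^bsub>R Quot J\<^esub> (J <+>\<^bsub>R\<^esub> W)"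
      unfolding ab(3,4) mult[OF I ab(1,2)] h[OF ab(1)] h[OF ab(2)] mult[OF J ab(1,2)] using ab h by simp
    show "J <+>\<^bsub>R\<^esub> (Z \<oplus>\<^bsub>R Quot I\<^esub> W) = (J <+>\<^bsub>R\<^esub> Z) \<oplus>\<^bsub>R Quot J\<^esub> (J <+>\<^bsub>R\<^esub> W)"
      unfolding ab(3,4) add[OF I ab(1,2)] h[OF ab(1)] h[OF ab(2)] add[OF J ab(1,2)] using ab h by simp
  next
    show "J <+>\<^bsub>R\<^esub> \<one>\<^bsub>R Quot I\<^esub> = \<one>\<^bsub>R Quot J\<^esub>" by (simp add: one h)
  qed
  moreover have "(\<lambda>Z. J <+>\<^bsub>R\<^esub> Z) ` carrier (R Quot I) = carrier (R Quot J)"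
  proof
    show "(\<lambda>Z. J <+>\<^bsub>R\<^esub> Z) ` carrier (R Quot I) \<subseteq> carrier (R Quot J)"
    proof
      fix Z assume "Z \<in> (\<lambda>Z. J <+>\<^bsub>R\<^esub> Z) ` carrier (R Quot I)"
      then obtain a where "a \<in> carrier R" "Z = J <+>\<^bsub>R\<^esub> (I +> a)" using carr by auto
      then show "Z \<in> carrier (R Quot J)" using h carr by auto
    qed
    show "carrier (R Quot J) \<subseteq> (\<lambda>Z. J <+>\<^bsub>R\<^esub> Z) ` carrier (R Quot I)"
    proof
      fix Z assume "Z \<in> carrier (R Quot J)"
      then obtain a where a: "a \<in> carrier R" "Z = J +> a" using carr by auto
      then have "Z = J <+>\<^bsub>R\<^esub> (I +> a)" "I +> a \<in> carrier (R Quot I)" using h carr by auto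
      then show "Z \<in> (\<lambda>Z. J <+>\<^bsub>R\<^esub> Z) ` carrier (R Quot I)" by (rule image_eqI)
    qed
  qed
  ultimately show ?thesis using I.quotient_is_cring[OF is_cring] by (intro krull_dim_surj_le)
qed

text \<open>Zorn's lemma yields maximal sets, so it is applied to the complements of the primes; the
  upper bound of a chain is the complement of an intersection. \<open>Q0\<close> serves as the bound
  of the empty chain.\<close>

lemma (in cring) minimal_prime_over:
  assumes I: "Q0 \<in> {Q. primeideal Q R \<and> I \<subseteq> Q}"
  obtains P where "primeideal P R" "I \<subseteq> P" "\<And>Q. primeideal Q R \<Longrightarrow> I \<subseteq> Q \<Longrightarrow> Q \<subseteq> P \<Longrightarrow> Q = P"
proof -
  define S where "S = {Q. primeideal Q R \<and> I \<subseteq> Q}"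
  have sub: "Q \<subseteq> carrier R" if "Q \<in> S" for Q
    using that ideal.Icarr[OF primeideal.axioms(1)] by (auto simp: S_def)
  have "\<exists>M\<in>(\<lambda>Q. carrier R - Q) ` S. \<forall>X\<in>(\<lambda>Q. carrier R - Q) ` S. M \<subseteq> X \<longrightarrow> X = M"
  proof (rule subset_Zorn)
    fix C assume C: "subset.chain ((\<lambda>Q. carrier R - Q) ` S) C"
    show "\<exists>U\<in>(\<lambda>Q. carrier R - Q) ` S. \<forall>X\<in>C. X \<subseteq> U"
    proof (cases "C = {}")
      case True then show ?thesis using I by (auto simp: S_def)
    next
      case False
      define D where "D = {Q \<in> S. carrier R - Q \<in> C}"
      have Ceq: "X \<in> C \<Longrightarrow> \<exists>Q\<in>D. X = carrier R - Q" for X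
        using C unfolding subset_chain_def D_def by auto
      have chain: "Q \<subseteq> Q' \<or> Q' \<subseteq> Q" if "Q \<in> D" "Q' \<in> D" for Q Q'
      proof -
        have "carrier R - Q \<subseteq> carrier R - Q' \<or> carrier R - Q' \<subseteq> carrier R - Q"
          using C that unfolding subset_chain_def D_def by auto
        moreover have "Q \<subseteq> carrier R" "Q' \<subseteq> carrier R" using sub that unfolding D_def by auto
        ultimately show ?thesis by auto
      qed
      obtain X where "X \<in> C" using False by auto
      then obtain Q1 where Q1: "Q1 \<in> D" using Ceq by auto
      have DS: "D \<subseteq> S" by (auto simp: D_def)
      have pr: "primeideal Q R" "I \<subseteq> Q" if "Q \<in> D" for Q using that by (auto simp: D_def S_def)
      have idl: "ideal Q R" if "Q \<in> D" for Q using primeideal.axioms(1)[OF pr(1)[OF that]] .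
      have "primeideal (\<Inter>D) R"
      proof (rule primeidealI[OF _ is_cring])
        show "ideal (\<Inter>D) R"
        proof (rule comm_idealI)
          show "\<Inter>D \<subseteq> carrier R" using Q1 DS sub[of Q1] by auto
          show "\<zero> \<in> \<Inter>D"
            by (rule InterI) (rule additive_subgroup.zero_closed[OF ideal.axioms(1)[OF idl]])
          show "a \<oplus> b \<in> \<Inter>D" if "a \<in> \<Inter>D" "b \<in> \<Inter>D" for a b
            by (rule InterI) (rule additive_subgroup.a_closed[OF ideal.axioms(1)[OF idl] InterD[OF that(1)] InterD[OF that(2)]])
          show "r \<otimes> a \<in> \<Inter>D" if "a \<in> \<Inter>D" "r \<in> carrier R" for a r
            by (rule InterI) (rule ideal.I_l_closed[OF idl InterD[OF that(1)] that(2)])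
        qed
        have "\<one> \<notin> Q1" using primeideal.I_notcarr[OF pr(1)[OF Q1]] ideal.one_imp_carrier[OF idl[OF Q1]] by auto
        then show "carrier R \<noteq> \<Inter>D" using Q1 by (metis InterD one_closed)
        fix a b assume ab: "a \<in> carrier R" "b \<in> carrier R" "a \<otimes> b \<in> \<Inter>D"
        show "a \<in> \<Inter>D \<or> b \<in> \<Inter>D"
        proof (rule ccontr)
          assume "\<not> (a \<in> \<Inter>D \<or> b \<in> \<Inter>D)"
          \<comment> \<open>The two primes are comparable; the smaller one contains neither
            \<open>a\<close> nor \<open>b\<close>, yet contains their product.\<close>
          then obtain Q Q' where Q: "Q \<in> D" "a \<notin> Q" "Q' \<in> D" "b \<notin> Q'" by blast
          have "a \<otimes> b \<in> Q" "a \<otimes> b \<in> Q'" using ab(3) Q(1,3) by auto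
          then have "a \<in> Q \<or> b \<in> Q" "a \<in> Q' \<or> b \<in> Q'"
            using primeideal.I_prime[OF pr(1)[OF Q(1)] ab(1,2)] primeideal.I_prime[OF pr(1)[OF Q(3)] ab(1,2)] by auto
          then show False using Q chain[OF Q(1,3)] by auto
        qed
      qed
      moreover have "I \<subseteq> \<Inter>D" using pr(2) by blast
      ultimately have "\<Inter>D \<in> S" by (simp add: S_def)
      then have "carrier R - \<Inter>D \<in> (\<lambda>Q. carrier R - Q) ` S" by (rule imageI)
      moreover have "\<forall>X\<in>C. X \<subseteq> carrier R - \<Inter>D"
      proof
        fix X assume "X \<in> C"
        then obtain Q where "Q \<in> D" "X = carrier R - Q" using Ceq by auto
        then show "X \<subseteq> carrier R - \<Inter>D" by auto
      qed
      ultimately show ?thesis by (rule bexI[rotated])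
    qed
  qed
  then obtain P where P: "P \<in> S" "\<forall>X\<in>(\<lambda>Q. carrier R - Q) ` S. carrier R - P \<subseteq> X \<longrightarrow> X = carrier R - P"
    by auto
  show ?thesis
  proof (rule that)
    show "primeideal P R" "I \<subseteq> P" using P(1) by (auto simp: S_def)
    fix Q assume "primeideal Q R" "I \<subseteq> Q" "Q \<subseteq> P"
    then have Q: "Q \<in> S" by (simp add: S_def)
    then have "carrier R - Q \<in> (\<lambda>Q. carrier R - Q) ` S" by (rule imageI)
    moreover have "carrier R - P \<subseteq> carrier R - Q" using \<open>Q \<subseteq> P\<close> by auto
    ultimately have "carrier R - Q = carrier R - P" by (rule P(2)[rule_format])
    then show "Q = P" using sub[OF Q] sub[OF P(1)] by auto
  qed
qed

lemma (in cring) exists_prime_over: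
  assumes R: "noetherian_ring R" and I: "ideal I R" "I \<noteq> carrier R"
  obtains Q where "primeideal Q R" "I \<subseteq> Q"
proof -
  interpret noetherian_ring R by fact
  let ?S = "{J. ideal J R \<and> I \<subseteq> J \<and> J \<noteq> carrier R}"
  have "?S \<noteq> {}" using I by blast
  moreover have "ideal J R" if "J \<in> ?S" for J using that by simp
  ultimately obtain J where J: "J \<in> ?S" "\<forall>J'\<in>?S. J \<subseteq> J' \<longrightarrow> J' = J" by (rule ideal_maximal_elem)
  have "maximalideal J R"
  proof (rule maximalidealI)
    show "ideal J R" "carrier R \<noteq> J" using J by auto
    fix J' assume "ideal J' R" "J \<subseteq> J'" "J' \<subseteq> carrier R"
    then show "J' = J \<or> J' = carrier R" using J by blast
  qed
  then have "primeideal J R" by (rule maximalideal_prime)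
  then show ?thesis using that J by blast
qed

section \<open>Supports of syzygies\<close>

text \<open>The product of the denominators of the finitely many basis vectors works for every
  element. This links vanishing at \<open>P\<close> to the annihilator: the support of a finitely
  generated module is closed.\<close>

lemma (in cring) uniform_local_le:
  assumes P: "primeideal P R" and N: "submodule R N (free_rank R n)"
    and le: "local_le R P (free_rank R n) (carrier (free_rank R n)) N"
  obtains s where "s \<in> carrier R - P" "\<forall>x\<in>carrier (free_rank R n). s \<odot>\<^bsub>free_rank R n\<^esub> x \<in> N"
proof -
  let ?F = "free_rank R n"
  interpret F: module_at_prime R ?F P by (rule module_at_primeI[OF P free_module_module])
  let ?e = "free_gen R {..<n}"
  have e: "?e j \<in> carrier ?F" if "j < n" for j using that by (intro free_gen_closed) simp
  have "\<exists>s\<in>carrier R - P. \<forall>j<m. s \<odot>\<^bsub>?F\<^esub> ?e j \<in> N" if "m \<le> n" for m using that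
  proof (induction m)
    case 0 then show ?case using F.one_not_prime by blast
  next
    case (Suc m)
    then obtain s where s: "s \<in> carrier R - P" "\<forall>j<m. s \<odot>\<^bsub>?F\<^esub> ?e j \<in> N" by auto
    have m: "m < n" using Suc.prems by simp
    obtain t where t: "t \<in> carrier R - P" "t \<odot>\<^bsub>?F\<^esub> ?e m \<in> N"
      using le e[OF m] by (auto simp: local_le_def)
    have "(s \<otimes> t) \<odot>\<^bsub>?F\<^esub> ?e j \<in> N" if j: "j < Suc m" for j
    proof (cases "j = m")
      case True
      have "(s \<otimes> t) \<odot>\<^bsub>?F\<^esub> ?e m = s \<odot>\<^bsub>?F\<^esub> (t \<odot>\<^bsub>?F\<^esub> ?e m)"
        using s t e[OF m] by (intro F.smult_assoc1) auto
      then show ?thesis using True submodule.smult_closed[OF N] s t by simp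
    next
      case False
      then have j': "j < m" "j < n" using j m by auto
      have "(s \<otimes> t) \<odot>\<^bsub>?F\<^esub> ?e j = (t \<otimes> s) \<odot>\<^bsub>?F\<^esub> ?e j" using s t by (simp add: m_comm)
      also have "\<dots> = t \<odot>\<^bsub>?F\<^esub> (s \<odot>\<^bsub>?F\<^esub> ?e j)"
        using s t e[OF j'(2)] by (intro F.smult_assoc1) auto
      finally show ?thesis using submodule.smult_closed[OF N] s t j'(1) by simp
    qed
    then show ?case using F.not_prime_mult[OF s(1) t(1)] by blast
  qed
  from this[OF order_refl] obtain s where s: "s \<in> carrier R - P" "\<forall>j<n. s \<odot>\<^bsub>?F\<^esub> ?e j \<in> N" by blast
  show ?thesis
  proof (rule that[OF s(1)], rule ballI)
    fix x assume x: "x \<in> carrier ?F"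
    then have xj: "x j \<in> carrier R" if "j < n" for j using that by (auto simp: free_rank_carrier)
    have sR: "s \<in> carrier R" using s by simp
    show "s \<odot>\<^bsub>?F\<^esub> x \<in> N"
    proof (rule free_rank_memI[OF N])
      show "s \<odot>\<^bsub>?F\<^esub> x \<in> carrier ?F" by (rule F.smult_closed[OF sR x])
      fix j assume j: "j < n"
      have "(s \<odot>\<^bsub>?F\<^esub> x) j = x j \<otimes> s" using j xj[OF j] sR by (simp add: free_module_simps m_comm)
      then have "(s \<odot>\<^bsub>?F\<^esub> x) j \<odot>\<^bsub>?F\<^esub> ?e j = x j \<odot>\<^bsub>?F\<^esub> (s \<odot>\<^bsub>?F\<^esub> ?e j)"
        using F.smult_assoc1[OF xj[OF j] sR e[OF j]] by simp
      then show "(s \<odot>\<^bsub>?F\<^esub> x) j \<odot>\<^bsub>?F\<^esub> ?e j \<in> N"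
        using submodule.smult_closed[OF N xj[OF j]] s(2) j by simp
    qed
  qed
qed

lemma module_hom_zero:
  assumes "f \<in> module_hom R A B" "module R A" "module R B" shows "f \<zero>\<^bsub>A\<^esub> = \<zero>\<^bsub>B\<^esub>"
proof -
  interpret mod_hom R A B f using assms by (simp add: mod_hom_def mod_hom_axioms_def)
  show ?thesis by (rule f0_is_0)
qed

lemma module_hom_mem: "f \<in> module_hom R A B \<Longrightarrow> x \<in> carrier A \<Longrightarrow> f x \<in> carrier B"
  by (auto simp: module_hom_def)

text \<open>This is \<open>I\<close> times the free module, described by coordinates instead of as a
  span.\<close>

definition coord_submodule :: "('a, 'r) ring_scheme \<Rightarrow> 'a set \<Rightarrow> nat \<Rightarrow> (nat \<Rightarrow> 'a) set" where
  "coord_submodule R I n = {x \<in> carrier (free_rank R n). \<forall>j<n. x j \<in> I}"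

lemma (in cring) coord_submodule_submodule:
  assumes "ideal I R" shows "submodule R (coord_submodule R I n) (free_rank R n)"
proof -
  interpret I: ideal I R by fact
  interpret T: module R "free_rank R n" by (rule free_module_module)
  show ?thesis unfolding submodule_def coord_submodule_def
    using free_module_module I.a_closed I.zero_closed I.I_l_closed
    by (auto simp: T.smult_closed) (auto simp: free_module_simps)
qed

lemma (in cring) smult_coord_submodule:
  assumes I: "ideal I R" and a: "a \<in> I" and y: "y \<in> carrier (free_rank R n)"
  shows "a \<odot>\<^bsub>free_rank R n\<^esub> y \<in> coord_submodule R I n"
proof -
  interpret I: ideal I R by fact
  interpret F: module R "free_rank R n" by (rule free_module_module)
  have yc: "y j \<in> carrier R" if "j < n" for j using y that by (auto simp: free_rank_carrier)
  show ?thesis unfolding coord_submodule_def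
  proof (intro CollectI conjI allI impI)
    show "a \<odot>\<^bsub>free_rank R n\<^esub> y \<in> carrier (free_rank R n)" by (rule F.smult_closed[OF I.Icarr[OF a] y])
    show "(a \<odot>\<^bsub>free_rank R n\<^esub> y) j \<in> I" if "j < n" for j
      using I.I_r_closed[OF a yc[OF that]] that by (simp add: free_module_simps)
  qed
qed

lemma (in cring) hom_coord_submodule:
  assumes I: "ideal I R" and f: "f \<in> module_hom R (free_rank R n) (free_rank R p)"
    and x: "x \<in> coord_submodule R I n"
  shows "f x \<in> coord_submodule R I p"
proof -
  interpret F: module R "free_rank R n" by (rule free_module_module)
  let ?C = "{x \<in> carrier (free_rank R n). f x \<in> coord_submodule R I p}"
  have C: "submodule R ?C (free_rank R n)"
    by (rule hom_vimage_submodule[OF f free_module_module coord_submodule_submodule[OF I]])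
  have "x \<in> ?C"
  proof (rule free_rank_memI[OF C])
    show "x \<in> carrier (free_rank R n)" using x by (simp add: coord_submodule_def)
    fix j assume j: "j < n"
    have e: "free_gen R {..<n} j \<in> carrier (free_rank R n)" using j by (intro free_gen_closed) simp
    have xj: "x j \<in> I" using x j by (simp add: coord_submodule_def)
    have xR: "x j \<in> carrier R" using ideal.Icarr[OF I xj] .
    have "f (x j \<odot>\<^bsub>free_rank R n\<^esub> free_gen R {..<n} j) = x j \<odot>\<^bsub>free_rank R p\<^esub> f (free_gen R {..<n} j)"
      by (rule module_hom_smult[OF f xR e])
    also have "\<dots> \<in> coord_submodule R I p" by (rule smult_coord_submodule[OF I xj module_hom_mem[OF f e]])
    finally show "x j \<odot>\<^bsub>free_rank R n\<^esub> free_gen R {..<n} j \<in> ?C" using F.smult_closed[OF xR e] by simp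
  qed
  then show ?thesis by simp
qed

section \<open>Lengths of syzygies along a resolution\<close>

lemma a_kernel_eq: "a_kernel X Y f = {x \<in> carrier X. f x = \<zero>\<^bsub>Y\<^esub>}"
  by (simp add: a_kernel_def kernel_def)

text \<open>Minimality is not included, because the resolution chosen inside \<open>Tor\<close> need
  not be minimal and is treated by the same locale.\<close>

locale resolution = cring R for R (structure) +
  fixes M :: "('a, 'm, 'k) module_scheme" and F :: "('a, 'm) free_complex"
  assumes noeth: "noetherian_ring R" and module_M: "module R M" and resolution: "free_resolution R M F"
begin

abbreviation "T i \<equiv> res_term R F i"
abbreviation "im i \<equiv> diff F (Suc i) ` carrier (T (Suc i))"

lemma diff_hom: "diff F (Suc i) \<in> module_hom R (T (Suc i)) (T i)"
  using resolution by (simp add: free_resolution_def)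

lemma im_submodule: "submodule R (im i) (T i)"
  by (rule hom_image_submodule[OF diff_hom free_module_module carrier_submodule[OF free_module_module]])

lemma im_subset: "im i \<subseteq> carrier (T i)"
  using im_submodule by (simp add: submodule_def)

lemma exact: "im (Suc i) = {x \<in> carrier (T (Suc i)). diff F (Suc i) x = \<zero>\<^bsub>T i\<^esub>}"
  using resolution unfolding free_resolution_def a_kernel_eq by blast

definition ann where "ann i = annihilator R (syzygy R F i)"

lemma ann_eq: "ann i = {a \<in> carrier R. \<forall>x\<in>carrier (T i). a \<odot>\<^bsub>T i\<^esub> x \<in> im i}"
  unfolding ann_def syzygy_def by (rule quotient.annihilator_quot[OF quotientI[OF im_submodule]])

lemma ann_ideal: "ideal (ann i) R"
proof (rule comm_idealI)
  interpret T: module R "T i" by (rule free_module_module)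
  interpret I: submodule R "im i" "T i" by (rule im_submodule)
  show "ann i \<subseteq> carrier R" by (auto simp: ann_eq)
  show "\<zero> \<in> ann i" unfolding ann_eq using I.zero_closed by (simp add: T.lmult_0)
  fix a b assume "a \<in> ann i" "b \<in> ann i"
  then show "a \<oplus> b \<in> ann i" unfolding ann_eq using I.m_closed by (simp add: T.smult_l_distr)
next
  interpret T: module R "T i" by (rule free_module_module)
  interpret I: submodule R "im i" "T i" by (rule im_submodule)
  fix a r assume "a \<in> ann i" "r \<in> carrier R"
  then show "r \<otimes> a \<in> ann i" unfolding ann_eq using I.smult_closed by (simp add: T.smult_assoc1)
qed

text \<open>The \<omega>_i of the overview, since the syzygy is \<open>T i\<close> modulo
  \<open>im i\<close>.\<close>

definition syz_length where
  "syz_length P i = local_length R P (T i) (im i) (carrier (T i))"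

lemma syz_length_zero_iff:
  assumes P: "primeideal P R" shows "syz_length P i = 0 \<longleftrightarrow> \<not> ann i \<subseteq> P"
proof -
  interpret T: module_at_prime R "T i" P by (rule module_at_primeI[OF P free_module_module])
  have "syz_length P i = 0 \<longleftrightarrow> T.ple (carrier (T i)) (im i)"
    unfolding syz_length_def by (rule T.len_zero_iff[OF im_submodule carrier_submodule[OF free_module_module] im_subset])
  also have "\<dots> \<longleftrightarrow> \<not> ann i \<subseteq> P"
  proof
    assume "T.ple (carrier (T i)) (im i)"
    then obtain s where s: "s \<in> carrier R - P" "\<forall>x\<in>carrier (T i). s \<odot>\<^bsub>T i\<^esub> x \<in> im i"
      by (rule uniform_local_le[OF P im_submodule])
    then have "s \<in> ann i" "s \<notin> P" by (auto simp: ann_eq)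
    then show "\<not> ann i \<subseteq> P" by blast
  next
    assume "\<not> ann i \<subseteq> P"
    then obtain s where "s \<in> ann i" "s \<notin> P" by blast
    then have "s \<in> carrier R - P" "\<forall>x\<in>carrier (T i). s \<odot>\<^bsub>T i\<^esub> x \<in> im i" by (auto simp: ann_eq)
    then show "T.ple (carrier (T i)) (im i)" unfolding local_le_def by blast
  qed
  finally show ?thesis .
qed

text \<open>By exactness \<open>im i\<close> is \<open>T (Suc i)\<close> modulo
  \<open>im (Suc i)\<close>, that is, the next syzygy.\<close>

lemma syz_length_Suc:
  assumes P: "primeideal P R"
  shows "local_length R P (T i) {\<zero>\<^bsub>T i\<^esub>} (im i) = syz_length P (Suc i)"
proof -
  interpret T: module_at_prime R "T (Suc i)" P by (rule module_at_primeI[OF P free_module_module])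
  show ?thesis unfolding syz_length_def exact
    by (rule T.hom_len_image[OF diff_hom free_module_module carrier_submodule[OF free_module_module]])
qed

lemma syz_length_add:
  assumes P: "primeideal P R"
  shows "syz_length P (Suc i) + syz_length P i = enat (rk F i) * ring_length R P"
proof -
  interpret T: module_at_prime R "T i" P by (rule module_at_primeI[OF P free_module_module])
  have "T.plen {\<zero>\<^bsub>T i\<^esub>} (carrier (T i)) = T.plen {\<zero>\<^bsub>T i\<^esub>} (im i) + T.plen (im i) (carrier (T i))"
  proof (rule T.len_add[OF zero_submodule[OF free_module_module] im_submodule carrier_submodule[OF free_module_module] _ im_subset])
    show "{\<zero>\<^bsub>T i\<^esub>} \<subseteq> im i" using im_submodule[of i] by (simp add: submodule_def)
  qed
  then show ?thesis unfolding free_rank_length[OF P] syz_length_Suc[OF P] by (simp add: syz_length_def)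
qed

lemma syz_length_le:
  assumes P: "primeideal P R" and eq: "rk F (Suc i) = rk F i"
  shows "syz_length P (Suc (Suc i)) \<le> syz_length P i"
proof -
  \<comment> \<open>Terms of equal rank are literally the same module, so the differential is an
    endomorphism. Its cokernel is the i-th syzygy, and its kernel \<open>im (Suc i)\<close> is the
    syzygy two steps further.\<close>
  have "diff F (Suc i) \<in> module_hom R (T i) (T i)" using diff_hom[of i] by (simp only: eq)
  from kernel_length_le[OF noeth is_cring P this] show ?thesis
    using exact[of i] unfolding syz_length_Suc[OF P, symmetric] by (simp add: syz_length_def eq)
qed

lemma syz_length_less:
  assumes P: "primeideal P R" and eq: "rk F (Suc i) = rk F i"
    and "syz_length P i < \<infinity>" "syz_length P i \<noteq> 0" "ring_length R P = \<infinity>"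
  shows "syz_length P (Suc (Suc i)) < syz_length P i"
proof -
  have "diff F (Suc i) \<in> module_hom R (T i) (T i)" using diff_hom[of i] by (simp only: eq)
  from kernel_length_less[OF noeth is_cring P this] show ?thesis
    using exact[of i] assms(3-5) unfolding syz_length_Suc[OF P, symmetric] by (simp add: syz_length_def eq)
qed

lemma syz_length_finite:
  assumes P: "primeideal P R" and min: "\<And>Q. primeideal Q R \<Longrightarrow> ann i \<subseteq> Q \<Longrightarrow> Q \<subseteq> P \<Longrightarrow> Q = P"
  shows "syz_length P i < \<infinity>"
proof -
  interpret T: module_at_prime R "T i" P by (rule module_at_primeI[OF P free_module_module])
  show ?thesis unfolding syz_length_def
  proof (rule T.finite_length[OF noeth noetherian_free_rank[OF noeth is_cring] im_submodule])
    fix Q assume "primeideal Q R" "Q \<subseteq> P" "{a \<in> carrier R. \<forall>x\<in>carrier (T i). a \<odot>\<^bsub>T i\<^esub> x \<in> im i} \<subseteq> Q"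
    then show "Q = P" using min unfolding ann_eq by blast
  qed
qed

section \<open>Syzygies with a minimal prime of the ring in their support\<close>

definition full where "full i \<longleftrightarrow> (\<exists>p. minimal_prime p R \<and> ann i \<subseteq> p)"

lemma not_full_length: "\<not> full i \<Longrightarrow> minimal_prime p R \<Longrightarrow> syz_length p i = 0"
  using syz_length_zero_iff by (auto simp: full_def minimal_prime_def)

lemma full_add_2:
  assumes "full i" and le: "rk F i \<le> rk F (Suc i)" shows "full (Suc (Suc i))"
proof -
  obtain p where p: "minimal_prime p R" "ann i \<subseteq> p" using assms by (auto simp: full_def)
  have pp: "primeideal p R" using p by (simp add: minimal_prime_def)
  obtain l where l: "ring_length R p = enat l" using ring_length_finite[OF noeth is_cring p(1)] by auto
  have 1: "syz_length p (Suc i) + syz_length p i = enat (rk F i * l)"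
    using syz_length_add[OF pp, of i] l by simp
  have 2: "syz_length p (Suc (Suc i)) + syz_length p (Suc i) = enat (rk F (Suc i) * l)"
    using syz_length_add[OF pp, of "Suc i"] l by simp
  have nz: "syz_length p i \<noteq> 0" using syz_length_zero_iff[OF pp] p by blast
  obtain a where a: "syz_length p i = enat a" using 1 by (cases "syz_length p i") auto
  obtain b where b: "syz_length p (Suc i) = enat b" using 1 by (cases "syz_length p (Suc i)") auto
  obtain c where c: "syz_length p (Suc (Suc i)) = enat c" using 2 by (cases "syz_length p (Suc (Suc i))") auto
  have "b + a = rk F i * l" "c + b = rk F (Suc i) * l" "a \<noteq> 0"
    using 1 2 nz unfolding a b c by (auto simp: zero_enat_def)
  moreover have "rk F i * l \<le> rk F (Suc i) * l" using le by simp
  ultimately have "c \<noteq> 0" by linarith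
  then have "syz_length p (Suc (Suc i)) \<noteq> 0" unfolding c by (simp add: zero_enat_def)
  then show ?thesis using syz_length_zero_iff[OF pp] p(1) by (auto simp: full_def)
qed

text \<open>At \<open>p\<close> the two outer lengths vanish, so the middle one equals both
  \<open>rk F i * l\<close> and \<open>rk F (Suc i) * l\<close>, where \<open>l\<close> is finite
  and nonzero.\<close>

lemma rk_eq:
  assumes "\<not> full i" "\<not> full (Suc (Suc i))" and p: "minimal_prime p R"
  shows "rk F (Suc i) = rk F i"
proof -
  have pp: "primeideal p R" using p by (simp add: minimal_prime_def)
  obtain l where l: "ring_length R p = enat l" using ring_length_finite[OF noeth is_cring p] by auto
  have "l \<noteq> 0" using ring_length_pos[OF pp] l by (auto simp: zero_enat_def)
  have "syz_length p (Suc i) = enat (rk F i * l)"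
    using syz_length_add[OF pp, of i] l not_full_length[OF assms(1) p] by simp
  moreover have "syz_length p (Suc i) = enat (rk F (Suc i) * l)"
    using syz_length_add[OF pp, of "Suc i"] l not_full_length[OF assms(2) p] by simp
  ultimately show ?thesis using \<open>l \<noteq> 0\<close> by simp
qed

text \<open>Without a full syzygy in this parity, all ranks are equal in pairs, and an infinite
  descent of lengths arises at a prime that stays in the support for ever. The hypothesis provides a
  prime in the support at every stage.\<close>

lemma exists_full:
  assumes ne: "\<And>j. ann (i + 2 * j) \<noteq> carrier R"
  shows "\<exists>j. full (i + 2 * j)"
proof (rule ccontr)
  assume "\<nexists>j. full (i + 2 * j)"
  then have nf: "\<not> full (i + 2 * j)" for j by blast
  have nf': "\<not> full (Suc (Suc (i + 2 * j)))" for j using nf[of "Suc j"] by simp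
  \<comment> \<open>Only to obtain some minimal prime of the ring, at which \<open>rk_eq\<close>
    compares the ranks.\<close>
  obtain Q0 where Q0: "primeideal Q0 R" "ann i \<subseteq> Q0" by (rule exists_prime_over[OF noeth ann_ideal ne[of 0, simplified]])
  have "\<zero> \<in> Q0" using additive_subgroup.zero_closed[OF ideal.axioms(1)[OF primeideal.axioms(1)[OF Q0(1)]]] .
  then have "Q0 \<in> {Q. primeideal Q R \<and> {\<zero>} \<subseteq> Q}" using Q0 by simp
  then obtain p where p: "primeideal p R" "\<And>Q. primeideal Q R \<Longrightarrow> {\<zero>} \<subseteq> Q \<Longrightarrow> Q \<subseteq> p \<Longrightarrow> Q = p"
    by (rule minimal_prime_over) blast
  have "{\<zero>} \<subseteq> Q" if "primeideal Q R" for Q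
    using additive_subgroup.zero_closed[OF ideal.axioms(1)[OF primeideal.axioms(1)[OF that]]] by simp
  then have mp: "minimal_prime p R" using p by (simp add: minimal_prime_def)
  have eq: "rk F (Suc (i + 2 * j)) = rk F (i + 2 * j)" for j by (rule rk_eq[OF nf nf' mp])
  define g where "g P j = syz_length P (i + 2 * j)" for P j
  have g_le: "g P (Suc j) \<le> g P j" if "primeideal P R" for P j
    using syz_length_le[OF that eq] by (simp add: g_def)
  \<comment> \<open>Lengths do not increase along the parity, so a prime that has left the support
    never returns.\<close>
  have supp: "ann (i + 2 * j) \<subseteq> P" if P: "primeideal P R" and "ann (i + 2 * Suc j) \<subseteq> P" for P j
  proof -
    have "g P (Suc j) \<noteq> 0" using that syz_length_zero_iff[OF P] by (simp only: g_def) blast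
    then have "g P j \<noteq> 0" using g_le[OF P, of j] by auto
    then show ?thesis using syz_length_zero_iff[OF P] by (simp only: g_def) blast
  qed
  \<comment> \<open>The intersection of the primes in the support, i.e. the radical of the
    annihilator. Decreasing supports make it increase, so it stabilises. The factor
    \<open>carrier R\<close> keeps an empty intersection inside the ring.\<close>
  define J where "J j = carrier R \<inter> \<Inter>{Q. primeideal Q R \<and> ann (i + 2 * j) \<subseteq> Q}" for j
  have J_ideal: "ideal (J j) R" for j
  proof (rule comm_idealI)
    have idl: "ideal Q R" if "primeideal Q R" for Q using that by (rule primeideal.axioms(1))
    show "J j \<subseteq> carrier R" by (auto simp: J_def)
    show "\<zero> \<in> J j" using additive_subgroup.zero_closed[OF ideal.axioms(1)[OF idl]] by (auto simp: J_def)
    show "a \<oplus> b \<in> J j" if "a \<in> J j" "b \<in> J j" for a b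
      using that additive_subgroup.a_closed[OF ideal.axioms(1)[OF idl]] by (auto simp: J_def)
    show "r \<otimes> a \<in> J j" if "a \<in> J j" "r \<in> carrier R" for a r
      using that ideal.I_l_closed[OF idl] by (auto simp: J_def)
  qed
  have J_Suc: "J j \<subseteq> J (Suc j)" for j using supp by (auto simp: J_def simp del: mult_Suc_right)
  have J_mono: "J j \<subseteq> J (j + d)" for j d
  proof (induction d)
    case (Suc d) then show ?case using J_Suc[of "j + d"] by simp
  qed simp
  interpret N: noetherian_ring R by (rule noeth)
  have "range J \<noteq> {}" by simp
  moreover have "ideal I R" if "I \<in> range J" for I using that J_ideal by blast
  ultimately obtain I where I: "I \<in> range J" "\<forall>I'\<in>range J. I \<subseteq> I' \<longrightarrow> I' = I"
    by (rule N.ideal_maximal_elem)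
  then obtain k where k: "I = J k" by blast
  have stable: "J (k + d) = J k" for d using I(2) J_mono[of k d] k by simp
  \<comment> \<open>\<open>P\<close> is taken minimal over the annihilator at the stage
    \<open>k\<close> where \<open>J\<close> has become stable, which makes the length at
    \<open>P\<close> finite there.\<close>
  obtain Q where Q: "primeideal Q R" "ann (i + 2 * k) \<subseteq> Q" by (rule exists_prime_over[OF noeth ann_ideal ne])
  then have "Q \<in> {Q. primeideal Q R \<and> ann (i + 2 * k) \<subseteq> Q}" by simp
  then obtain P where P: "primeideal P R" "ann (i + 2 * k) \<subseteq> P"
    and minP: "\<And>Q. primeideal Q R \<Longrightarrow> ann (i + 2 * k) \<subseteq> Q \<Longrightarrow> Q \<subseteq> P \<Longrightarrow> Q = P"
    by (rule minimal_prime_over) blast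
  \<comment> \<open>All later annihilators lie in the stable ideal \<open>J k\<close>, hence in
    \<open>P\<close>, so the later lengths at \<open>P\<close> never vanish.\<close>
  have annP: "ann (i + 2 * (k + d)) \<subseteq> P" for d
  proof -
    have "ann (i + 2 * (k + d)) \<subseteq> J (k + d)" using additive_subgroup.a_subset[OF ideal.axioms(1)[OF ann_ideal]]
      by (auto simp: J_def)
    also have "\<dots> = J k" by (rule stable)
    also have "\<dots> \<subseteq> P" using P by (auto simp: J_def)
    finally show ?thesis .
  qed
  \<comment> \<open>A minimal prime in the support would make the syzygy full. So \<open>P\<close>
    properly contains another prime, and the ring has infinite length at \<open>P\<close>, as the
    strict decrease requires.\<close>
  have "\<not> minimal_prime P R" using nf P(2) by (auto simp: full_def)
  then obtain Q' where "primeideal Q' R" "Q' \<subset> P" using P(1) by (auto simp: minimal_prime_def)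
  then have inf: "ring_length R P = \<infinity>" by (rule ring_length_infinite[OF P(1)])
  have nz: "g P (k + d) \<noteq> 0" for d using syz_length_zero_iff[OF P(1)] annP[of d] by (simp only: g_def) blast
  have fin0: "g P k < \<infinity>" unfolding g_def by (rule syz_length_finite[OF P(1) minP])
  have fin: "g P (k + d) < \<infinity>" for d
  proof (induction d)
    case (Suc d) then show ?case using g_le[OF P(1), of "k + d"] by (simp only: add_Suc_right order_le_less_trans)
  qed (use fin0 in simp)
  have less: "g P (Suc (k + d)) < g P (k + d)" for d
    using syz_length_less[OF P(1) eq, of "k + d"] fin[of d] nz[of d] inf by (simp add: g_def)
  define h where "h d = the_enat (g P (k + d))" for d
  have "h (Suc d) < h d" for d
  proof -
    obtain a b where "g P (k + d) = enat a" "g P (Suc (k + d)) = enat b"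
      using fin[of d] fin[of "Suc d"] by auto
    then show ?thesis using less[of d] by (simp add: h_def)
  qed
  then have "(h (Suc d), h d) \<in> less_than" for d by simp
  then show False using wf_less_than unfolding wf_iff_no_infinite_down_chain by blast
qed

end

text \<open>The annihilator lies between 0 and \<open>p\<close>, and equidimensionality makes the
  dimensions at both ends equal.\<close>

lemma (in resolution) full_dim:
  assumes equi: "equidimensional R" and full: "full i"
  shows "module_krull_dim R (syzygy R F i) = krull_dim R"
proof -
  obtain p where p: "minimal_prime p R" "ann i \<subseteq> p" using full by (auto simp: full_def)
  have idp: "ideal p R" using p primeideal.axioms(1) by (auto simp: minimal_prime_def)
  have "krull_dim (R Quot p) \<le> krull_dim (R Quot ann i)"
    by (rule krull_dim_quot_mono[OF ann_ideal idp p(2)])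
  moreover have "krull_dim (R Quot p) = krull_dim R" using equi p(1) by (simp add: equidimensional_def)
  moreover have "krull_dim (R Quot ann i) \<le> krull_dim R" by (rule krull_dim_quot_le[OF ann_ideal])
  ultimately show ?thesis by (simp add: module_krull_dim_def ann_def)
qed

section \<open>Minimal resolutions and eventual constancy of the dimension\<close>

lemma (in cring) one_not_max_ideal:
  assumes "local_ring R" shows "maximalideal (max_ideal R) R" "\<one> \<notin> max_ideal R"
proof -
  show m: "maximalideal (max_ideal R) R"
    using assms theI'[of "\<lambda>I. maximalideal I R"] by (simp add: local_ring_def max_ideal_def)
  show "\<one> \<notin> max_ideal R"
    using maximalideal.I_notcarr[OF m] ideal.one_imp_carrier[OF maximalideal.axioms(1)[OF m]] by auto
qed

locale minimal_resolution = resolution +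
  assumes local: "local_ring R" and minimal: "minimal_free_resolution R M F"
begin

abbreviation "\<mm> \<equiv> max_ideal R"

lemma max_ideal: "maximalideal \<mm> R" "ideal \<mm> R" "\<one> \<notin> \<mm>"
  using one_not_max_ideal[OF local] maximalideal.axioms(1) by auto

text \<open>Coordinate form of minimality: the matrices of the differentials have all entries in the
  maximal ideal.\<close>

lemma diff_coords:
  assumes y: "y \<in> im i" shows "y \<in> coord_submodule R \<mm> (rk F i)"
proof -
  interpret T: module R "T i" by (rule free_module_module)
  let ?S = "{a \<odot>\<^bsub>T i\<^esub> x | a x. a \<in> \<mm> \<and> x \<in> carrier (T i)}"
  let ?N = "coord_submodule R \<mm> (rk F i)"
  have "?S \<subseteq> ?N"
  proof
    fix z assume "z \<in> ?S"
    then obtain a x where "z = a \<odot>\<^bsub>T i\<^esub> x" "a \<in> \<mm>" "x \<in> carrier (T i)" by blast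
    then show "z \<in> ?N" using smult_coord_submodule[OF max_ideal(2)] by simp
  qed
  then have "T.span ?S \<subseteq> ?N" by (rule T.span_is_subset[OF _ coord_submodule_submodule[OF max_ideal(2)]])
  moreover have "y \<in> T.span ?S" using y minimal unfolding minimal_free_resolution_def by blast
  ultimately show ?thesis by blast
qed

text \<open>If the syzygy vanishes, the differential is onto \<open>T i\<close> while its image has
  coordinates in the maximal ideal, so \<open>T i\<close> is 0. Then all of \<open>T (Suc i)\<close>
  is kernel, and the next syzygy vanishes too. A resolution that is not minimal can fail
  this.\<close>

lemma ann_eq_carrier_Suc:
  assumes "ann i = carrier R" shows "ann (Suc i) = carrier R"
proof -
  interpret T: module R "T i" by (rule free_module_module)
  interpret T': module R "T (Suc i)" by (rule free_module_module)
  have "\<one> \<in> ann i" using assms by simp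
  then have all: "x \<in> im i" if "x \<in> carrier (T i)" for x using that by (auto simp: ann_eq)
  have 0: "rk F i = 0"
  proof (rule ccontr)
    assume "rk F i \<noteq> 0"
    then have e: "free_gen R {..<rk F i} 0 \<in> carrier (T i)" by (intro free_gen_closed) simp
    have "free_gen R {..<rk F i} 0 0 \<in> \<mm>" using diff_coords[OF all[OF e]] \<open>rk F i \<noteq> 0\<close> by (simp add: coord_submodule_def)
    then show False using max_ideal(3) \<open>rk F i \<noteq> 0\<close> by (simp add: free_gen_def)
  qed
  have z: "x = \<zero>\<^bsub>T i\<^esub>" if "x \<in> carrier (T i)" for x
    using that unfolding free_rank_carrier 0 by (auto simp: free_module_simps 0)
  have "im (Suc i) = carrier (T (Suc i))" unfolding exact
    using z im_subset[of i] by auto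
  then show ?thesis by (auto simp: ann_eq)
qed

lemma eventually_constant_dim:
  assumes equi: "equidimensional R" and mono: "\<And>i. i \<ge> N0 \<Longrightarrow> rk F i \<le> rk F (Suc i)"
  shows "\<exists>c N. \<forall>i\<ge>N. module_krull_dim R (syzygy R F i) = c"
proof (cases "\<exists>i. ann i = carrier R")
  case True
  then obtain i where i: "ann i = carrier R" by blast
  have "ann (i + d) = carrier R" for d by (induction d) (simp_all add: i ann_eq_carrier_Suc)
  \<comment> \<open>From here on the syzygies are zero modules, whose common dimension is that of
    the zero ring.\<close>
  then have "\<forall>j\<ge>i. module_krull_dim R (syzygy R F j) = krull_dim (R Quot carrier R)"
    unfolding module_krull_dim_def ann_def[symmetric] by (metis le_add_diff_inverse)
  then show ?thesis by blast
next
  case False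
  have step: "full (i + 2 * d)" if "full i" "i \<ge> N0" for i d
  proof (induction d)
    case (Suc d)
    have "full (Suc (Suc (i + 2 * d)))" by (rule full_add_2[OF Suc.IH mono]) (use that in simp)
    then show ?case by simp
  qed (use that in simp)
  \<comment> \<open>One starting point for each parity: \<open>N0\<close> and
    \<open>Suc N0\<close>.\<close>
  obtain j where j: "full (N0 + 2 * j)" using exists_full[of N0] False by auto
  obtain j' where j': "full (Suc N0 + 2 * j')" using exists_full[of "Suc N0"] False by auto
  \<comment> \<open>The bound exceeds both full indices found, so every \<open>i\<close> beyond it
    is reached from the one of its parity by steps of 2.\<close>
  have "full i" if i: "i \<ge> N0 + 2 * j + 2 * j' + 1" for i
  proof (cases "even (i - N0)")
    case True
    then obtain m where "i - N0 = 2 * m" by (rule evenE)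
    then have "i = (N0 + 2 * j) + 2 * (m - j)" using i by simp
    then show ?thesis using step[OF j] by (metis le_add1)
  next
    case False
    then obtain m where "i - N0 = 2 * m + 1" by (rule oddE)
    then have "i = (Suc N0 + 2 * j') + 2 * (m - j')" using i by simp
    then show ?thesis using step[OF j'] by (metis le_add1 add_Suc le_SucI)
  qed
  then have "\<forall>i\<ge>N0 + 2 * j + 2 * j' + 1. module_krull_dim R (syzygy R F i) = krull_dim R"
    using full_dim[OF equi] by blast
  then show ?thesis by blast
qed

end

section \<open>Maps out of free modules\<close>

text \<open>The linear extension of \<open>h\<close> from the generators. It has the shape of the
  sum inside \<open>tensor_map\<close>, which can therefore be folded into it.\<close>

definition free_ext ::
  "('a, 'r) ring_scheme \<Rightarrow> 'c set \<Rightarrow> ('a, 'b, 'm) module_scheme \<Rightarrow> ('c \<Rightarrow> 'b) \<Rightarrow> ('c \<Rightarrow> 'a) \<Rightarrow> 'b" where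
  "free_ext R S N h g = (\<Oplus>\<^bsub>N\<^esub>s\<in>{s \<in> S. g s \<noteq> \<zero>\<^bsub>R\<^esub>}. g s \<odot>\<^bsub>N\<^esub> h s)"

context cring
begin

lemma free_ext_eq:
  assumes N: "module R N" and h: "h \<in> S \<rightarrow> carrier N" and g: "g \<in> S \<rightarrow> carrier R"
    and T: "finite T" "{s \<in> S. g s \<noteq> \<zero>} \<subseteq> T" "T \<subseteq> S"
  shows "free_ext R S N h g = (\<Oplus>\<^bsub>N\<^esub>s\<in>T. g s \<odot>\<^bsub>N\<^esub> h s)"
proof -
  interpret N: module R N by fact
  show ?thesis unfolding free_ext_def
  proof (rule N.M.add.finprod_mono_neutral_cong_left[OF T(1,2)])
    fix s assume "s \<in> T - {s \<in> S. g s \<noteq> \<zero>}"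
    then have "s \<in> S" "g s = \<zero>" using T by auto
    then show "g s \<odot>\<^bsub>N\<^esub> h s = \<zero>\<^bsub>N\<^esub>" using h by (auto simp: Pi_def N.lmult_0)
  qed (use h g T in \<open>auto intro!: N.smult_closed simp: Pi_def subset_iff\<close>)
qed

lemma free_module_finite: "g \<in> carrier (free_module R S) \<Longrightarrow> finite {s \<in> S. g s \<noteq> \<zero>}"
  by (simp add: free_module_simps)

lemma free_module_fun: "g \<in> carrier (free_module R S) \<Longrightarrow> g \<in> S \<rightarrow> carrier R"
  by (auto simp: free_module_simps)

lemma free_ext_hom:
  assumes N: "module R N" and h: "h \<in> S \<rightarrow> carrier N"
  shows "free_ext R S N h \<in> module_hom R (free_module R S) N"
proof -
  interpret N: module R N by fact
  interpret F: module R "free_module R S" by (rule free_module_module)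
  let ?F = "free_module R S"
  have hc: "h s \<in> carrier N" if "s \<in> S" for s using h that by auto
  have gc: "g s \<in> carrier R" if "g \<in> carrier ?F" "s \<in> S" for g s using free_module_fun[OF that(1)] that(2) by auto
  show ?thesis unfolding module_hom_def
  proof (intro CollectI conjI allI impI)
    show "free_ext R S N h \<in> carrier ?F \<rightarrow> carrier N"
      unfolding free_ext_def using hc gc by (auto intro!: N.M.finsum_closed)
  next
    fix x y assume xy: "x \<in> carrier ?F \<and> y \<in> carrier ?F"
    let ?T = "{s \<in> S. x s \<noteq> \<zero>} \<union> {s \<in> S. y s \<noteq> \<zero>}"
    have T: "finite ?T" "?T \<subseteq> S" using xy free_module_finite by auto
    have s: "{s \<in> S. (x \<oplus>\<^bsub>?F\<^esub> y) s \<noteq> \<zero>} \<subseteq> ?T" by (auto simp: free_module_simps)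
    have "free_ext R S N h (x \<oplus>\<^bsub>?F\<^esub> y) = (\<Oplus>\<^bsub>N\<^esub>s\<in>?T. (x \<oplus>\<^bsub>?F\<^esub> y) s \<odot>\<^bsub>N\<^esub> h s)"
      using xy by (intro free_ext_eq[OF N h _ T(1) s T(2)] free_module_fun F.M.a_closed) auto
    also have "\<dots> = (\<Oplus>\<^bsub>N\<^esub>s\<in>?T. x s \<odot>\<^bsub>N\<^esub> h s \<oplus>\<^bsub>N\<^esub> y s \<odot>\<^bsub>N\<^esub> h s)"
    proof (rule N.M.add.finprod_cong')
      fix s assume "s \<in> ?T"
      then have s: "s \<in> S" by auto
      then have "x s \<in> carrier R" "y s \<in> carrier R" "h s \<in> carrier N" using xy gc hc by auto
      then show "(x \<oplus>\<^bsub>?F\<^esub> y) s \<odot>\<^bsub>N\<^esub> h s = x s \<odot>\<^bsub>N\<^esub> h s \<oplus>\<^bsub>N\<^esub> y s \<odot>\<^bsub>N\<^esub> h s"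
        using s by (simp add: free_module_simps N.smult_l_distr)
    qed (use xy gc hc in auto)
    also have "\<dots> = (\<Oplus>\<^bsub>N\<^esub>s\<in>?T. x s \<odot>\<^bsub>N\<^esub> h s) \<oplus>\<^bsub>N\<^esub> (\<Oplus>\<^bsub>N\<^esub>s\<in>?T. y s \<odot>\<^bsub>N\<^esub> h s)"
      using xy gc hc by (intro N.M.finsum_addf) auto
    also have "(\<Oplus>\<^bsub>N\<^esub>s\<in>?T. x s \<odot>\<^bsub>N\<^esub> h s) = free_ext R S N h x"
      using xy by (intro free_ext_eq[OF N h _ T(1) _ T(2), symmetric] free_module_fun) auto
    also have "(\<Oplus>\<^bsub>N\<^esub>s\<in>?T. y s \<odot>\<^bsub>N\<^esub> h s) = free_ext R S N h y"
      using xy by (intro free_ext_eq[OF N h _ T(1) _ T(2), symmetric] free_module_fun) auto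
    finally show "free_ext R S N h (x \<oplus>\<^bsub>?F\<^esub> y) = free_ext R S N h x \<oplus>\<^bsub>N\<^esub> free_ext R S N h y" .
  next
    fix r x assume rx: "r \<in> carrier R \<and> x \<in> carrier ?F"
    let ?T = "{s \<in> S. x s \<noteq> \<zero>}"
    have T: "finite ?T" "?T \<subseteq> S" using rx free_module_finite by auto
    have s: "{s \<in> S. (r \<odot>\<^bsub>?F\<^esub> x) s \<noteq> \<zero>} \<subseteq> ?T" using rx by (auto simp: free_module_simps)
    have "free_ext R S N h (r \<odot>\<^bsub>?F\<^esub> x) = (\<Oplus>\<^bsub>N\<^esub>s\<in>?T. (r \<odot>\<^bsub>?F\<^esub> x) s \<odot>\<^bsub>N\<^esub> h s)"
      using rx by (intro free_ext_eq[OF N h _ T(1) s T(2)] free_module_fun F.smult_closed) auto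
    also have "\<dots> = (\<Oplus>\<^bsub>N\<^esub>s\<in>?T. r \<odot>\<^bsub>N\<^esub> (x s \<odot>\<^bsub>N\<^esub> h s))"
    proof (rule N.M.add.finprod_cong')
      fix s assume "s \<in> ?T"
      then have s: "s \<in> S" by auto
      then have "x s \<in> carrier R" "h s \<in> carrier N" using rx gc hc by auto
      then show "(r \<odot>\<^bsub>?F\<^esub> x) s \<odot>\<^bsub>N\<^esub> h s = r \<odot>\<^bsub>N\<^esub> (x s \<odot>\<^bsub>N\<^esub> h s)"
        using s rx by (simp add: free_module_simps N.smult_assoc1)
    qed (use rx gc hc in auto)
    also have "\<dots> = r \<odot>\<^bsub>N\<^esub> (\<Oplus>\<^bsub>N\<^esub>s\<in>?T. x s \<odot>\<^bsub>N\<^esub> h s)"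
      using rx gc hc T by (intro N.finsum_smult_ldistr[symmetric]) auto
    finally show "free_ext R S N h (r \<odot>\<^bsub>?F\<^esub> x) = r \<odot>\<^bsub>N\<^esub> free_ext R S N h x"
      by (simp only: free_ext_def)
  qed
qed

lemma free_ext_gen:
  assumes N: "module R N" and h: "h \<in> S \<rightarrow> carrier N" and s: "s \<in> S"
  shows "free_ext R S N h (free_gen R S s) = h s"
proof -
  interpret N: module R N by fact
  have hs: "h s \<in> carrier N" using h s by auto
  have "free_ext R S N h (free_gen R S s) = (\<Oplus>\<^bsub>N\<^esub>t\<in>{s}. free_gen R S s t \<odot>\<^bsub>N\<^esub> h t)"
    using s by (intro free_ext_eq[OF N h]) (auto simp: free_gen_def)
  also have "\<dots> = h s" using hs s by (simp add: free_gen_def)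
  finally show ?thesis .
qed

lemma hom_eq_on_free:
  assumes N: "module R N" and f: "f \<in> module_hom R (free_module R S) N" and g: "g \<in> module_hom R (free_module R S) N"
    and eq: "\<And>s. s \<in> S \<Longrightarrow> f (free_gen R S s) = g (free_gen R S s)" and x: "x \<in> carrier (free_module R S)"
  shows "f x = g x"
proof -
  let ?F = "free_module R S"
  interpret f: mod_hom R ?F N f using N f free_module_module by (simp add: mod_hom_def mod_hom_axioms_def)
  interpret g: mod_hom R ?F N g using N g free_module_module by (simp add: mod_hom_def mod_hom_axioms_def)
  let ?C = "{x \<in> carrier ?F. f x = g x}"
  have C: "submodule R ?C ?F" unfolding submodule_def using free_module_module f.f0_is_0 g.f0_is_0 by auto
  have "x \<in> ?C"
  proof (rule free_module_memI[OF C x])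
    fix s assume s: "s \<in> S"
    have "x s \<in> carrier R" using free_module_fun[OF x] s by auto
    then show "x s \<odot>\<^bsub>?F\<^esub> free_gen R S s \<in> ?C" using eq[OF s] free_gen_closed[OF s] by simp
  qed
  then show ?thesis by simp
qed

lemma hom_comp:
  "f \<in> module_hom R A B \<Longrightarrow> g \<in> module_hom R B C \<Longrightarrow> (\<lambda>x. g (f x)) \<in> module_hom R A C"
  by (auto simp: module_hom_def Pi_def)

lemma hom_diff:
  assumes f: "f \<in> module_hom R A B" and g: "g \<in> module_hom R A B" and A: "module R A" and B: "module R B"
  shows "(\<lambda>x. f x \<ominus>\<^bsub>B\<^esub> g x) \<in> module_hom R A B"
proof -
  interpret B: module R B by fact
  interpret f: mod_hom R A B f using A B f by (simp add: mod_hom_def mod_hom_axioms_def)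
  interpret g: mod_hom R A B g using A B g by (simp add: mod_hom_def mod_hom_axioms_def)
  show ?thesis unfolding module_hom_def
  proof (intro CollectI conjI allI impI)
    show "(\<lambda>x. f x \<ominus>\<^bsub>B\<^esub> g x) \<in> carrier A \<rightarrow> carrier B" by auto
    fix x y assume "x \<in> carrier A \<and> y \<in> carrier A"
    then show "f (x \<oplus>\<^bsub>A\<^esub> y) \<ominus>\<^bsub>B\<^esub> g (x \<oplus>\<^bsub>A\<^esub> y) = f x \<ominus>\<^bsub>B\<^esub> g x \<oplus>\<^bsub>B\<^esub> (f y \<ominus>\<^bsub>B\<^esub> g y)"
      by (simp add: a_minus_def B.M.minus_add B.M.a_ac)
  next
    fix r x assume "r \<in> carrier R \<and> x \<in> carrier A"
    then show "f (r \<odot>\<^bsub>A\<^esub> x) \<ominus>\<^bsub>B\<^esub> g (r \<odot>\<^bsub>A\<^esub> x) = r \<odot>\<^bsub>B\<^esub> (f x \<ominus>\<^bsub>B\<^esub> g x)"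
      by (simp add: a_minus_def B.smult_r_distr B.smult_r_minus)
  qed
qed

text \<open>Projectivity of free modules: choose preimages of the values on the generators and
  extend linearly. Both comparison arguments for resolutions rest on it.\<close>

lemma free_lift:
  assumes N: "module R N" and Y: "module R Y" and f: "f \<in> module_hom R (free_module R S) N"
    and g: "g \<in> module_hom R Y N" and im: "\<And>x. x \<in> carrier (free_module R S) \<Longrightarrow> f x \<in> g ` carrier Y"
  obtains h where "h \<in> module_hom R (free_module R S) Y" "\<forall>x\<in>carrier (free_module R S). g (h x) = f x"
proof -
  have "\<forall>s\<in>S. \<exists>y. y \<in> carrier Y \<and> g y = f (free_gen R S s)"
  proof
    fix s assume "s \<in> S"
    from im[OF free_gen_closed[OF this]] show "\<exists>y. y \<in> carrier Y \<and> g y = f (free_gen R S s)" by force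
  qed
  from bchoice[OF this] obtain y where y: "\<forall>s\<in>S. y s \<in> carrier Y \<and> g (y s) = f (free_gen R S s)" by blast
  then have yS: "y \<in> S \<rightarrow> carrier Y" by auto
  let ?h = "free_ext R S Y y"
  have h: "?h \<in> module_hom R (free_module R S) Y" by (rule free_ext_hom[OF Y yS])
  have "g (?h x) = f x" if "x \<in> carrier (free_module R S)" for x
  proof (rule hom_eq_on_free[OF N hom_comp[OF h g] f _ that])
    fix s assume "s \<in> S"
    then show "g (?h (free_gen R S s)) = f (free_gen R S s)" using free_ext_gen[OF Y yS] y by simp
  qed
  then show ?thesis using that h by blast
qed

end

section \<open>Comparison of resolutions\<close>

context resolution
begin

lemma aug_hom: "aug F \<in> module_hom R (T 0) M"
  and aug_surj: "aug F ` carrier (T 0) = carrier M"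
  and im_0: "im 0 = {x \<in> carrier (T 0). aug F x = \<zero>\<^bsub>M\<^esub>}"
  using resolution unfolding free_resolution_def a_kernel_eq by simp_all

lemma diff_in_im: "x \<in> carrier (T (Suc i)) \<Longrightarrow> diff F (Suc i) x \<in> im i"
  by simp

lemma diff_closed: "x \<in> carrier (T (Suc i)) \<Longrightarrow> diff F (Suc i) x \<in> carrier (T i)"
  using im_subset[of i] diff_in_im[of x i] by blast

lemma diff_im: "y \<in> im (Suc i) \<Longrightarrow> diff F (Suc i) y = \<zero>\<^bsub>T i\<^esub>"
  unfolding exact by simp

end

locale two_resolutions = F: resolution R M F + G: resolution R M G
  for R (structure) and M :: "('a, 'm, 'k) module_scheme" and F and G
begin

text \<open>Compatibility with the augmentations is kept apart, so that the notion also covers the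
  difference of a composite and the identity, which lifts the zero map of \<open>M\<close>.\<close>

definition chain_map where
  "chain_map \<phi> \<longleftrightarrow> (\<forall>i. \<phi> i \<in> module_hom R (F.T i) (G.T i)) \<and>
     (\<forall>i. \<forall>x\<in>carrier (F.T (Suc i)). diff G (Suc i) (\<phi> (Suc i) x) = \<phi> i (diff F (Suc i) x))"

lemma exists_chain_map:
  "\<exists>\<phi>. chain_map \<phi> \<and> (\<forall>x\<in>carrier (F.T 0). aug G (\<phi> 0 x) = aug F x)"
proof -
  \<comment> \<open>The induction must carry that \<open>\<phi>\<close> respects the images of the
    differentials: this is exactly what makes the lifting problem in the next degree
    solvable.\<close>
  define P where "P i \<phi> \<longleftrightarrow> \<phi> \<in> module_hom R (F.T i) (G.T i) \<and> (\<forall>y\<in>F.im i. \<phi> y \<in> G.im i) \<and>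
    (i = 0 \<longrightarrow> (\<forall>x\<in>carrier (F.T 0). aug G (\<phi> x) = aug F x))" for i \<phi>
  define Q where "Q i \<phi> \<psi> \<longleftrightarrow> (\<forall>x\<in>carrier (F.T (Suc i)). diff G (Suc i) (\<psi> x) = \<phi> (diff F (Suc i) x))" for i \<phi> \<psi>
  have "\<exists>f. \<forall>i. P i (f i) \<and> Q i (f i) (f (Suc i))"
  proof (rule dependent_nat_choice)
    obtain \<phi> where \<phi>: "\<phi> \<in> module_hom R (F.T 0) (G.T 0)" "\<forall>x\<in>carrier (F.T 0). aug G (\<phi> x) = aug F x"
    proof (rule F.free_lift[OF F.module_M F.free_module_module F.aug_hom G.aug_hom])
      show "aug F x \<in> aug G ` carrier (G.T 0)" if "x \<in> carrier (F.T 0)" for x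
        unfolding G.aug_surj using module_hom_mem[OF F.aug_hom that] .
    qed
    have "\<phi> y \<in> G.im 0" if "y \<in> F.im 0" for y
      using that \<phi> module_hom_mem[OF \<phi>(1)] unfolding F.im_0 G.im_0 by auto
    then have "P 0 \<phi>" using \<phi> by (simp add: P_def)
    then show "\<exists>\<phi>. P 0 \<phi>" by (intro exI[of _ \<phi>])
  next
    fix \<phi> i assume "P i \<phi>"
    then have \<phi>: "\<phi> \<in> module_hom R (F.T i) (G.T i)" "\<forall>y\<in>F.im i. \<phi> y \<in> G.im i" by (auto simp: P_def)
    obtain \<psi> where \<psi>: "\<psi> \<in> module_hom R (F.T (Suc i)) (G.T (Suc i))"
        "\<forall>x\<in>carrier (F.T (Suc i)). diff G (Suc i) (\<psi> x) = \<phi> (diff F (Suc i) x)"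
    proof (rule F.free_lift[OF F.free_module_module F.free_module_module F.hom_comp[OF F.diff_hom \<phi>(1)] G.diff_hom])
      show "\<phi> (diff F (Suc i) x) \<in> G.im i" if "x \<in> carrier (F.T (Suc i))" for x
        using \<phi>(2) F.diff_in_im[OF that] by blast
    qed
    have "\<psi> y \<in> G.im (Suc i)" if y: "y \<in> F.im (Suc i)" for y
    proof -
      have yc: "y \<in> carrier (F.T (Suc i))" using y F.im_subset by blast
      have "diff G (Suc i) (\<psi> y) = \<phi> \<zero>\<^bsub>F.T i\<^esub>" using \<psi>(2) yc F.diff_im[OF y] by simp
      also have "\<dots> = \<zero>\<^bsub>G.T i\<^esub>" by (rule module_hom_zero[OF \<phi>(1) F.free_module_module F.free_module_module])
      finally show ?thesis unfolding G.exact using module_hom_mem[OF \<psi>(1) yc] by simp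
    qed
    then have "P (Suc i) \<psi> \<and> Q i \<phi> \<psi>" using \<psi> by (simp add: P_def Q_def)
    then show "\<exists>\<psi>. P (Suc i) \<psi> \<and> Q i \<phi> \<psi>" by (intro exI[of _ \<psi>])
  qed
  then obtain f where f: "\<forall>i. P i (f i) \<and> Q i (f i) (f (Suc i))" ..
  then show ?thesis unfolding P_def Q_def chain_map_def by (intro exI[of _ f]) simp
qed

lemma exists_homotopy:
  assumes \<alpha>: "chain_map \<alpha>" and aug0: "\<And>x. x \<in> carrier (F.T 0) \<Longrightarrow> aug G (\<alpha> 0 x) = \<zero>\<^bsub>M\<^esub>"
  shows "\<exists>h. (\<forall>i. h i \<in> module_hom R (F.T i) (G.T (Suc i))) \<and>
    (\<forall>x\<in>carrier (F.T 0). \<alpha> 0 x = diff G 1 (h 0 x)) \<and>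
    (\<forall>i. \<forall>x\<in>carrier (F.T (Suc i)). \<alpha> (Suc i) x =
       diff G (Suc (Suc i)) (h (Suc i) x) \<oplus>\<^bsub>G.T (Suc i)\<^esub> h i (diff F (Suc i) x))"
proof -
  have \<alpha>_hom: "\<alpha> i \<in> module_hom R (F.T i) (G.T i)" for i using \<alpha> by (simp add: chain_map_def)
  \<comment> \<open>The identity \<alpha> = d h on \<open>F.im i\<close>, where the second term of
    the homotopy vanishes, is what makes the next \<alpha> - h d a cycle and hence a
    boundary.\<close>
  define P where "P i h \<longleftrightarrow> h \<in> module_hom R (F.T i) (G.T (Suc i)) \<and> (\<forall>y\<in>F.im i. \<alpha> i y = diff G (Suc i) (h y)) \<and>
    (i = 0 \<longrightarrow> (\<forall>x\<in>carrier (F.T 0). \<alpha> 0 x = diff G 1 (h x)))" for i h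
  define Q where "Q i h h' \<longleftrightarrow> (\<forall>x\<in>carrier (F.T (Suc i)). \<alpha> (Suc i) x =
       diff G (Suc (Suc i)) (h' x) \<oplus>\<^bsub>G.T (Suc i)\<^esub> h (diff F (Suc i) x))" for i h h'
  have "\<exists>f. \<forall>i. P i (f i) \<and> Q i (f i) (f (Suc i))"
  proof (rule dependent_nat_choice)
    obtain h where h: "h \<in> module_hom R (F.T 0) (G.T (Suc 0))" "\<forall>x\<in>carrier (F.T 0). diff G (Suc 0) (h x) = \<alpha> 0 x"
    proof (rule F.free_lift[OF F.free_module_module F.free_module_module \<alpha>_hom G.diff_hom])
      show "\<alpha> 0 x \<in> G.im 0" if "x \<in> carrier (F.T 0)" for x
        unfolding G.im_0 using aug0[OF that] module_hom_mem[OF \<alpha>_hom that] by simp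
    qed
    have "y \<in> carrier (F.T 0)" if "y \<in> F.im 0" for y using that F.im_subset[of 0] by blast
    then have "P 0 h" using h by (simp add: P_def)
    then show "\<exists>h. P 0 h" by (intro exI[of _ h])
  next
    fix h i assume "P i h"
    then have h: "h \<in> module_hom R (F.T i) (G.T (Suc i))" "\<forall>y\<in>F.im i. \<alpha> i y = diff G (Suc i) (h y)"
      by (auto simp: P_def)
    interpret GT: module R "G.T (Suc i)" by (rule F.free_module_module)
    interpret d: mod_hom R "G.T (Suc i)" "G.T i" "diff G (Suc i)"
      using G.diff_hom by (simp add: mod_hom_def mod_hom_axioms_def F.free_module_module)
    have hd: "(\<lambda>x. h (diff F (Suc i) x)) \<in> module_hom R (F.T (Suc i)) (G.T (Suc i))"
      by (rule F.hom_comp[OF F.diff_hom h(1)])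
    let ?f = "\<lambda>x. \<alpha> (Suc i) x \<ominus>\<^bsub>G.T (Suc i)\<^esub> h (diff F (Suc i) x)"
    have f: "?f \<in> module_hom R (F.T (Suc i)) (G.T (Suc i))"
      by (rule F.hom_diff[OF \<alpha>_hom hd F.free_module_module F.free_module_module])
    obtain h' where h': "h' \<in> module_hom R (F.T (Suc i)) (G.T (Suc (Suc i)))"
        "\<forall>x\<in>carrier (F.T (Suc i)). diff G (Suc (Suc i)) (h' x) = ?f x"
    proof (rule F.free_lift[OF F.free_module_module F.free_module_module f G.diff_hom])
      fix x assume x: "x \<in> carrier (F.T (Suc i))"
      have c: "\<alpha> (Suc i) x \<in> carrier (G.T (Suc i))" "h (diff F (Suc i) x) \<in> carrier (G.T (Suc i))"
        using module_hom_mem[OF \<alpha>_hom x] module_hom_mem[OF hd x] by auto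
      have "diff G (Suc i) (?f x) = diff G (Suc i) (\<alpha> (Suc i) x) \<ominus>\<^bsub>G.T i\<^esub> diff G (Suc i) (h (diff F (Suc i) x))"
        using c by simp
      also have "diff G (Suc i) (\<alpha> (Suc i) x) = \<alpha> i (diff F (Suc i) x)" using \<alpha> x by (simp add: chain_map_def)
      also have "\<alpha> i (diff F (Suc i) x) = diff G (Suc i) (h (diff F (Suc i) x))"
        using h(2) F.diff_in_im[OF x] by blast
      finally have "diff G (Suc i) (?f x) = \<zero>\<^bsub>G.T i\<^esub>" using G.diff_closed[OF c(2)] by simp
      then show "?f x \<in> G.im (Suc i)" unfolding G.exact using c by simp
    qed
    have eq: "\<alpha> (Suc i) x = diff G (Suc (Suc i)) (h' x) \<oplus>\<^bsub>G.T (Suc i)\<^esub> h (diff F (Suc i) x)"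
      if x: "x \<in> carrier (F.T (Suc i))" for x
    proof -
      have c: "\<alpha> (Suc i) x \<in> carrier (G.T (Suc i))" "h (diff F (Suc i) x) \<in> carrier (G.T (Suc i))"
        using module_hom_mem[OF \<alpha>_hom x] module_hom_mem[OF hd x] by auto
      show ?thesis using h'(2) x c by (simp add: a_minus_def GT.M.a_assoc GT.M.l_neg)
    qed
    have "\<alpha> (Suc i) y = diff G (Suc (Suc i)) (h' y)" if y: "y \<in> F.im (Suc i)" for y
    proof -
      have yc: "y \<in> carrier (F.T (Suc i))" using y F.im_subset by blast
      have "h (diff F (Suc i) y) = \<zero>\<^bsub>G.T (Suc i)\<^esub>"
        unfolding F.diff_im[OF y] by (rule module_hom_zero[OF h(1) F.free_module_module F.free_module_module])
      then show ?thesis using eq[OF yc] G.diff_closed[OF module_hom_mem[OF h'(1) yc]] by simp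
    qed
    then have "P (Suc i) h' \<and> Q i h h'" using h' eq by (simp add: P_def Q_def)
    then show "\<exists>h'. P (Suc i) h' \<and> Q i h h'" by (intro exI[of _ h'])
  qed
  then obtain f where f: "\<forall>i. P i (f i) \<and> Q i (f i) (f (Suc i))" ..
  then show ?thesis unfolding P_def Q_def by (intro exI[of _ f]) simp
qed

end

section \<open>Tensor products\<close>

lemma (in cring) mod_homI:
  "module R A \<Longrightarrow> module R B \<Longrightarrow> f \<in> module_hom R A B \<Longrightarrow> mod_hom R A B f"
  by (simp add: mod_hom_def mod_hom_axioms_def)

locale tensor = cring R for R :: "('a, 'r) ring_scheme" (structure) +
  fixes A :: "('a, 'b, 'm) module_scheme" and B :: "('a, 'c, 'n) module_scheme"
  assumes A: "module R A" and B: "module R B"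
begin

sublocale A: module R A by (rule A)
sublocale B: module R B by (rule B)

abbreviation "PM \<equiv> pair_module R A B"
abbreviation "TR \<equiv> tensor_relations R A B"
abbreviation "TP \<equiv> tensor_product R A B"

lemma PM: "module R PM" by (rule free_module_module)

sublocale PM: module R PM by (rule PM)

lemma gen_closed: "a \<in> carrier A \<Longrightarrow> b \<in> carrier B \<Longrightarrow> pair_gen R A B a b \<in> carrier PM"
  by (rule free_gen_closed) simp

lemma relators_closed: "bilinear_relators R A B \<subseteq> carrier PM"
proof
  fix z assume "z \<in> bilinear_relators R A B"
  then show "z \<in> carrier PM"
    by cases (auto intro!: PM.M.minus_closed PM.M.a_closed PM.smult_closed gen_closed)
qed

lemma TR_submodule: "submodule R TR PM"
  unfolding tensor_relations_def by (rule PM.span_is_submodule[OF relators_closed])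

lemma relator_in: "z \<in> bilinear_relators R A B \<Longrightarrow> z \<in> TR"
  unfolding tensor_relations_def using PM.in_own_span[OF relators_closed] by blast

sublocale Q: quotient R PM TR by (rule quotientI[OF TR_submodule])

lemma TP: "module R TP"
  unfolding tensor_product_def by (rule Q.quot_module_module)

definition cl where "cl a b = TR +>\<^bsub>PM\<^esub> pair_gen R A B a b"

lemma cl_closed: "a \<in> carrier A \<Longrightarrow> b \<in> carrier B \<Longrightarrow> cl a b \<in> carrier TP"
  unfolding cl_def tensor_product_def by (intro Q.coset_closed gen_closed)

lemma cl_add_left:
  assumes "a \<in> carrier A" "a' \<in> carrier A" "b \<in> carrier B"
  shows "cl (a \<oplus>\<^bsub>A\<^esub> a') b = cl a b \<oplus>\<^bsub>TP\<^esub> cl a' b"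
proof -
  have "cl (a \<oplus>\<^bsub>A\<^esub> a') b = TR +>\<^bsub>PM\<^esub> (pair_gen R A B a b \<oplus>\<^bsub>PM\<^esub> pair_gen R A B a' b)"
    unfolding cl_def using assms
    by (subst Q.coset_eq_iff) (auto intro!: PM.M.a_closed gen_closed relator_in bilinear_relators.add_left)
  then show ?thesis unfolding tensor_product_def cl_def using assms by (simp add: Q.quot_add gen_closed)
qed

lemma cl_add_right:
  assumes "a \<in> carrier A" "b \<in> carrier B" "b' \<in> carrier B"
  shows "cl a (b \<oplus>\<^bsub>B\<^esub> b') = cl a b \<oplus>\<^bsub>TP\<^esub> cl a b'"
proof -
  have "cl a (b \<oplus>\<^bsub>B\<^esub> b') = TR +>\<^bsub>PM\<^esub> (pair_gen R A B a b \<oplus>\<^bsub>PM\<^esub> pair_gen R A B a b')"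
    unfolding cl_def using assms
    by (subst Q.coset_eq_iff) (auto intro!: PM.M.a_closed gen_closed relator_in bilinear_relators.add_right)
  then show ?thesis unfolding tensor_product_def cl_def using assms by (simp add: Q.quot_add gen_closed)
qed

lemma cl_smult_left:
  assumes "r \<in> carrier R" "a \<in> carrier A" "b \<in> carrier B"
  shows "cl (r \<odot>\<^bsub>A\<^esub> a) b = r \<odot>\<^bsub>TP\<^esub> cl a b"
proof -
  have "cl (r \<odot>\<^bsub>A\<^esub> a) b = TR +>\<^bsub>PM\<^esub> (r \<odot>\<^bsub>PM\<^esub> pair_gen R A B a b)"
    unfolding cl_def using assms
    by (subst Q.coset_eq_iff) (auto intro!: PM.smult_closed gen_closed relator_in bilinear_relators.smult_left)
  then show ?thesis unfolding tensor_product_def cl_def using assms by (simp add: Q.quot_smult gen_closed)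
qed

lemma cl_smult_right:
  assumes "r \<in> carrier R" "a \<in> carrier A" "b \<in> carrier B"
  shows "cl a (r \<odot>\<^bsub>B\<^esub> b) = r \<odot>\<^bsub>TP\<^esub> cl a b"
proof -
  have "cl a (r \<odot>\<^bsub>B\<^esub> b) = TR +>\<^bsub>PM\<^esub> (r \<odot>\<^bsub>PM\<^esub> pair_gen R A B a b)"
    unfolding cl_def using assms
    by (subst Q.coset_eq_iff) (auto intro!: PM.smult_closed gen_closed relator_in bilinear_relators.smult_right)
  then show ?thesis unfolding tensor_product_def cl_def using assms by (simp add: Q.quot_smult gen_closed)
qed

definition bilinear_map where
  "bilinear_map N h \<longleftrightarrow>
     (\<forall>a\<in>carrier A. \<forall>b\<in>carrier B. h (a, b) \<in> carrier N) \<and>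
     (\<forall>a\<in>carrier A. \<forall>a'\<in>carrier A. \<forall>b\<in>carrier B. h (a \<oplus>\<^bsub>A\<^esub> a', b) = h (a, b) \<oplus>\<^bsub>N\<^esub> h (a', b)) \<and>
     (\<forall>a\<in>carrier A. \<forall>b\<in>carrier B. \<forall>b'\<in>carrier B. h (a, b \<oplus>\<^bsub>B\<^esub> b') = h (a, b) \<oplus>\<^bsub>N\<^esub> h (a, b')) \<and>
     (\<forall>r\<in>carrier R. \<forall>a\<in>carrier A. \<forall>b\<in>carrier B. h (r \<odot>\<^bsub>A\<^esub> a, b) = r \<odot>\<^bsub>N\<^esub> h (a, b)) \<and>
     (\<forall>r\<in>carrier R. \<forall>a\<in>carrier A. \<forall>b\<in>carrier B. h (a, r \<odot>\<^bsub>B\<^esub> b) = r \<odot>\<^bsub>N\<^esub> h (a, b))"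

abbreviation "ext N h \<equiv> free_ext R (carrier A \<times> carrier B) N h"

lemma bilinear_fun: "bilinear_map N h \<Longrightarrow> h \<in> carrier A \<times> carrier B \<rightarrow> carrier N"
  by (auto simp: bilinear_map_def)

text \<open>The universal property of the tensor product: bilinear maps kill the relators and hence
  their span. It is the means of showing that a class in a tensor product is not zero.\<close>

lemma ext_relations:
  assumes N: "module R N" and h: "bilinear_map N h" and z: "z \<in> TR"
  shows "ext N h z = \<zero>\<^bsub>N\<^esub>"
proof -
  interpret N: module R N by fact
  have hom: "ext N h \<in> module_hom R PM N" by (rule free_ext_hom[OF N bilinear_fun[OF h]])
  interpret f: mod_hom R PM N "ext N h" by (rule mod_homI[OF PM N hom])
  have gen: "ext N h (pair_gen R A B a b) = h (a, b)" if "a \<in> carrier A" "b \<in> carrier B" for a b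
    using free_ext_gen[OF N bilinear_fun[OF h], of "(a, b)"] that by simp
  have hc: "h (a, b) \<in> carrier N" if "a \<in> carrier A" "b \<in> carrier B" for a b
    using h that by (simp add: bilinear_map_def)
  have "bilinear_relators R A B \<subseteq> {x \<in> carrier PM. ext N h x = \<zero>\<^bsub>N\<^esub>}"
  proof
    fix x assume x: "x \<in> bilinear_relators R A B"
    then have "ext N h x = \<zero>\<^bsub>N\<^esub>"
    proof cases
      case (add_left a a' b)
      then have "ext N h x = h (a \<oplus>\<^bsub>A\<^esub> a', b) \<ominus>\<^bsub>N\<^esub> (h (a, b) \<oplus>\<^bsub>N\<^esub> h (a', b))"
        by (simp add: gen gen_closed)
      also have "\<dots> = \<zero>\<^bsub>N\<^esub>" using add_left h hc by (simp add: bilinear_map_def)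
      finally show ?thesis .
    next
      case (add_right a b b')
      then have "ext N h x = h (a, b \<oplus>\<^bsub>B\<^esub> b') \<ominus>\<^bsub>N\<^esub> (h (a, b) \<oplus>\<^bsub>N\<^esub> h (a, b'))"
        by (simp add: gen gen_closed)
      also have "\<dots> = \<zero>\<^bsub>N\<^esub>" using add_right h hc by (simp add: bilinear_map_def)
      finally show ?thesis .
    next
      case (smult_left r a b)
      then have "ext N h x = h (r \<odot>\<^bsub>A\<^esub> a, b) \<ominus>\<^bsub>N\<^esub> r \<odot>\<^bsub>N\<^esub> h (a, b)"
        by (simp add: gen gen_closed)
      also have "\<dots> = \<zero>\<^bsub>N\<^esub>" using smult_left h hc by (simp add: bilinear_map_def)
      finally show ?thesis .
    next
      case (smult_right r a b)
      then have "ext N h x = h (a, r \<odot>\<^bsub>B\<^esub> b) \<ominus>\<^bsub>N\<^esub> r \<odot>\<^bsub>N\<^esub> h (a, b)"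
        by (simp add: gen gen_closed)
      also have "\<dots> = \<zero>\<^bsub>N\<^esub>" using smult_right h hc by (simp add: bilinear_map_def)
      finally show ?thesis .
    qed
    then show "x \<in> {x \<in> carrier PM. ext N h x = \<zero>\<^bsub>N\<^esub>}" using relators_closed x by blast
  qed
  moreover have "submodule R {x \<in> carrier PM. ext N h x = \<zero>\<^bsub>N\<^esub>} PM"
    using f.ker_is_submodule by (simp only: f.ker_def)
  ultimately have "TR \<subseteq> {x \<in> carrier PM. ext N h x = \<zero>\<^bsub>N\<^esub>}"
    unfolding tensor_relations_def by (rule PM.span_is_subset)
  then show ?thesis using z by blast
qed

lemma ext_coset:
  assumes N: "module R N" and h: "bilinear_map N h" and g: "g \<in> carrier PM" and g': "g' \<in> TR +>\<^bsub>PM\<^esub> g"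
  shows "ext N h g' = ext N h g"
proof -
  interpret N: module R N by fact
  interpret f: mod_hom R PM N "ext N h" by (rule mod_homI[OF PM N free_ext_hom[OF N bilinear_fun[OF h]]])
  have g'c: "g' \<in> carrier PM" by (rule Q.N.a_elemrcos_carrier[OF g g'])
  have "g' \<ominus>\<^bsub>PM\<^esub> g \<in> TR" using Q.N.a_rcos_module_imp[OF g g'] by (simp add: a_minus_def)
  then have "ext N h (g' \<ominus>\<^bsub>PM\<^esub> g) = \<zero>\<^bsub>N\<^esub>" by (rule ext_relations[OF N h])
  then show ?thesis using g g'c by simp
qed

end

lemma (in cring) tensorI: "module R A \<Longrightarrow> module R B \<Longrightarrow> tensor R A B"
  by (simp add: tensor_def tensor_axioms_def is_cring)

text \<open>\<open>tensor_map\<close> is a union of cosets over all representatives. The coset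
  obtained from \<open>g\<close> is the value at \<open>g\<close> of the extension of the bilinear
  map \<open>(a, b) \<mapsto> cl a (f b)\<close>; that value does not depend on the representative,
  so the union is a single coset.\<close>

lemma (in cring) tensor_map_cl:
  assumes A: "module R A" and B: "module R B" and C: "module R C" and f: "f \<in> module_hom R B C"
    and ab: "a \<in> carrier A" "b \<in> carrier B"
  shows "tensor_map R A B C f (tensor.cl R A B a b) = tensor.cl R A C a (f b)"
proof -
  interpret B: tensor R A B by (rule tensorI[OF A B])
  interpret C: tensor R A C by (rule tensorI[OF A C])
  let ?h = "\<lambda>p. pair_gen R A C (fst p) (f (snd p))"
  let ?h' = "\<lambda>p. C.cl (fst p) (f (snd p))"
  have fc: "f b \<in> carrier C" if "b \<in> carrier B" for b using module_hom_mem[OF f that] .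
  have fadd: "f (b \<oplus>\<^bsub>B\<^esub> b') = f b \<oplus>\<^bsub>C\<^esub> f b'" if "b \<in> carrier B" "b' \<in> carrier B" for b b'
    using module_hom_add[OF f that] .
  have fsmult: "f (r \<odot>\<^bsub>B\<^esub> b) = r \<odot>\<^bsub>C\<^esub> f b" if "r \<in> carrier R" "b \<in> carrier B" for r b
    using module_hom_smult[OF f that] .
  have h': "B.bilinear_map C.TP ?h'" unfolding B.bilinear_map_def
    by (simp add: fc fadd fsmult C.cl_closed C.cl_add_left C.cl_add_right C.cl_smult_left C.cl_smult_right)
  have h: "?h \<in> carrier A \<times> carrier B \<rightarrow> carrier C.PM" using fc C.gen_closed by auto
  have ext_eq: "C.TR +>\<^bsub>C.PM\<^esub> B.ext C.PM ?h g = B.ext C.TP ?h' g" if g: "g \<in> carrier B.PM" for g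
  proof (rule hom_eq_on_free[OF C.TP _ _ _ g])
    show "(\<lambda>g. C.TR +>\<^bsub>C.PM\<^esub> B.ext C.PM ?h g) \<in> module_hom R B.PM C.TP"
      unfolding tensor_product_def by (rule hom_comp[OF free_ext_hom[OF C.PM h] C.Q.quot_proj_hom])
    show "B.ext C.TP ?h' \<in> module_hom R B.PM C.TP" by (rule free_ext_hom[OF C.TP B.bilinear_fun[OF h']])
    fix p assume p: "p \<in> carrier A \<times> carrier B"
    show "C.TR +>\<^bsub>C.PM\<^esub> B.ext C.PM ?h (free_gen R (carrier A \<times> carrier B) p) =
        B.ext C.TP ?h' (free_gen R (carrier A \<times> carrier B) p)"
      unfolding free_ext_gen[OF C.PM h p] free_ext_gen[OF C.TP B.bilinear_fun[OF h'] p] by (simp add: C.cl_def)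
  qed
  let ?g0 = "pair_gen R A B a b"
  have g0: "?g0 \<in> carrier B.PM" by (rule B.gen_closed[OF ab])
  have self: "?g0 \<in> B.TR +>\<^bsub>B.PM\<^esub> ?g0" by (rule B.Q.N.a_rcos_self[OF g0])
  have "tensor_map R A B C f (B.cl a b) = (\<Union>g\<in>B.TR +>\<^bsub>B.PM\<^esub> ?g0. C.TR +>\<^bsub>C.PM\<^esub> B.ext C.PM ?h g)"
    unfolding tensor_map_def B.cl_def free_ext_def ..
  also have "\<dots> = (\<Union>g\<in>B.TR +>\<^bsub>B.PM\<^esub> ?g0. B.ext C.TP ?h' ?g0)"
  proof (rule SUP_cong[OF refl])
    fix g assume g: "g \<in> B.TR +>\<^bsub>B.PM\<^esub> ?g0"
    show "C.TR +>\<^bsub>C.PM\<^esub> B.ext C.PM ?h g = B.ext C.TP ?h' ?g0"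
      unfolding ext_eq[OF B.Q.N.a_elemrcos_carrier[OF g0 g]] by (rule B.ext_coset[OF C.TP h' g0 g])
  qed
  also have "\<dots> = B.ext C.TP ?h' ?g0" using self by blast
  also have "\<dots> = C.cl a (f b)"
    using free_ext_gen[OF C.TP B.bilinear_fun[OF h'], of "(a, b)"] ab by simp
  finally show ?thesis .
qed

section \<open>Tensoring with a cyclic module\<close>

locale cyclic_tensor = cring R for R :: "('a, 'r) ring_scheme" (structure) +
  fixes I and B :: "('a, 'c, 'n) module_scheme"
  assumes I: "ideal I R" and B: "module R B"
begin

abbreviation "RI \<equiv> quot_module (self_module R) I"

sublocale I: ideal I R by (rule I)
sublocale QI: quotient R "self_module R" I by (rule quotientI) (simp add: self_submodule_iff I)
sublocale tensor R RI B by (rule tensorI[OF QI.quot_module_module B])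

definition unit where "unit = I +>\<^bsub>self_module R\<^esub> \<one>"

text \<open>The canonical map from \<open>B\<close> to \<open>R / I\<close> tensored with
  \<open>B\<close>. As it is onto with known kernel, computations in the tensor product are carried
  out in \<open>B\<close>.\<close>

definition \<tau> where "\<tau> y = cl unit y"

lemma unit_closed: "unit \<in> carrier RI" unfolding unit_def by (rule QI.coset_closed) simp

lemma smult_unit: "r \<in> carrier R \<Longrightarrow> r \<odot>\<^bsub>RI\<^esub> unit = I +>\<^bsub>self_module R\<^esub> r"
  unfolding unit_def by (subst QI.quot_smult) simp_all

lemma smult_unit_zero_iff: "r \<in> carrier R \<Longrightarrow> r \<odot>\<^bsub>RI\<^esub> unit = \<zero>\<^bsub>RI\<^esub> \<longleftrightarrow> r \<in> I"
  using QI.coset_eq_zero_iff[of r] by (simp add: smult_unit quot_module_simps(3))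

lemma \<tau>_hom: "\<tau> \<in> module_hom R B TP"
  unfolding module_hom_def \<tau>_def
  by (auto simp: cl_closed cl_add_right cl_smult_right unit_closed)

sublocale \<tau>: mod_hom R B TP \<tau> by (rule mod_homI[OF B TP \<tau>_hom])

text \<open>With \<open>a\<close> the class of \<open>r\<close>, the generator for
  \<open>(a, b)\<close> is \<open>r\<close> times that for \<open>(unit, b)\<close>, and
  \<open>r\<close> moves into the second factor.\<close>

lemma \<tau>_surj: "\<tau> ` carrier B = carrier TP"
proof
  show "\<tau> ` carrier B \<subseteq> carrier TP" using module_hom_mem[OF \<tau>_hom] by blast
  have im: "submodule R (\<tau> ` carrier B) TP" by (rule hom_image_submodule[OF \<tau>_hom TP carrier_submodule[OF B]])
  have proj: "(\<lambda>x. TR +>\<^bsub>PM\<^esub> x) \<in> module_hom R PM TP" unfolding tensor_product_def by (rule Q.quot_proj_hom)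
  let ?C = "{g \<in> carrier PM. TR +>\<^bsub>PM\<^esub> g \<in> \<tau> ` carrier B}"
  have C: "submodule R ?C PM" by (rule hom_vimage_submodule[OF proj PM im])
  show "carrier TP \<subseteq> \<tau> ` carrier B"
  proof
    fix Z assume "Z \<in> carrier TP"
    then obtain g where g: "g \<in> carrier PM" "Z = TR +>\<^bsub>PM\<^esub> g"
      unfolding tensor_product_def by (rule Q.quot_carrierE)
    have "g \<in> ?C"
    proof (rule free_module_memI[OF C g(1)])
      fix p assume p: "p \<in> carrier RI \<times> carrier B"
      then obtain a b where ab: "p = (a, b)" "a \<in> carrier RI" "b \<in> carrier B" by blast
      obtain r where r: "r \<in> carrier R" "a = I +>\<^bsub>self_module R\<^esub> r"
        using QI.quot_carrierE[OF ab(2)] by auto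
      have "TR +>\<^bsub>PM\<^esub> free_gen R (carrier RI \<times> carrier B) p = cl (r \<odot>\<^bsub>RI\<^esub> unit) b"
        using ab r smult_unit by (simp add: cl_def)
      also have "\<dots> = r \<odot>\<^bsub>TP\<^esub> cl unit b" by (rule cl_smult_left[OF r(1) unit_closed ab(3)])
      also have "\<dots> = \<tau> (r \<odot>\<^bsub>B\<^esub> b)" unfolding \<tau>_def by (rule cl_smult_right[OF r(1) unit_closed ab(3), symmetric])
      finally have "TR +>\<^bsub>PM\<^esub> free_gen R (carrier RI \<times> carrier B) p \<in> \<tau> ` carrier B"
        using B.smult_closed[OF r(1) ab(3)] by (simp only: imageI)
      then have "free_gen R (carrier RI \<times> carrier B) p \<in> ?C" using free_gen_closed[OF p] by blast
      moreover have "g p \<in> carrier R" using free_module_fun[OF g(1)] p by auto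
      ultimately show "g p \<odot>\<^bsub>PM\<^esub> free_gen R (carrier RI \<times> carrier B) p \<in> ?C"
        by (intro submodule.smult_closed[OF C])
    qed
    then show "Z \<in> \<tau> ` carrier B" using g by simp
  qed
qed

lemma \<tau>_smult_ideal:
  assumes "r \<in> I" "b \<in> carrier B" shows "\<tau> (r \<odot>\<^bsub>B\<^esub> b) = \<zero>\<^bsub>TP\<^esub>"
proof -
  have r: "r \<in> carrier R" using assms(1) by (rule I.Icarr)
  have z: "\<zero>\<^bsub>RI\<^esub> \<in> carrier RI" by (rule A.M.zero_closed)
  have "\<tau> (r \<odot>\<^bsub>B\<^esub> b) = cl (r \<odot>\<^bsub>RI\<^esub> unit) b"
    unfolding \<tau>_def cl_smult_right[OF r unit_closed assms(2)] cl_smult_left[OF r unit_closed assms(2)] ..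
  \<comment> \<open>Zero is written as a scalar multiple so that linearity in the left factor
    applies to it.\<close>
  also have "r \<odot>\<^bsub>RI\<^esub> unit = \<zero> \<odot>\<^bsub>RI\<^esub> \<zero>\<^bsub>RI\<^esub>"
    using smult_unit_zero_iff[OF r] assms(1) A.lmult_0[OF z] by simp
  also have "cl (\<zero> \<odot>\<^bsub>RI\<^esub> \<zero>\<^bsub>RI\<^esub>) b = \<zero> \<odot>\<^bsub>TP\<^esub> cl \<zero>\<^bsub>RI\<^esub> b" by (rule cl_smult_left[OF zero_closed z assms(2)])
  also have "\<dots> = \<zero>\<^bsub>TP\<^esub>" by (rule module.lmult_0[OF TP cl_closed[OF z assms(2)]])
  finally show ?thesis .
qed

end

lemma (in cring) cyclic_tensorI: "ideal I R \<Longrightarrow> module R B \<Longrightarrow> cyclic_tensor R I B"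
  by (simp add: cyclic_tensor_def cyclic_tensor_axioms_def is_cring)

text \<open>Identifies \<open>R / I\<close> tensored with a free module of rank \<open>n\<close>
  with the free module modulo \<open>I\<close> times it: the submodule lies in the kernel by
  bilinearity, and coordinate functionals show that nothing else does.\<close>

lemma (in cring) \<tau>_zero_iff:
  assumes I: "ideal I R" and y: "y \<in> carrier (free_rank R n)"
  shows "cyclic_tensor.\<tau> R I (free_rank R n) y = \<zero>\<^bsub>tensor_product R (quot_module (self_module R) I) (free_rank R n)\<^esub>
    \<longleftrightarrow> y \<in> coord_submodule R I n"
proof -
  let ?F = "free_rank R n"
  interpret t: cyclic_tensor R I ?F by (rule cyclic_tensorI[OF I free_module_module])
  show "t.\<tau> y = \<zero>\<^bsub>t.TP\<^esub> \<longleftrightarrow> y \<in> coord_submodule R I n"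
  proof
    assume y0: "y \<in> coord_submodule R I n"
    have C: "submodule R {x \<in> carrier ?F. t.\<tau> x = \<zero>\<^bsub>t.TP\<^esub>} ?F"
      using t.\<tau>.ker_is_submodule by (simp only: t.\<tau>.ker_def)
    have "y \<in> {x \<in> carrier ?F. t.\<tau> x = \<zero>\<^bsub>t.TP\<^esub>}"
    proof (rule free_rank_memI[OF C y])
      fix j assume j: "j < n"
      have e: "free_gen R {..<n} j \<in> carrier ?F" using j by (intro free_gen_closed) simp
      have yj: "y j \<in> I" using y0 j by (simp add: coord_submodule_def)
      have "y j \<odot>\<^bsub>?F\<^esub> free_gen R {..<n} j \<in> carrier ?F" using t.I.Icarr[OF yj] e by (rule t.B.smult_closed)
      then show "y j \<odot>\<^bsub>?F\<^esub> free_gen R {..<n} j \<in> {x \<in> carrier ?F. t.\<tau> x = \<zero>\<^bsub>t.TP\<^esub>}"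
        using t.\<tau>_smult_ideal[OF yj e] by simp
    qed
    then show "t.\<tau> y = \<zero>\<^bsub>t.TP\<^esub>" by simp
  next
    assume "t.\<tau> y = \<zero>\<^bsub>t.TP\<^esub>"
    then have "t.TR +>\<^bsub>t.PM\<^esub> pair_gen R t.RI ?F t.unit y = t.TR"
      unfolding t.\<tau>_def t.cl_def tensor_product_def quot_module_simps(3) .
    then have rel: "pair_gen R t.RI ?F t.unit y \<in> t.TR"
      using t.Q.coset_eq_zero_iff[OF t.gen_closed[OF t.unit_closed y]] by blast
    have "y j \<in> I" if j: "j < n" for j
    proof -
      \<comment> \<open>The bilinear map that multiplies the class in \<open>R / I\<close> by the
        j-th coordinate; at \<open>(unit, y)\<close> it returns the class of
        \<open>y j\<close>.\<close>
      let ?h = "\<lambda>p. snd p j \<odot>\<^bsub>t.RI\<^esub> fst p"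
      have vc: "v j \<in> carrier R" if "v \<in> carrier ?F" for v using that j by (auto simp: free_rank_carrier)
      have h: "t.bilinear_map t.RI ?h" unfolding t.bilinear_map_def
      proof (intro conjI ballI)
        fix r a b assume r: "r \<in> carrier R" and a: "a \<in> carrier t.RI" and b: "b \<in> carrier ?F"
        show "?h (r \<odot>\<^bsub>t.RI\<^esub> a, b) = r \<odot>\<^bsub>t.RI\<^esub> ?h (a, b)"
          using r a vc[OF b] by (simp add: t.A.smult_assoc1[symmetric] m_comm)
        show "?h (a, r \<odot>\<^bsub>?F\<^esub> b) = r \<odot>\<^bsub>t.RI\<^esub> ?h (a, b)"
          using r a vc[OF b] j by (simp add: free_module_simps t.A.smult_assoc1)
      next
        fix a b b' assume a: "a \<in> carrier t.RI" and b: "b \<in> carrier ?F" "b' \<in> carrier ?F"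
        show "?h (a, b \<oplus>\<^bsub>?F\<^esub> b') = ?h (a, b) \<oplus>\<^bsub>t.RI\<^esub> ?h (a, b')"
          using a vc[OF b(1)] vc[OF b(2)] j by (simp add: free_module_simps t.A.smult_l_distr)
      qed (use vc in \<open>auto simp: t.A.smult_r_distr intro!: t.A.smult_closed\<close>)
      have "t.ext t.RI ?h (pair_gen R t.RI ?F t.unit y) = y j \<odot>\<^bsub>t.RI\<^esub> t.unit"
        using free_ext_gen[OF t.A t.bilinear_fun[OF h], of "(t.unit, y)"] t.unit_closed y by simp
      then have "y j \<odot>\<^bsub>t.RI\<^esub> t.unit = \<zero>\<^bsub>t.RI\<^esub>" using t.ext_relations[OF t.A h rel] by simp
      then show ?thesis using t.smult_unit_zero_iff[OF vc[OF y]] by simp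
    qed
    then show "y \<in> coord_submodule R I n" using y by (simp add: coord_submodule_def)
  qed
qed

section \<open>Betti numbers\<close>

text \<open>The representative picked by \<open>SOME\<close> differs from \<open>r\<close> by an
  element of \<open>I\<close>, which acts as zero.\<close>

lemma (in cring) coset_smult_quot_ring_module:
  assumes I: "ideal I R" and H: "module R H"
    and kill: "\<And>a x. a \<in> I \<Longrightarrow> x \<in> carrier H \<Longrightarrow> a \<odot>\<^bsub>H\<^esub> x = \<zero>\<^bsub>H\<^esub>"
    and r: "r \<in> carrier R" and x: "x \<in> carrier H"
  shows "(I +> r) \<odot>\<^bsub>quot_ring_module H\<^esub> x = r \<odot>\<^bsub>H\<^esub> x"
proof -
  interpret I: ideal I R by fact
  interpret H: module R H by fact
  define s where "s = (SOME a. a \<in> I +> r)"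
  have "s \<in> I +> r" unfolding s_def using I.a_rcos_self[OF r] by (rule someI[of "\<lambda>a. a \<in> I +> r"])
  then have s: "s \<in> carrier R" "s \<oplus> \<ominus> r \<in> I"
    using I.a_elemrcos_carrier[OF r] I.a_rcos_module_imp[OF r] by auto
  have "s = (s \<oplus> \<ominus> r) \<oplus> r" using s r by (simp add: a_assoc l_neg)
  then have "s \<odot>\<^bsub>H\<^esub> x = (s \<oplus> \<ominus> r) \<odot>\<^bsub>H\<^esub> x \<oplus>\<^bsub>H\<^esub> r \<odot>\<^bsub>H\<^esub> x"
    using H.smult_l_distr[of "s \<oplus> \<ominus> r" r x] s r x by simp
  also have "\<dots> = r \<odot>\<^bsub>H\<^esub> x" using kill[OF s(2) x] r x by simp
  finally show ?thesis by (simp add: quot_ring_module_def s_def)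
qed

lemma quot_ring_module_simps:
  "carrier (quot_ring_module H) = carrier H" "x \<oplus>\<^bsub>quot_ring_module H\<^esub> y = x \<oplus>\<^bsub>H\<^esub> y"
  "\<zero>\<^bsub>quot_ring_module H\<^esub> = \<zero>\<^bsub>H\<^esub>"
  by (simp_all add: quot_ring_module_def)

lemma (in cring) quot_ring_module_module:
  assumes I: "ideal I R" and H: "module R H"
    and kill: "\<And>a x. a \<in> I \<Longrightarrow> x \<in> carrier H \<Longrightarrow> a \<odot>\<^bsub>H\<^esub> x = \<zero>\<^bsub>H\<^esub>"
  shows "module (R Quot I) (quot_ring_module H)"
proof -
  interpret I: ideal I R by fact
  interpret H: module R H by fact
  let ?V = "quot_ring_module H" and ?K = "R Quot I"
  note sm = coset_smult_quot_ring_module[OF I H kill]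
  have carr: "Z \<in> carrier ?K \<longleftrightarrow> (\<exists>a\<in>carrier R. Z = I +> a)" for Z
    by (auto simp: FactRing_def A_RCOSETS_def')
  have mult: "(I +> a) \<otimes>\<^bsub>?K\<^esub> (I +> b) = I +> (a \<otimes> b)" if "a \<in> carrier R" "b \<in> carrier R" for a b
    using ring_hom_mult[OF I.rcos_ring_hom that] by simp
  have add: "(I +> a) \<oplus>\<^bsub>?K\<^esub> (I +> b) = I +> (a \<oplus> b)" if "a \<in> carrier R" "b \<in> carrier R" for a b
    using ring_hom_add[OF I.rcos_ring_hom that] by simp
  have one: "\<one>\<^bsub>?K\<^esub> = I +> \<one>" by (simp add: FactRing_def)
  show ?thesis
  proof (rule module_criteria, unfold quot_ring_module_simps)
    show "cring ?K" by (rule I.quotient_is_cring[OF is_cring])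
    show "\<forall>v\<in>carrier H. \<exists>neg_v\<in>carrier H. v \<oplus>\<^bsub>H\<^esub> neg_v = \<zero>\<^bsub>H\<^esub>" using H.M.r_neg H.M.a_inv_closed by blast
    show "\<forall>c v. c \<in> carrier ?K \<and> v \<in> carrier H \<longrightarrow> c \<odot>\<^bsub>?V\<^esub> v \<in> carrier H" by (auto simp: carr sm)
    show "\<forall>a b v. a \<in> carrier ?K \<and> b \<in> carrier ?K \<and> v \<in> carrier H \<longrightarrow>
        (a \<otimes>\<^bsub>?K\<^esub> b) \<odot>\<^bsub>?V\<^esub> v = a \<odot>\<^bsub>?V\<^esub> (b \<odot>\<^bsub>?V\<^esub> v)"
      by (auto simp: carr sm mult H.smult_assoc1)
    show "\<forall>v\<in>carrier H. \<one>\<^bsub>?K\<^esub> \<odot>\<^bsub>?V\<^esub> v = v" by (auto simp: one sm)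
    show "\<forall>a b v. a \<in> carrier ?K \<and> b \<in> carrier ?K \<and> v \<in> carrier H \<longrightarrow>
        (a \<oplus>\<^bsub>?K\<^esub> b) \<odot>\<^bsub>?V\<^esub> v = a \<odot>\<^bsub>?V\<^esub> v \<oplus>\<^bsub>H\<^esub> b \<odot>\<^bsub>?V\<^esub> v"
      by (auto simp: carr sm add H.smult_l_distr)
    show "\<forall>a v w. a \<in> carrier ?K \<and> v \<in> carrier H \<and> w \<in> carrier H \<longrightarrow>
        a \<odot>\<^bsub>?V\<^esub> (v \<oplus>\<^bsub>H\<^esub> w) = a \<odot>\<^bsub>?V\<^esub> v \<oplus>\<^bsub>H\<^esub> a \<odot>\<^bsub>?V\<^esub> w"
      by (auto simp: carr sm H.smult_r_distr)
  qed (auto simp: H.M.a_ac)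
qed

text \<open>\<open>H\<close> is the free module of rank \<open>n\<close> modulo the maximal ideal
  times it, so the images of the free generators form a basis over the residue field.\<close>

lemma (in cring) dim_free_quotient:
  assumes m: "maximalideal \<mm> R" and H: "module R H" and u: "u \<in> module_hom R (free_rank R n) H"
    and surj: "u ` carrier (free_rank R n) = carrier H"
    and ker: "\<And>x. x \<in> carrier (free_rank R n) \<Longrightarrow> u x = \<zero>\<^bsub>H\<^esub> \<longleftrightarrow> x \<in> coord_submodule R \<mm> n"
  shows "vectorspace.dim (R Quot \<mm>) (quot_ring_module H) = n"
proof -
  let ?F = "free_rank R n" and ?K = "R Quot \<mm>" and ?V = "quot_ring_module H" and ?e = "free_gen R {..<n}"
  have I: "ideal \<mm> R" using m by (rule maximalideal.axioms(1))
  interpret m: ideal \<mm> R by (rule I)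
  interpret F: module R ?F by (rule free_module_module)
  interpret H: module R H by fact
  interpret u: mod_hom R ?F H u using u by (intro mod_homI free_module_module H)
  have kill: "a \<odot>\<^bsub>H\<^esub> x = \<zero>\<^bsub>H\<^esub>" if a: "a \<in> \<mm>" and x: "x \<in> carrier H" for a x
  proof -
    obtain y where y: "y \<in> carrier ?F" "x = u y" using x surj by blast
    have aR: "a \<in> carrier R" using a by (rule m.Icarr)
    have "a \<odot>\<^bsub>?F\<^esub> y \<in> coord_submodule R \<mm> n" by (rule smult_coord_submodule[OF I a y(1)])
    then have "u (a \<odot>\<^bsub>?F\<^esub> y) = \<zero>\<^bsub>H\<^esub>" by (simp only: ker[OF F.smult_closed[OF aR y(1)]])
    then show ?thesis using y aR by simp
  qed
  note sm = coset_smult_quot_ring_module[OF I H kill]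
  have V: "module ?K ?V" by (rule quot_ring_module_module[OF I H kill])
  interpret VS: vectorspace ?K ?V
    using V maximalideal.quotient_is_field[OF m is_cring] by (simp add: vectorspace_def)
  have carr: "Z \<in> carrier ?K \<longleftrightarrow> (\<exists>a\<in>carrier R. Z = \<mm> +> a)" for Z
    by (auto simp: FactRing_def A_RCOSETS_def')
  have zeroK: "\<zero>\<^bsub>?K\<^esub> = \<mm>" by (simp add: FactRing_def)
  have e: "?e j \<in> carrier ?F" if "j < n" for j using that by (intro free_gen_closed) simp
  have ue: "u (?e j) \<in> carrier H" if "j < n" for j using e[OF that] by simp
  let ?S = "(\<lambda>j. u (?e j)) ` {..<n}"
  \<comment> \<open>The basis is a set, so the images must be distinct for it to have
    \<open>n\<close> elements and for linear combinations to be indexed by \<open>j\<close>. Equal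
    images would put a vector with a coordinate 1 into the kernel.\<close>
  have inj: "inj_on (\<lambda>j. u (?e j)) {..<n}"
  proof (rule inj_onI)
    fix j k assume jk: "j \<in> {..<n}" "k \<in> {..<n}" "u (?e j) = u (?e k)"
    show "j = k"
    proof (rule ccontr)
      assume "j \<noteq> k"
      let ?x = "?e j \<oplus>\<^bsub>?F\<^esub> (\<ominus> \<one>) \<odot>\<^bsub>?F\<^esub> ?e k"
      have c: "(\<ominus> \<one>) \<odot>\<^bsub>?F\<^esub> ?e k \<in> carrier ?F" using e jk by (intro F.smult_closed) auto
      have xc: "?x \<in> carrier ?F" using c e jk by (intro F.M.a_closed) auto
      have "u ?x = u (?e j) \<oplus>\<^bsub>H\<^esub> (\<ominus> \<one>) \<odot>\<^bsub>H\<^esub> u (?e k)" using c e jk(1,2) by simp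
      also have "\<dots> = \<zero>\<^bsub>H\<^esub>" using jk ue by (simp add: H.smult_minus_1 H.M.r_neg)
      finally have "?x \<in> coord_submodule R \<mm> n" by (simp only: ker[OF xc])
      then have "?x j \<in> \<mm>" using jk by (simp add: coord_submodule_def)
      moreover have "?x j = \<one>" using jk \<open>j \<noteq> k\<close> by (simp add: free_module_simps free_gen_def)
      ultimately show False using maximalideal.I_notcarr[OF m] m.one_imp_carrier by auto
    qed
  qed
  have S: "?S \<subseteq> carrier ?V" using ue by (auto simp: quot_ring_module_simps)
  have spanS: "submodule ?K (VS.span ?S) ?V" by (rule VS.span_is_submodule[OF S])
  have gen: "VS.span ?S = carrier ?V"
  proof
    show "VS.span ?S \<subseteq> carrier ?V" by (rule VS.span_is_subset2[OF S])
    let ?C = "{x \<in> carrier ?F. u x \<in> VS.span ?S}"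
    have C: "submodule R ?C ?F" unfolding submodule_def
    proof (intro conjI allI impI)
      show "\<zero>\<^bsub>?F\<^esub> \<in> ?C" using spanS u.f0_is_0 by (auto simp: submodule_def quot_ring_module_simps)
      fix v w assume "v \<in> ?C" "w \<in> ?C"
      then show "v \<oplus>\<^bsub>?F\<^esub> w \<in> ?C"
        using submodule.m_closed[OF spanS, of "u v" "u w"] by (simp add: quot_ring_module_simps)
    next
      fix c v assume c: "c \<in> carrier R" and v: "v \<in> ?C"
      have "(\<mm> +> c) \<odot>\<^bsub>?V\<^esub> u v \<in> VS.span ?S"
        using submodule.smult_closed[OF spanS, of "\<mm> +> c" "u v"] c v carr by blast
      then show "c \<odot>\<^bsub>?F\<^esub> v \<in> ?C" using c v by (simp add: sm)
    qed (auto intro: free_module_module)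
    show "carrier ?V \<subseteq> VS.span ?S"
    proof
      fix h assume "h \<in> carrier ?V"
      then obtain x where x: "x \<in> carrier ?F" "h = u x" using surj by (auto simp: quot_ring_module_simps)
      have "x \<in> ?C"
      proof (rule free_rank_memI[OF C x(1)])
        fix j assume j: "j < n"
        have "u (?e j) \<in> VS.span ?S" using VS.in_own_span[OF S] j by blast
        then have "?e j \<in> ?C" using e[OF j] by simp
        moreover have "x j \<in> carrier R" using x(1) j by (auto simp: free_rank_carrier)
        ultimately show "x j \<odot>\<^bsub>?F\<^esub> ?e j \<in> ?C" by (intro submodule.smult_closed[OF C])
      qed
      then show "h \<in> VS.span ?S" using x by simp
    qed
  qed
  have li: "VS.lin_indpt ?S"
  proof (rule VS.finite_lin_indpt2[OF _ S])
    show "finite ?S" by simp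
    fix a assume a: "a \<in> ?S \<rightarrow> carrier ?K" and 0: "VS.lincomb a ?S = \<zero>\<^bsub>?V\<^esub>"
    have "\<forall>j\<in>{..<n}. \<exists>r. r \<in> carrier R \<and> a (u (?e j)) = \<mm> +> r" using a carr by (auto simp: Pi_def)
    from bchoice[OF this] obtain r where r: "\<forall>j\<in>{..<n}. r j \<in> carrier R \<and> a (u (?e j)) = \<mm> +> r j" by blast
    \<comment> \<open>Lifts \<open>r j\<close> of the coefficients, truncated at \<open>k\<close>,
      so that \<open>u (y k)\<close> is the k-th partial sum. A vanishing combination puts
      \<open>y n\<close> into the kernel, so all \<open>r j\<close> lie in the maximal
      ideal.\<close>
    define y where "y k = (\<lambda>j\<in>{..<n}. if j < k then r j else \<zero>)" for k
    have yc: "y k \<in> carrier ?F" for k using r by (auto simp: y_def free_rank_carrier)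
    have summand: "a (u (?e j)) \<odot>\<^bsub>?V\<^esub> u (?e j) = r j \<odot>\<^bsub>H\<^esub> u (?e j)" if "j < n" for j
      using r that sm ue by simp
    have sum: "(\<Oplus>\<^bsub>?V\<^esub>j\<in>{..<k}. a (u (?e j)) \<odot>\<^bsub>?V\<^esub> u (?e j)) = u (y k)" if "k \<le> n" for k using that
    proof (induction k)
      case 0
      have "y 0 = \<zero>\<^bsub>?F\<^esub>" by (simp add: y_def free_module_simps)
      then show ?case by (simp add: quot_ring_module_simps)
    next
      case (Suc k)
      then have k: "k < n" by simp
      have "y (Suc k) = r k \<odot>\<^bsub>?F\<^esub> ?e k \<oplus>\<^bsub>?F\<^esub> y k"
        using r k by (auto simp: y_def free_module_simps free_gen_def fun_eq_iff restrict_def less_Suc_eq)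
      moreover have "r k \<in> carrier R" using r k by simp
      ultimately have "u (y (Suc k)) = r k \<odot>\<^bsub>H\<^esub> u (?e k) \<oplus>\<^bsub>H\<^esub> u (y k)" using yc e[OF k] by simp
      moreover have "(\<Oplus>\<^bsub>?V\<^esub>j\<in>{..<Suc k}. a (u (?e j)) \<odot>\<^bsub>?V\<^esub> u (?e j)) =
          a (u (?e k)) \<odot>\<^bsub>?V\<^esub> u (?e k) \<oplus>\<^bsub>?V\<^esub> (\<Oplus>\<^bsub>?V\<^esub>j\<in>{..<k}. a (u (?e j)) \<odot>\<^bsub>?V\<^esub> u (?e j))"
        unfolding lessThan_Suc
      proof (rule VS.finsum_insert)
        show "(\<lambda>j. a (u (?e j)) \<odot>\<^bsub>?V\<^esub> u (?e j)) \<in> {..<k} \<rightarrow> carrier ?V"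
          using summand r ue k by (auto simp: quot_ring_module_simps)
        show "a (u (?e k)) \<odot>\<^bsub>?V\<^esub> u (?e k) \<in> carrier ?V"
          using summand[OF k] r ue[OF k] k by (simp add: quot_ring_module_simps)
      qed auto
      ultimately show ?case using Suc summand[OF k] by (simp add: quot_ring_module_simps)
    qed
    have "VS.lincomb a ?S = (\<Oplus>\<^bsub>?V\<^esub>j\<in>{..<n}. a (u (?e j)) \<odot>\<^bsub>?V\<^esub> u (?e j))"
      unfolding VS.lincomb_def
    proof (rule VS.add.finprod_reindex[OF _ inj])
      show "(\<lambda>v. a v \<odot>\<^bsub>?V\<^esub> v) \<in> ?S \<rightarrow> carrier ?V"
        using summand r ue by (auto simp: quot_ring_module_simps)
    qed
    then have "u (y n) = \<zero>\<^bsub>H\<^esub>" using sum[OF order_refl] 0 by (simp add: quot_ring_module_simps)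
    then have yn: "y n \<in> coord_submodule R \<mm> n" by (simp only: ker[OF yc])
    show "\<forall>v\<in>?S. a v = \<zero>\<^bsub>?K\<^esub>"
    proof
      fix v assume "v \<in> ?S"
      then obtain j where j: "j < n" "v = u (?e j)" by auto
      have "y n j \<in> \<mm>" using yn j by (simp add: coord_submodule_def)
      then have "r j \<in> \<mm>" using j by (simp add: y_def)
      then have "\<mm> +> r j = \<mm>" by (rule m.a_rcos_const)
      then show "a v = \<zero>\<^bsub>?K\<^esub>" using r j zeroK by simp
    qed
  qed
  have "VS.basis ?S" using li gen S by (simp add: VS.basis_def)
  then have "VS.dim = card ?S" by (intro VS.dim_basis) auto
  also have "\<dots> = n" using card_image[OF inj] by simp
  finally show ?thesis .
qed

section \<open>Tensor homology computed by comparison with the minimal resolution\<close>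

context two_resolutions
begin

lemma chain_mapD:
  assumes "chain_map \<phi>"
  shows "\<phi> i \<in> module_hom R (F.T i) (G.T i)"
    and "x \<in> carrier (F.T (Suc i)) \<Longrightarrow> diff G (Suc i) (\<phi> (Suc i) x) = \<phi> i (diff F (Suc i) x)"
  using assms by (simp_all add: chain_map_def)

text \<open>The composite minus the identity is a chain map over the zero map of \<open>M\<close>,
  hence null-homotopic.\<close>

lemma composite_homotopy:
  assumes \<phi>: "chain_map \<phi>" "\<forall>x\<in>carrier (F.T 0). aug G (\<phi> 0 x) = aug F x"
    and \<psi>: "two_resolutions.chain_map R G F \<psi>" "\<forall>x\<in>carrier (G.T 0). aug F (\<psi> 0 x) = aug G x"
  shows "\<exists>h. (\<forall>i. h i \<in> module_hom R (F.T i) (F.T (Suc i))) \<and>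
    (\<forall>x\<in>carrier (F.T 0). \<psi> 0 (\<phi> 0 x) \<ominus>\<^bsub>F.T 0\<^esub> x = diff F 1 (h 0 x)) \<and>
    (\<forall>i. \<forall>x\<in>carrier (F.T (Suc i)). \<psi> (Suc i) (\<phi> (Suc i) x) \<ominus>\<^bsub>F.T (Suc i)\<^esub> x =
       diff F (Suc (Suc i)) (h (Suc i) x) \<oplus>\<^bsub>F.T (Suc i)\<^esub> h i (diff F (Suc i) x))"
proof -
  interpret GF: two_resolutions R M G F by unfold_locales
  interpret FF: two_resolutions R M F F by unfold_locales
  define \<alpha> where "\<alpha> i x = \<psi> i (\<phi> i x) \<ominus>\<^bsub>F.T i\<^esub> x" for i x
  have id: "(\<lambda>x. x) \<in> module_hom R (F.T i) (F.T i)" for i by (auto simp: module_hom_def)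
  have comp: "(\<lambda>x. \<psi> i (\<phi> i x)) \<in> module_hom R (F.T i) (F.T i)" for i
    by (rule F.hom_comp[OF chain_mapD(1)[OF \<phi>(1)] GF.chain_mapD(1)[OF \<psi>(1)]])
  have "FF.chain_map \<alpha>" unfolding FF.chain_map_def
  proof (intro conjI allI ballI)
    show "\<alpha> i \<in> module_hom R (F.T i) (F.T i)" for i
      unfolding \<alpha>_def by (rule F.hom_diff[OF comp id F.free_module_module F.free_module_module])
    fix i x assume x: "x \<in> carrier (F.T (Suc i))"
    interpret d: mod_hom R "F.T (Suc i)" "F.T i" "diff F (Suc i)"
      by (rule F.mod_homI[OF F.free_module_module F.free_module_module F.diff_hom])
    have "diff F (Suc i) (\<alpha> (Suc i) x) = diff F (Suc i) (\<psi> (Suc i) (\<phi> (Suc i) x)) \<ominus>\<^bsub>F.T i\<^esub> diff F (Suc i) x"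
      unfolding \<alpha>_def using x module_hom_mem[OF comp x] by simp
    also have "diff F (Suc i) (\<psi> (Suc i) (\<phi> (Suc i) x)) = \<psi> i (\<phi> i (diff F (Suc i) x))"
      using GF.chain_mapD(2)[OF \<psi>(1) module_hom_mem[OF chain_mapD(1)[OF \<phi>(1)] x]] chain_mapD(2)[OF \<phi>(1) x] by simp
    finally show "diff F (Suc i) (\<alpha> (Suc i) x) = \<alpha> i (diff F (Suc i) x)" by (simp only: \<alpha>_def)
  qed
  moreover have "aug F (\<alpha> 0 x) = \<zero>\<^bsub>M\<^esub>" if x: "x \<in> carrier (F.T 0)" for x
  proof -
    interpret M: module R M by (rule F.module_M)
    interpret a: mod_hom R "F.T 0" M "aug F"
      by (rule F.mod_homI[OF F.free_module_module F.module_M F.aug_hom])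
    have "aug F (\<alpha> 0 x) = aug F (\<psi> 0 (\<phi> 0 x)) \<ominus>\<^bsub>M\<^esub> aug F x"
      unfolding \<alpha>_def using x module_hom_mem[OF comp x] by simp
    also have "aug F (\<psi> 0 (\<phi> 0 x)) = aug F x"
      using \<phi>(2) \<psi>(2) x module_hom_mem[OF chain_mapD(1)[OF \<phi>(1)] x] by simp
    finally show ?thesis using module_hom_mem[OF F.aug_hom x] by simp
  qed
  ultimately show ?thesis using FF.exists_homotopy[of \<alpha>] unfolding \<alpha>_def by blast
qed

end

locale minimal_comparison = two_resolutions R M F G + min: minimal_resolution R M F
  for R (structure) and M :: "('a, 'm, 'k) module_scheme" and F and G
begin

abbreviation "\<mm> \<equiv> max_ideal R"

text \<open>The comparison map from the minimal \<open>F\<close> to the arbitrary \<open>G\<close>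
  induces a map \<open>u\<close> from \<open>F.T i\<close> straight to the homology of the tensored
  \<open>G\<close>. Showing that \<open>u\<close> is onto with kernel the maximal ideal times
  \<open>F.T i\<close> gives the dimension without functoriality or independence of
  \<open>Tor\<close>.\<close>

lemma tensor_homology_dim:
  "vectorspace.dim (R Quot \<mm>) (quot_ring_module (tensor_homology R (residue_module R) G i)) = rk F i"
proof -
  interpret GF: two_resolutions R M G F by unfold_locales
  note I = min.max_ideal(2)
  interpret t: cyclic_tensor R \<mm> "G.T k" for k by (rule F.cyclic_tensorI[OF I F.free_module_module])
  let ?co = "coord_submodule R \<mm>"
  have k: "residue_module R = quot_module (self_module R) \<mm>" by (simp add: residue_module_def)
  obtain \<phi> where \<phi>: "chain_map \<phi>" "\<forall>x\<in>carrier (F.T 0). aug G (\<phi> 0 x) = aug F x"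
    using exists_chain_map by blast
  obtain \<psi> where \<psi>: "GF.chain_map \<psi>" "\<forall>x\<in>carrier (G.T 0). aug F (\<psi> 0 x) = aug G x"
    using GF.exists_chain_map by blast
  have \<phi>h: "\<phi> j \<in> module_hom R (F.T j) (G.T j)" for j by (rule chain_mapD(1)[OF \<phi>(1)])
  have \<psi>h: "\<psi> j \<in> module_hom R (G.T j) (F.T j)" for j by (rule GF.chain_mapD(1)[OF \<psi>(1)])
  have co_sub: "submodule R (?co p) (free_rank R p)" for p by (rule F.coord_submodule_submodule[OF I])
  have co_carr: "x \<in> ?co p \<Longrightarrow> x \<in> carrier (free_rank R p)" for x p by (simp add: coord_submodule_def)
  have co_zero: "\<zero>\<^bsub>free_rank R p\<^esub> \<in> ?co p" for p using co_sub by (simp add: submodule_def)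
  have hom_co: "f x \<in> ?co q" if "f \<in> module_hom R (free_rank R p) (free_rank R q)" "x \<in> ?co p" for f x p q
    by (rule F.hom_coord_submodule[OF I that])
  have \<tau>0: "t.\<tau> j y = \<zero>\<^bsub>t.TP j\<^esub> \<longleftrightarrow> y \<in> ?co (rk G j)" if "y \<in> carrier (G.T j)" for j y
    by (rule F.\<tau>_zero_iff[OF I that])
  have map_\<tau>: "tensor_map R t.RI (G.T (Suc j)) (G.T j) (diff G (Suc j)) (t.\<tau> (Suc j) y) = t.\<tau> j (diff G (Suc j) y)"
    if "y \<in> carrier (G.T (Suc j))" for j y
    unfolding t.\<tau>_def
    by (rule F.tensor_map_cl[OF t.A F.free_module_module F.free_module_module G.diff_hom t.unit_closed that])

  \<comment> \<open>The cycles pulled back along \<open>t.\<tau>\<close>: elements whose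
    differential vanishes modulo the maximal ideal, and all elements in degree 0.\<close>
  define D where "D = {y \<in> carrier (G.T i). case i of 0 \<Rightarrow> True | Suc j \<Rightarrow> diff G (Suc j) y \<in> ?co (rk G j)}"
  have D_sub: "submodule R D (G.T i)"
  proof (cases i)
    case 0 then show ?thesis using carrier_submodule[OF F.free_module_module] by (simp add: D_def)
  next
    case (Suc j)
    then show ?thesis unfolding D_def
      using hom_vimage_submodule[OF G.diff_hom[of j] F.free_module_module co_sub] by simp
  qed
  have D_carr: "D \<subseteq> carrier (G.T i)" by (auto simp: D_def)
  have cyc: "tensor_cycles R (residue_module R) G i = t.\<tau> i ` D"
  proof (cases i)
    case 0
    then show ?thesis using t.\<tau>_surj[of 0] by (simp add: tensor_cycles_def k D_def)
  next
    case (Suc j)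
    have "tensor_cycles R (residue_module R) G i =
      {Z \<in> t.\<tau> (Suc j) ` carrier (G.T (Suc j)).
        tensor_map R t.RI (G.T (Suc j)) (G.T j) (diff G (Suc j)) Z = \<zero>\<^bsub>t.TP j\<^esub>}"
      unfolding Suc tensor_cycles_def k t.\<tau>_surj by (simp add: a_kernel_eq)
    also have "\<dots> = t.\<tau> (Suc j) ` {y \<in> carrier (G.T (Suc j)). t.\<tau> j (diff G (Suc j) y) = \<zero>\<^bsub>t.TP j\<^esub>}"
      using map_\<tau>[of _ j] by auto
    also have "{y \<in> carrier (G.T (Suc j)). t.\<tau> j (diff G (Suc j) y) = \<zero>\<^bsub>t.TP j\<^esub>} = D"
      unfolding D_def Suc using \<tau>0[OF G.diff_closed] by auto
    finally show ?thesis unfolding Suc .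
  qed
  have bd: "tensor_boundaries R (residue_module R) G i = t.\<tau> i ` G.im i"
  proof -
    have "tensor_boundaries R (residue_module R) G i =
      tensor_map R t.RI (G.T (Suc i)) (G.T i) (diff G (Suc i)) ` t.\<tau> (Suc i) ` carrier (G.T (Suc i))"
      unfolding tensor_boundaries_def k t.\<tau>_surj ..
    also have "\<dots> = t.\<tau> i ` G.im i" unfolding image_image using map_\<tau>[of _ i] by (intro image_cong) auto
    finally show ?thesis .
  qed
  have im_D: "G.im i \<subseteq> D"
  proof
    fix y assume y: "y \<in> G.im i"
    have yc: "y \<in> carrier (G.T i)" using y G.im_subset by blast
    show "y \<in> D"
    proof (cases i)
      case 0 then show ?thesis using yc by (simp add: D_def)
    next
      case (Suc j)
      have "diff G (Suc j) y = \<zero>\<^bsub>G.T j\<^esub>" by (rule G.diff_im) (use y in \<open>simp only: Suc\<close>)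
      then have "diff G (Suc j) y \<in> ?co (rk G j)" using co_zero by (simp only:)
      then show ?thesis using yc by (simp add: D_def Suc)
    qed
  qed

  let ?C = "t.\<tau> i ` D" and ?B = "t.\<tau> i ` G.im i"
  let ?Z = "(t.TP i)\<lparr>carrier := ?C\<rparr>"
  have C_sub: "submodule R ?C (t.TP i)" by (rule hom_image_submodule[OF t.\<tau>_hom t.TP D_sub])
  have B_sub: "submodule R ?B (t.TP i)" by (rule hom_image_submodule[OF t.\<tau>_hom t.TP G.im_submodule])
  have Z: "module R ?Z" by (rule module.submodule_is_module[OF t.TP C_sub])
  have BC: "?B \<subseteq> ?C" using im_D by (rule image_mono)
  have BZ: "submodule R ?B ?Z" using B_sub Z BC by (simp add: submodule_def)
  interpret Q: quotient R ?Z ?B by (rule quotientI[OF BZ])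
  let ?H = "quot_module ?Z ?B"
  have H_eq: "tensor_homology R (residue_module R) G i = ?H"
    unfolding tensor_homology_def cyc bd unfolding k ..
  have dF_co: "diff F (Suc j) x \<in> ?co (rk F j)" if "x \<in> carrier (F.T (Suc j))" for j x
    by (rule min.diff_coords[OF F.diff_in_im[OF that]])
  have \<phi>_D: "\<phi> i x \<in> D" if x: "x \<in> carrier (F.T i)" for x
  proof (cases i)
    case 0 then show ?thesis using module_hom_mem[OF \<phi>h x] by (simp add: D_def)
  next
    case (Suc j)
    have "diff G (Suc j) (\<phi> (Suc j) x) = \<phi> j (diff F (Suc j) x)" using chain_mapD(2)[OF \<phi>(1)] x Suc by simp
    moreover have "\<phi> j (diff F (Suc j) x) \<in> ?co (rk G j)"
      using dF_co x Suc by (intro hom_co[OF \<phi>h]) simp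
    ultimately show ?thesis using module_hom_mem[OF \<phi>h x] Suc by (simp add: D_def)
  qed
  \<comment> \<open>All of \<open>F.T i\<close> lands in cycles: by minimality d x has coordinates
    in the maximal ideal, and a linear map preserves this.\<close>
  define u where "u x = ?B +>\<^bsub>?Z\<^esub> t.\<tau> i (\<phi> i x)" for x
  have comp: "(\<lambda>x. t.\<tau> i (\<phi> i x)) \<in> module_hom R (F.T i) (t.TP i)"
    by (rule F.hom_comp[OF \<phi>h t.\<tau>_hom])
  then have "(\<lambda>x. t.\<tau> i (\<phi> i x)) \<in> module_hom R (F.T i) ?Z"
    using \<phi>_D by (simp add: module_hom_def Pi_def)
  then have u_hom: "u \<in> module_hom R (F.T i) ?H"
    unfolding u_def by (rule F.hom_comp[OF _ Q.quot_proj_hom])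

  have u_surj: "u ` carrier (F.T i) = carrier ?H"
  proof
    show "u ` carrier (F.T i) \<subseteq> carrier ?H" using module_hom_mem[OF u_hom] by blast
    obtain h where hh: "\<And>j. h j \<in> module_hom R (G.T j) (G.T (Suc j))"
      and h0: "\<And>x. x \<in> carrier (G.T 0) \<Longrightarrow> \<phi> 0 (\<psi> 0 x) \<ominus>\<^bsub>G.T 0\<^esub> x = diff G 1 (h 0 x)"
      and hS: "\<And>j x. x \<in> carrier (G.T (Suc j)) \<Longrightarrow> \<phi> (Suc j) (\<psi> (Suc j) x) \<ominus>\<^bsub>G.T (Suc j)\<^esub> x =
        diff G (Suc (Suc j)) (h (Suc j) x) \<oplus>\<^bsub>G.T (Suc j)\<^esub> h j (diff G (Suc j) x)"
      using GF.composite_homotopy[OF \<psi> \<phi>] by blast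
    show "carrier ?H \<subseteq> u ` carrier (F.T i)"
    proof
      fix W assume "W \<in> carrier ?H"
      then obtain z where z: "z \<in> carrier ?Z" "W = ?B +>\<^bsub>?Z\<^esub> z" by (rule Q.quot_carrierE)
      then obtain y where y: "y \<in> D" "z = t.\<tau> i y" by auto
      have yc: "y \<in> carrier (G.T i)" using y D_carr by blast
      have \<psi>y: "\<psi> i y \<in> carrier (F.T i)" by (rule module_hom_mem[OF \<psi>h yc])
      have \<phi>\<psi>y: "\<phi> i (\<psi> i y) \<in> carrier (G.T i)" by (rule module_hom_mem[OF \<phi>h \<psi>y])
      have hy: "diff G (Suc i) (h i y) \<in> G.im i" by (rule G.diff_in_im[OF module_hom_mem[OF hh yc]])
      have hyc: "diff G (Suc i) (h i y) \<in> carrier (G.T i)" using hy G.im_subset by blast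
      \<comment> \<open>The homotopy expresses the difference as d h y + h d y. For \<open>y\<close>
        in \<open>D\<close> the second term has coordinates in the maximal ideal and is killed by
        \<open>t.\<tau>\<close>, so \<open>y\<close> and its round trip differ by a
        boundary.\<close>
      have "t.\<tau> i (\<phi> i (\<psi> i y) \<ominus>\<^bsub>G.T i\<^esub> y) = t.\<tau> i (diff G (Suc i) (h i y))"
      proof (cases i)
        case 0 then show ?thesis using h0 yc by simp
      next
        case (Suc j)
        have "diff G (Suc j) y \<in> ?co (rk G j)" using y Suc by (simp add: D_def)
        then have hd: "h j (diff G (Suc j) y) \<in> ?co (rk G i)" using hom_co[OF hh] Suc by simp
        then have hdc: "h j (diff G (Suc j) y) \<in> carrier (G.T i)" by (rule co_carr)
        have "\<phi> i (\<psi> i y) \<ominus>\<^bsub>G.T i\<^esub> y = diff G (Suc i) (h i y) \<oplus>\<^bsub>G.T i\<^esub> h j (diff G (Suc j) y)"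
          using hS yc Suc by simp
        then have "t.\<tau> i (\<phi> i (\<psi> i y) \<ominus>\<^bsub>G.T i\<^esub> y) =
            t.\<tau> i (diff G (Suc i) (h i y)) \<oplus>\<^bsub>t.TP i\<^esub> t.\<tau> i (h j (diff G (Suc j) y))"
          using module_hom_add[OF t.\<tau>_hom hyc hdc] by simp
        also have "t.\<tau> i (h j (diff G (Suc j) y)) = \<zero>\<^bsub>t.TP i\<^esub>" using \<tau>0[OF hdc] hd by simp
        finally show ?thesis using module_hom_mem[OF t.\<tau>_hom hyc] abelian_monoid.r_zero[OF abelian_group.axioms(1)[OF module.axioms(2)[OF t.TP]]] by simp
      qed
      then have mem: "t.\<tau> i (\<phi> i (\<psi> i y) \<ominus>\<^bsub>G.T i\<^esub> y) \<in> ?B" using hy by simp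
      have \<phi>\<psi>D: "\<phi> i (\<psi> i y) \<in> D" by (rule \<phi>_D[OF \<psi>y])
      have "t.\<tau> i y \<oplus>\<^bsub>t.TP i\<^esub> t.\<tau> i (\<phi> i (\<psi> i y) \<ominus>\<^bsub>G.T i\<^esub> y) = t.\<tau> i (\<phi> i (\<psi> i y))"
      proof -

        have "y \<oplus>\<^bsub>G.T i\<^esub> (\<phi> i (\<psi> i y) \<ominus>\<^bsub>G.T i\<^esub> y) = \<phi> i (\<psi> i y)"
          by (rule abelian_group.add_diff_cancel[OF module.axioms(2)[OF F.free_module_module] yc \<phi>\<psi>y])
        then show ?thesis using module_hom_add[OF t.\<tau>_hom yc t.B.M.minus_closed[OF \<phi>\<psi>y yc]] by simp
      qed
      then have sum: "t.\<tau> i (\<phi> i (\<psi> i y)) = t.\<tau> i y \<oplus>\<^bsub>?Z\<^esub> t.\<tau> i (\<phi> i (\<psi> i y) \<ominus>\<^bsub>G.T i\<^esub> y)" by simp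
      have c1: "t.\<tau> i y \<in> carrier ?Z" using y by simp
      have c2: "t.\<tau> i (\<phi> i (\<psi> i y) \<ominus>\<^bsub>G.T i\<^esub> y) \<in> carrier ?Z" using mem BC by auto
      have "u (\<psi> i y) = (?B +>\<^bsub>?Z\<^esub> t.\<tau> i y) \<oplus>\<^bsub>?H\<^esub> (?B +>\<^bsub>?Z\<^esub> t.\<tau> i (\<phi> i (\<psi> i y) \<ominus>\<^bsub>G.T i\<^esub> y))"
        unfolding u_def sum by (rule Q.quot_add[OF c1 c2, symmetric])
      also have "?B +>\<^bsub>?Z\<^esub> t.\<tau> i (\<phi> i (\<psi> i y) \<ominus>\<^bsub>G.T i\<^esub> y) = \<zero>\<^bsub>?H\<^esub>"
        using Q.coset_eq_zero_iff[OF c2] mem by (simp only: quot_module_simps(3))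
      also have "(?B +>\<^bsub>?Z\<^esub> t.\<tau> i y) \<oplus>\<^bsub>?H\<^esub> \<zero>\<^bsub>?H\<^esub> = W"
        using abelian_monoid.r_zero[OF abelian_group.axioms(1)[OF module.axioms(2)[OF Q.quot_module_module]] Q.coset_closed[OF c1]]
        by (simp only: z y)
      finally show "W \<in> u ` carrier (F.T i)" using \<psi>y by blast
    qed
  qed

  have ker: "u x = \<zero>\<^bsub>?H\<^esub> \<longleftrightarrow> x \<in> ?co (rk F i)" if x: "x \<in> carrier (F.T i)" for x
  proof
    assume x0: "x \<in> ?co (rk F i)"
    then have "\<phi> i x \<in> ?co (rk G i)" by (rule hom_co[OF \<phi>h])
    then have "t.\<tau> i (\<phi> i x) = \<zero>\<^bsub>t.TP i\<^esub>" using \<tau>0[OF module_hom_mem[OF \<phi>h x]] by blast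
    then have "t.\<tau> i (\<phi> i x) = \<zero>\<^bsub>?Z\<^esub>" by simp
    then show "u x = \<zero>\<^bsub>?H\<^esub>" unfolding u_def by (simp only: Q.coset_zero quot_module_simps(3))
  next
    assume "u x = \<zero>\<^bsub>?H\<^esub>"
    have "t.\<tau> i (\<phi> i x) \<in> carrier ?Z" using \<phi>_D[OF x] by simp
    then have "t.\<tau> i (\<phi> i x) \<in> ?B"
      using \<open>u x = \<zero>\<^bsub>?H\<^esub>\<close> Q.coset_eq_zero_iff unfolding u_def quot_module_simps(3) by blast
    then obtain w where w: "w \<in> carrier (G.T (Suc i))" "t.\<tau> i (\<phi> i x) = t.\<tau> i (diff G (Suc i) w)" by blast
    have \<phi>x: "\<phi> i x \<in> carrier (G.T i)" by (rule module_hom_mem[OF \<phi>h x])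
    have dw: "diff G (Suc i) w \<in> carrier (G.T i)" by (rule G.diff_closed[OF w(1)])
    interpret FT: module R "F.T i" by (rule F.free_module_module)
    interpret \<tau>: mod_hom R "G.T i" "t.TP i" "t.\<tau> i" by (rule F.mod_homI[OF F.free_module_module t.TP t.\<tau>_hom])
    interpret \<psi>: mod_hom R "G.T i" "F.T i" "\<psi> i" by (rule F.mod_homI[OF F.free_module_module F.free_module_module \<psi>h])
    \<comment> \<open>Now \<phi> x equals the boundary d w modulo the maximal ideal. Applying
      \<psi>, the boundary becomes d \<psi> w, which vanishes modulo the maximal ideal because
      \<open>F\<close> is minimal; hence so does \<psi> \<phi> x.\<close>
    have "t.\<tau> i (\<phi> i x \<ominus>\<^bsub>G.T i\<^esub> diff G (Suc i) w) = \<zero>\<^bsub>t.TP i\<^esub>" using w \<phi>x dw by simp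
    then have "\<phi> i x \<ominus>\<^bsub>G.T i\<^esub> diff G (Suc i) w \<in> ?co (rk G i)"
      by (simp only: \<tau>0[OF abelian_group.minus_closed[OF module.axioms(2)[OF F.free_module_module] \<phi>x dw]])
    then have "\<psi> i (\<phi> i x \<ominus>\<^bsub>G.T i\<^esub> diff G (Suc i) w) \<in> ?co (rk F i)" by (rule hom_co[OF \<psi>h])
    moreover have "\<psi> i (\<phi> i x \<ominus>\<^bsub>G.T i\<^esub> diff G (Suc i) w) = \<psi> i (\<phi> i x) \<ominus>\<^bsub>F.T i\<^esub> \<psi> i (diff G (Suc i) w)"
      using \<phi>x dw by simp
    moreover have \<psi>d: "\<psi> i (diff G (Suc i) w) \<in> ?co (rk F i)"
      using dF_co[OF module_hom_mem[OF \<psi>h w(1)]] GF.chain_mapD(2)[OF \<psi>(1) w(1)] by simp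
    ultimately have "(\<psi> i (\<phi> i x) \<ominus>\<^bsub>F.T i\<^esub> \<psi> i (diff G (Suc i) w)) \<oplus>\<^bsub>F.T i\<^esub> \<psi> i (diff G (Suc i) w) \<in> ?co (rk F i)"
      using submodule.m_closed[OF co_sub] by simp
    moreover have \<psi>\<phi>x: "\<psi> i (\<phi> i x) \<in> carrier (F.T i)" by (rule module_hom_mem[OF \<psi>h \<phi>x])
    ultimately have co1: "\<psi> i (\<phi> i x) \<in> ?co (rk F i)"
      using co_carr[OF \<psi>d] by (simp add: a_minus_def FT.M.a_assoc FT.M.l_neg)
    obtain h where hh: "\<And>j. h j \<in> module_hom R (F.T j) (F.T (Suc j))"
      and h0: "\<And>x. x \<in> carrier (F.T 0) \<Longrightarrow> \<psi> 0 (\<phi> 0 x) \<ominus>\<^bsub>F.T 0\<^esub> x = diff F 1 (h 0 x)"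
      and hS: "\<And>j x. x \<in> carrier (F.T (Suc j)) \<Longrightarrow> \<psi> (Suc j) (\<phi> (Suc j) x) \<ominus>\<^bsub>F.T (Suc j)\<^esub> x =
        diff F (Suc (Suc j)) (h (Suc j) x) \<oplus>\<^bsub>F.T (Suc j)\<^esub> h j (diff F (Suc j) x)"
      using composite_homotopy[OF \<phi> \<psi>] by blast
    \<comment> \<open>Both homotopy terms d h x and h d x contain a differential of the minimal
      resolution, so \<psi> \<phi> is the identity modulo the maximal ideal, and \<open>x\<close>
      itself vanishes there.\<close>
    have co2: "\<psi> i (\<phi> i x) \<ominus>\<^bsub>F.T i\<^esub> x \<in> ?co (rk F i)"
    proof (cases i)
      case 0
      then show ?thesis using h0 x dF_co[OF module_hom_mem[OF hh x]] by simp
    next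
      case (Suc j)
      have "diff F (Suc i) (h i x) \<in> ?co (rk F i)" by (rule dF_co[OF module_hom_mem[OF hh x]])
      moreover have "h j (diff F (Suc j) x) \<in> ?co (rk F (Suc j))"
        using dF_co x Suc by (intro hom_co[OF hh]) simp
      ultimately show ?thesis using hS[of x j] x Suc submodule.m_closed[OF co_sub] by simp
    qed
    have "\<psi> i (\<phi> i x) \<ominus>\<^bsub>F.T i\<^esub> (\<psi> i (\<phi> i x) \<ominus>\<^bsub>F.T i\<^esub> x) \<in> ?co (rk F i)"
      by (rule submodule_minus_closed[OF co_sub co1 co2])
    moreover have "\<psi> i (\<phi> i x) \<ominus>\<^bsub>F.T i\<^esub> (\<psi> i (\<phi> i x) \<ominus>\<^bsub>F.T i\<^esub> x) = x"
      by (rule abelian_group.diff_diff_cancel[OF module.axioms(2)[OF F.free_module_module] \<psi>\<phi>x x])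
    ultimately show "x \<in> ?co (rk F i)" by simp
  qed
  show ?thesis unfolding H_eq
    by (rule F.dim_free_quotient[OF min.max_ideal(1) Q.quot_module_module u_hom u_surj ker])
qed

end

lemma (in minimal_resolution) betti_eq: "betti R M i = rk F i"
proof -
  define G where "G = (SOME G. free_resolution R M G)"
  \<comment> \<open>The given \<open>F\<close> witnesses that a resolution exists, so the choice
    inside \<open>Tor\<close> does return one.\<close>
  have "free_resolution R M G" unfolding G_def using resolution by (rule someI)
  then have "resolution R M G"
    using noeth module_M is_cring by (simp add: resolution_def resolution_axioms_def)
  then interpret c: minimal_comparison R M F G
    using resolution_axioms minimal_resolution_axioms
    by (simp add: minimal_comparison_def two_resolutions_def)
  show ?thesis unfolding betti_def Tor_def G_def[symmetric] by (rule c.tensor_homology_dim)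
qed

theorem corollary2:
  fixes R :: "('a, 'r) ring_scheme"
    and M :: "('a, 'b, 'm) module_scheme"
    and F :: "('a, 'b) free_complex"
  assumes "noetherian_ring R" and "local_ring R" and "equidimensional R"
    and "fin_gen_module R M"
    and "minimal_free_resolution R M F"
    and "\<exists>N\<^sub>0. \<forall>i\<ge>N\<^sub>0. betti R M i \<le> betti R M (Suc i)"
  shows "\<exists>c N. \<forall>i\<ge>N. module_krull_dim R (syzygy R F i) = c"
proof -
  have "cring R" "module R M" "free_resolution R M F"
    using assms by (auto simp: local_ring_def fin_gen_module_def minimal_free_resolution_def)
  then interpret minimal_resolution R M F
    using assms by (simp add: minimal_resolution_def minimal_resolution_axioms_def resolution_def resolution_axioms_def)
  obtain N0 where "\<forall>i\<ge>N0. rk F i \<le> rk F (Suc i)" using assms(6) unfolding betti_eq by blast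
  then show ?thesis using eventually_constant_dim[OF assms(3)] by blast
qed

end
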